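(* Let $\epsilon>0$. There is a constant $K_\epsilon>0$, depending only on $\epsilon$, such that for all real $x \ge 2$ and $1 \le Q \leq x^{1-\epsilon}$, $$ \sum_{q \leq Q}\ \sum_{\substack{\varphi \in \widehat{\mathrm{G}}_q \\ \varphi \neq I}} \left|\ \mathop{{\sum}'}_{p \leq x} \varphi(\sigma_p) \right|^2 \ \leq\ K_\epsilon\left( (Q^2 + x)\, \pi(x) \ +\ \sum_{q \leq Q}\ \sum_{c, d \in \mathbb{F}_q^{*} } \left|\ \mathop{{\sum}'}_{p \leq x} e\left(\frac{pd - i_p c}{q}\right) \right|^2\right). $$
   Context: Notation: $e(t) = e^{2\pi i t}$; $\pi(x)$ is the number of primes $\le x$. The sum $\sum_{q\le Q}$ runs over odd primes $q \le Q$; $\mathbb{F}_q^{*}$ is identified with the residues $\{1,\dots,q-1\}$ modulo $q$. For an odd prime $p$, $i_p = [\mathbb{F}_p^* : \langle 2\rangle]$ denotes the index of the subgroup generated by $2$ modulo $p$. The primed sum $\mathop{{\sum}'}_{p\le x}$ runs over odd primes $p \le x$ satisfying $i_p \le \sqrt{x}\,\log x$. For an odd prime $q$, $L_q = \mathbb{Q}(e^{2\pi i/q}, 2^{1/q})$, $\mathrm{G}_q = \mathrm{Gal}(L_q/\mathbb{Q})$, and $\widehat{\mathrm{G}}_q$ is the set of irreducible complex characters of $\mathrm{G}_q$; $I$ denotes the trivial character. The group $\mathrm{G}_q$ is isomorphic to the group of matrices $\begin{bmatrix} a & b\\ 0 & 1\end{bmatrix}$ with $a\in\mathbb{F}_q^*$,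 $b\in\mathbb{F}_q$, where such a matrix corresponds to $\zeta_q\mapsto\zeta_q^a$, $2^{1/q}\mapsto \zeta_q^b 2^{1/q}$ ($\zeta_q=e^{2\pi i/q}$). It has $q$ irreducible characters: $q-1$ one-dimensional ones, given by $\begin{bmatrix} a & b\\ 0 & 1\end{bmatrix}\mapsto\chi(a)$ for Dirichlet characters $\chi$ modulo $q$, and one character $\varphi_q$ of dimension $q-1$. For an odd prime $p\ne q$, $\sigma_p$ denotes a Frobenius element of $p$ in $\mathrm{G}_q$ (well defined up to conjugacy, so $\varphi(\sigma_p)$ is well defined). For $p=q$ one sets $\varphi(\sigma_p)=0$ for every $\varphi\in\widehat{\mathrm{G}}_q$, $\varphi\ne I$. *)

theory Defs
  imports
    "HOL-Algebra.Bij"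
    "HOL-Algebra.Generated_Fields"
    "HOL-Algebra.Generated_Groups"
    "HOL-Algebra.QuotRing"
    "HOL-Number_Theory.Residues"
    "Jordan_Normal_Form.VS_Connect"
begin

section \<open>Primes, the index of 2, and the additive character\<close>

definition e_unit :: "real \<Rightarrow> complex" where
  "e_unit t = exp (2 * of_real pi * \<i> * of_real t)"

definition prime_pi :: "real \<Rightarrow> nat" where
  "prime_pi x = card {p :: nat. Factorial_Ring.prime p \<and> real p \<le> x}"

definition odd_primes_upto :: "real \<Rightarrow> nat set" where
  "odd_primes_upto x = {p :: nat. Factorial_Ring.prime p \<and> odd p \<and> real p \<le> x}"

definition index_of_two :: "nat \<Rightarrow> nat" where
  "index_of_two p =
     (let U = units_of (residue_ring (int p)) in card (rcosets\<^bsub>U\<^esub> (generate U {2})))"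

text \<open>The range of the primed sum over \<open>p \<le> x\<close>.\<close>

definition primed_primes :: "real \<Rightarrow> nat set" where
  "primed_primes x = {p \<in> odd_primes_upto x. real (index_of_two p) \<le> sqrt x * ln x}"

section \<open>Subfields of the complex numbers, Galois groups, Frobenius elements\<close>

definition rat_adjoin :: "complex set \<Rightarrow> complex set" where
  "rat_adjoin S = generate_field class_ring (\<rat> \<union> S)"

definition gal_Q :: "complex set \<Rightarrow> (complex \<Rightarrow> complex) monoid" where
  "gal_Q L = (BijGroup L)
     \<lparr>carrier := {\<sigma> \<in> Bij L. \<sigma> \<in> Ring.ring_hom (class_ring\<lparr>carrier := L\<rparr>) (class_ring\<lparr>carrier := L\<rparr>)
                             \<and> (\<forall>r \<in> \<rat>. \<sigma> r = r)}\<rparr>"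

definition integers_of :: "complex set \<Rightarrow> complex ring" where
  "integers_of L = class_ring\<lparr>carrier := {\<alpha> \<in> L. algebraic_int \<alpha>}\<rparr>"

text \<open>
  \<open>\<sigma>\<close> is a Frobenius element at some prime of \<open>L\<close> above \<open>p\<close>. The congruence implies that \<open>\<sigma>\<close>
  stabilises that prime. The notion is only used when \<open>p\<close> is unramified in \<open>L\<close>, where these
  elements form one conjugacy class.
\<close>

definition is_frobenius :: "complex set \<Rightarrow> nat \<Rightarrow> (complex \<Rightarrow> complex) \<Rightarrow> bool" where
  "is_frobenius L p \<sigma> \<longleftrightarrow> \<sigma> \<in> carrier (gal_Q L) \<and>
     (\<exists>P. primeideal P (integers_of L) \<and> of_nat p \<in> P \<and>
          (\<forall>\<alpha> \<in> carrier (integers_of L). \<sigma> \<alpha> - \<alpha> ^ p \<in> P))"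

section \<open>Irreducible complex characters\<close>

definition representation ::
    "('g, 'm) monoid_scheme \<Rightarrow> nat \<Rightarrow> ('g \<Rightarrow> complex mat) \<Rightarrow> bool" where
  "representation G n \<rho> \<longleftrightarrow> \<rho> \<in> hom G (units_of (ring_mat TYPE(complex) n ()))"

definition irreducible_rep ::
    "('g, 'm) monoid_scheme \<Rightarrow> nat \<Rightarrow> ('g \<Rightarrow> complex mat) \<Rightarrow> bool" where
  "irreducible_rep G n \<rho> \<longleftrightarrow> representation G n \<rho> \<and> n > 0 \<and>
     (\<forall>W. VectorSpace.subspace class_ring W (module_vec TYPE(complex) n) \<and>
          (\<forall>g \<in> carrier G. \<forall>w \<in> W. \<rho> g *\<^sub>v w \<in> W)
          \<longrightarrow> W = {0\<^sub>v n} \<or> W = carrier_vec n)"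

text \<open>
  Characters are made extensional on \<open>carrier G\<close>, so that distinct elements of \<open>irr_chars G\<close> are
  distinct as functions on the group.
\<close>

definition character_of ::
    "('g, 'm) monoid_scheme \<Rightarrow> nat \<Rightarrow> ('g \<Rightarrow> complex mat) \<Rightarrow> 'g \<Rightarrow> complex" where
  "character_of G n \<rho> = (\<lambda>g \<in> carrier G. \<Sum>i<n. \<rho> g $$ (i, i))"

definition irr_chars :: "('g, 'm) monoid_scheme \<Rightarrow> ('g \<Rightarrow> complex) set" where
  "irr_chars G = {character_of G n \<rho> | n \<rho>. irreducible_rep G n \<rho>}"

definition trivial_char :: "('g, 'm) monoid_scheme \<Rightarrow> 'g \<Rightarrow> complex" where
  "trivial_char G = (\<lambda>g \<in> carrier G. 1)"

section \<open>The Kummer fields\<close>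

definition L_field :: "nat \<Rightarrow> complex set" where
  "L_field q = rat_adjoin {e_unit (1 / real q), of_real (root q 2)}"

definition G_group :: "nat \<Rightarrow> (complex \<Rightarrow> complex) monoid" where
  "G_group q = gal_Q (L_field q)"

text \<open>
  \<open>\<sigma> q p\<close> is some choice of Frobenius element of \<open>p\<close> in \<open>G_group q\<close>, for all odd primes
  \<open>p \<noteq> q\<close>.
\<close>

definition frobenius_choice :: "(nat \<Rightarrow> nat \<Rightarrow> complex \<Rightarrow> complex) \<Rightarrow> bool" where
  "frobenius_choice \<sigma> \<longleftrightarrow>
     (\<forall>q p. Factorial_Ring.prime q \<and> odd q \<and> Factorial_Ring.prime p \<and> odd p \<and> p \<noteq> q
        \<longrightarrow> is_frobenius (L_field q) p (\<sigma> q p))"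

definition char_at_frobenius ::
    "(nat \<Rightarrow> nat \<Rightarrow> complex \<Rightarrow> complex) \<Rightarrow> nat \<Rightarrow> ((complex \<Rightarrow> complex) \<Rightarrow> complex) \<Rightarrow> nat \<Rightarrow> complex" where
  "char_at_frobenius \<sigma> q \<phi> p = (if p = q then 0 else \<phi> (\<sigma> q p))"

end

theory Submission
  imports
    Defs
    "HOL-Number_Theory.Residue_Primitive_Roots"
    "Jordan_Normal_Form.Spectral_Radius"
begin

text \<open>
  Write \<open>P\<close> for the range of the primed sum and \<open>S(d/q) = \<Sum>\<^sub>p e(pd/q)\<close>.
  The nontrivial linear characters contribute at most the variance of \<open>P\<close> in residue classes
  mod \<open>q\<close>, that is \<open>\<Sum>\<^sub>d |S(d/q)|\<^sup>2\<close> over \<open>d \<noteq> 0\<close>; the large sieve bounds this on average.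
  Kummer theory gives \<open>\<phi>\<^sub>q(\<sigma>\<^sub>p) = q [q | i\<^sub>p] - [p \<equiv> 1 (mod q)]\<close>, hence a sum
  \<open>q A - B\<close> of two counts. With \<open>D = B - |P|/q\<close> and \<open>E\<close> the part \<open>c, d \<noteq> 0\<close> of the Fourier
  expansion of the condition \<open>p \<equiv> 1, i\<^sub>p \<equiv> 0 (mod q)\<close> one has \<open>(q - 1) A = D + E\<close>, because
  \<open>q | i\<^sub>p\<close> already forces \<open>p \<equiv> 1\<close>. So \<open>q A - B\<close> is controlled by \<open>D\<close> (large sieve),
  by \<open>E\<close> (the double sum on the right) and by \<open>|P|/q\<close>. No equidistribution of primes beyond
  the large sieve enters.

  Neither the irreducibility of the cyclotomic polynomial nor that of \<open>X\<^sup>q - 2\<close> is needed.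
  The Frobenius elements at the odd primes generate the quotient \<open>(\<int>/q)\<^sup>*\<close>, and if the Galois
  group contained no translations, it would merely have fewer irreducible characters.
\<close>

section \<open>The large sieve\<close>

text \<open>The danger in \<open>q A - B\<close> is the weight \<open>q\<close> on \<open>A\<close>.
  It disappears on rewriting: \<open>(q - 1) A = D + E\<close> gives
  \<open>q A - B = A + E - |P|/q\<close> and \<open>0 <= A <= |D| + |E|\<close>. Cauchy-Schwarz over
  the \<open>(q - 1)^2\<close> frequencies of \<open>E\<close> loses at most \<open>q^2\<close>,
  which the normalisation \<open>1/q\<close> of the Fourier expansion pays back in full. The term
  \<open>|P|/q\<close> is harmless because \<open>|P|^2 <= x pi(x)\<close> and the sum of
  \<open>1/q^2\<close> converges. The ramified prime disturbs the comparison of variances: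
  \<open>p = q\<close> counts as zero in every nontrivial character but is present in
  \<open>S(d/q)\<close>. Characters come from arbitrary matrix representations, so their values have
  to be extracted from invariant subspaces: from an eigenvector of a lift of a primitive root if
  translations act trivially, and otherwise from the eigenspaces of a translation.\<close>

lemma e_unit_cis: "e_unit t = cis (2 * pi * t)"
  by (simp add: e_unit_def cis_conv_exp mult_ac)

lemma e_unit_0 [simp]: "e_unit 0 = 1"
  by (simp add: e_unit_cis)

lemma e_unit_add: "e_unit (s + t) = e_unit s * e_unit t"
  by (simp add: e_unit_cis cis_mult algebra_simps)

lemma e_unit_minus: "e_unit (- t) = cnj (e_unit t)"
  by (simp add: e_unit_cis cis_cnj)

lemma norm_e_unit [simp]: "cmod (e_unit t) = 1"
  by (simp add: e_unit_cis)

lemma e_unit_nonzero [simp]: "e_unit t \<noteq> 0"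
  by (metis norm_e_unit norm_zero zero_neq_one)

lemma e_unit_power: "e_unit t ^ n = e_unit (real n * t)"
  by (induction n) (simp_all add: distrib_right e_unit_add)

lemma e_unit_eq_1_iff: "e_unit t = 1 \<longleftrightarrow> t \<in> \<int>"
proof -
  have "e_unit t = 1 \<longleftrightarrow> cos (2 * pi * t) = 1"
    by (auto simp: e_unit_cis complex_eq_iff cos_one_sin_zero)
  also have "\<dots> \<longleftrightarrow> (\<exists>n::int. 2 * pi * t = of_int n * (2 * pi))"
    by (simp add: cos_one_2pi_int mult.assoc)
  also have "\<dots> \<longleftrightarrow> (\<exists>n::int. t = of_int n)"
    by (simp add: mult.commute)
  finally show ?thesis by (auto elim!: Ints_cases)
qed

lemma e_unit_diff_int: "k \<in> \<int> \<Longrightarrow> e_unit (t + k) = e_unit t"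
  using e_unit_eq_1_iff by (simp add: e_unit_add)

lemma of_int_divide_in_Ints_iff:
  "real_of_int k / real m \<in> \<int> \<longleftrightarrow> int m dvd k" if "m > 0"
proof
  assume "real_of_int k / real m \<in> \<int>"
  then obtain z where "real_of_int k / real m = of_int z" by (auto elim: Ints_cases)
  then have "real_of_int k = of_int (z * int m)" using that by (simp add: field_simps)
  then have "k = z * int m" by linarith
  then show "int m dvd k" by simp
next
  assume "int m dvd k"
  then obtain z where "k = int m * z" by auto
  then show "real_of_int k / real m \<in> \<int>" using that by simp
qed

lemma sum_e_unit_orthogonality:
  assumes "m > 0"
  shows "(\<Sum>j<m. e_unit (real j * of_int k / real m)) = (if int m dvd k then of_nat m else 0)"
proof -
  let ?w = "e_unit (of_int k / real m)"
  have pow: "e_unit (real j * of_int k / real m) = ?w ^ j" for j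
    by (simp add: e_unit_power)
  have w1: "?w = 1 \<longleftrightarrow> int m dvd k"
    using assms by (simp add: e_unit_eq_1_iff of_int_divide_in_Ints_iff)
  show ?thesis
  proof (cases "int m dvd k")
    case True
    then show ?thesis using w1 by (simp add: pow)
  next
    case False
    have "?w ^ m = 1"
      using assms by (simp add: e_unit_power e_unit_eq_1_iff)
    then show ?thesis using False w1 by (simp add: pow geometric_sum)
  qed
qed

lemma cmod_sum_square:
  "complex_of_real ((cmod (\<Sum>p\<in>S. f p))\<^sup>2) = (\<Sum>p\<in>S. \<Sum>r\<in>S. f p * cnj (f r))"
  unfolding complex_norm_square cnj_sum by (rule sum_product)

text \<open>Parseval on Z/m for the number of elements of \<open>S\<close> in each class of
  \<open>k\<close>. It is applied with \<open>m = q\<close> to additive characters, and with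
  \<open>m = q - 1\<close> and \<open>k\<close> a discrete logarithm to multiplicative ones.\<close>

lemma sum_exponential_parseval:
  fixes k :: "'a \<Rightarrow> int"
  assumes "m > 0"
  shows "(\<Sum>j<m. (cmod (\<Sum>p\<in>S. e_unit (real j * of_int (k p) / real m)))\<^sup>2)
    = real m * (\<Sum>p\<in>S. \<Sum>r\<in>S. of_bool (int m dvd k p - k r))"
proof -
  have "complex_of_real (\<Sum>j<m. (cmod (\<Sum>p\<in>S. e_unit (real j * of_int (k p) / real m)))\<^sup>2)
    = (\<Sum>j<m. \<Sum>p\<in>S. \<Sum>r\<in>S. e_unit (real j * of_int (k p - k r) / real m))"
    unfolding of_real_sum cmod_sum_square
    by (intro sum.cong refl)
      (simp flip: e_unit_minus e_unit_add add: diff_divide_distrib algebra_simps)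
  also have "\<dots> = (\<Sum>p\<in>S. \<Sum>r\<in>S. \<Sum>j<m. e_unit (real j * of_int (k p - k r) / real m))"
    by (subst sum.swap, rule sum.cong[OF refl], rule sum.swap)
  also have "\<dots> = (\<Sum>p\<in>S. \<Sum>r\<in>S. of_nat m * of_bool (int m dvd k p - k r))"
    unfolding sum_e_unit_orthogonality[OF assms] by (intro sum.cong refl) auto
  also have "\<dots> = complex_of_real (real m * (\<Sum>p\<in>S. \<Sum>r\<in>S. of_bool (int m dvd k p - k r)))"
    by (simp add: sum_distrib_left of_bool_def if_distrib cong: if_cong)
  finally show ?thesis unfolding of_real_eq_iff .
qed

section \<open>Inverse squares over separated points\<close>

lemma sum_inverse_square_le: "N \<ge> 1 \<Longrightarrow> (\<Sum>n=1..N. 1 / (real n)\<^sup>2) \<le> 2 - 1 / real N"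
proof (induction N rule: nat_induct_at_least)
  case (Suc N)
  have "1 / (real (Suc N))\<^sup>2 \<le> 1 / (real N * real (Suc N))"
    using Suc.hyps by (intro divide_left_mono) (auto simp: power2_eq_square)
  also have "\<dots> = 1 / real N - 1 / real (Suc N)"
    using Suc.hyps by (simp add: field_simps)
  finally show ?case using Suc.IH by simp
qed simp

lemma sum_inverse_square_le_2:
  assumes "finite A" "0 \<notin> A"
  shows "(\<Sum>n\<in>A. 1 / (real n)\<^sup>2) \<le> 2"
proof -
  have "A \<subseteq> {1..Max (insert 1 A)}"
    using assms by (auto simp: Suc_le_eq intro: gr0I)
  then have "(\<Sum>n\<in>A. 1 / (real n)\<^sup>2) \<le> (\<Sum>n=1..Max (insert 1 A). 1 / (real n)\<^sup>2)"
    by (intro sum_mono2) auto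
  also have "\<dots> \<le> 2 - 1 / real (Max (insert 1 A))"
    using assms(1) by (intro sum_inverse_square_le) simp
  also have "\<dots> \<le> 2" by simp
  finally show ?thesis .
qed

lemma sum_inverse_square_int_le_4:
  assumes "finite A" "(0::int) \<notin> A"
  shows "(\<Sum>k\<in>A. 1 / (real_of_int k)\<^sup>2) \<le> 4"
proof -
  let ?P = "{k\<in>A. k > 0}" and ?N = "{k\<in>A. k < 0}"
  have *: "(\<Sum>k\<in>B. 1 / (real_of_int k)\<^sup>2) \<le> 2"
    if B: "B \<subseteq> A" "inj_on (\<lambda>k. nat \<bar>k\<bar>) B" for B
  proof -
    have "(\<Sum>k\<in>B. 1 / (real_of_int k)\<^sup>2) = (\<Sum>n\<in>(\<lambda>k. nat \<bar>k\<bar>) ` B. 1 / (real n)\<^sup>2)"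
      using B(2) by (subst sum.reindex) auto
    also have "\<dots> \<le> 2"
      using assms B finite_subset by (intro sum_inverse_square_le_2) auto
    finally show ?thesis .
  qed
  have A: "A = ?P \<union> ?N" using assms(2) by (auto simp: not_less order_le_less)
  have "(\<Sum>k\<in>A. 1 / (real_of_int k)\<^sup>2) = (\<Sum>k\<in>?P. 1 / (real_of_int k)\<^sup>2) + (\<Sum>k\<in>?N. 1 / (real_of_int k)\<^sup>2)"
    by (subst A, rule sum.union_disjoint) (use assms in auto)
  also have "\<dots> \<le> 2 + 2"
    by (intro add_mono *) (auto simp: inj_on_def)
  finally show ?thesis by simp
qed

text \<open>The cell number \<open>floor (\<theta> / \<delta>)\<close> is injective on
  \<open>S\<close>, as two points of one cell would be too close, and it is never 0. This compares
  the sum with one over nonzero integers. The 16 is a 4 from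
  \<open>|\<theta>| >= |k| \<delta> / 2\<close> times the 4 that bounds the sum over
  integers.\<close>

lemma spaced_sum_inverse_square:
  fixes \<theta> :: "'a \<Rightarrow> real"
  assumes "finite S" "\<delta> > 0"
    and away: "\<And>r. r \<in> S \<Longrightarrow> \<bar>\<theta> r\<bar> \<ge> \<delta>"
    and spaced: "\<And>r s. r \<in> S \<Longrightarrow> s \<in> S \<Longrightarrow> r \<noteq> s \<Longrightarrow> \<bar>\<theta> r - \<theta> s\<bar> \<ge> \<delta>"
  shows "(\<Sum>r\<in>S. 1 / (\<theta> r)\<^sup>2) \<le> 16 / \<delta>\<^sup>2"
proof -
  define k where "k r = \<lfloor>\<theta> r / \<delta>\<rfloor>" for r
  have k: "real_of_int (k r) * \<delta> \<le> \<theta> r" "\<theta> r < (real_of_int (k r) + 1) * \<delta>" for r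
    using assms(2) unfolding k_def
    by (metis floor_divide_lower, metis floor_divide_upper)
  have inj: "inj_on k S"
  proof
    fix r s assume rs: "r \<in> S" "s \<in> S" "k r = k s"
    have "\<theta> r - \<theta> s < \<delta>" "\<theta> s - \<theta> r < \<delta>"
      using k[of r] k[of s] rs(3) by (simp_all add: algebra_simps)
    then show "r = s" using spaced[of r s] rs by fastforce
  qed
  have nz: "k r \<noteq> 0" if "r \<in> S" for r
    using k[of r] away[OF that] by (auto simp: abs_if split: if_splits)
  have bound: "1 / (\<theta> r)\<^sup>2 \<le> (4 / \<delta>\<^sup>2) * (1 / (real_of_int (k r))\<^sup>2)" if "r \<in> S" for r
  proof -
    \<comment> \<open>The halving is for negative \<open>k\<close>, where only
      \<open>|\<theta>| > (|k| - 1) \<delta>\<close> is known; this suffices from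
      \<open>|k| = 2\<close> on, and \<open>k = -1\<close> uses the distance from 0 instead.\<close>
    have "\<bar>real_of_int (k r)\<bar> * \<delta> / 2 \<le> \<bar>\<theta> r\<bar>"
    proof (cases "k r \<ge> 1 \<or> k r = -1")
      case True
      then show ?thesis
      proof
        assume "1 \<le> k r"
        then have "0 \<le> real_of_int (k r) * \<delta>" using assms(2) by simp
        then show ?thesis using k(1)[of r] \<open>1 \<le> k r\<close> by simp
      qed (use away[OF that] assms(2) in auto)
    next
      case False
      then have "k r \<le> -2" using nz[OF that] by linarith
      then have "real_of_int (k r) + 1 \<le> real_of_int (k r) / 2" by linarith
      then have "(real_of_int (k r) + 1) * \<delta> \<le> real_of_int (k r) / 2 * \<delta>"
        using assms(2) by (intro mult_right_mono) auto
      then have "\<theta> r \<le> real_of_int (k r) * \<delta> / 2" using k(2)[of r] by simp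
      moreover have "real_of_int (k r) * \<delta> < 0" using \<open>k r \<le> -2\<close> assms(2) by (simp add: mult_neg_pos)
      ultimately show ?thesis using \<open>k r \<le> -2\<close> by (simp add: abs_if)
    qed
    then have "(\<bar>real_of_int (k r)\<bar> * \<delta> / 2)\<^sup>2 \<le> \<bar>\<theta> r\<bar>\<^sup>2"
      using assms(2) by (intro power_mono) auto
    then have "(real_of_int (k r))\<^sup>2 * \<delta>\<^sup>2 / 4 \<le> (\<theta> r)\<^sup>2"
      by (simp add: power_mult_distrib power_divide)
    moreover have "0 < (real_of_int (k r))\<^sup>2 * \<delta>\<^sup>2 / 4" using nz[OF that] assms(2) by simp
    ultimately have "1 / (\<theta> r)\<^sup>2 \<le> 1 / ((real_of_int (k r))\<^sup>2 * \<delta>\<^sup>2 / 4)"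
      by (intro frac_le) auto
    then show ?thesis by (simp add: mult_ac)
  qed
  have "(\<Sum>r\<in>S. 1 / (\<theta> r)\<^sup>2) \<le> (\<Sum>r\<in>S. (4 / \<delta>\<^sup>2) * (1 / (real_of_int (k r))\<^sup>2))"
    by (intro sum_mono bound)
  also have "\<dots> = (4 / \<delta>\<^sup>2) * (\<Sum>z\<in>k ` S. 1 / (real_of_int z)\<^sup>2)"
    using inj by (simp add: sum.reindex sum_distrib_left)
  also have "\<dots> \<le> (4 / \<delta>\<^sup>2) * 4"
    using nz assms(1) by (intro mult_left_mono sum_inverse_square_int_le_4) auto
  finally show ?thesis by simp
qed


section \<open>Geometric sums of additive characters\<close>

lemma sin_ge_half:
  assumes "0 \<le> x" "x \<le> pi / 2"
  shows "x / 2 \<le> sin x"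
proof -
  \<comment> \<open>Halving the angle: \<open>sin x = 2 sin y cos y >= 2 y cos^2 y\<close>, and
    \<open>cos^2 y >= 1/2\<close> up to \<open>pi/4\<close>. The inequality
    \<open>y cos y <= sin y\<close> comes from the derivative \<open>- t sin t\<close> of the
    difference.\<close>
  define y where "y = x / 2"
  have y: "0 \<le> y" "y \<le> pi / 4" using assms by (auto simp: y_def)
  have "0 * cos 0 - sin 0 \<ge> y * cos y - sin y"
  proof (rule DERIV_nonpos_imp_nonincreasing[OF y(1)])
    fix t assume t: "0 \<le> t" "t \<le> y"
    have "((\<lambda>t. t * cos t - sin t) has_real_derivative (- t * sin t)) (at t)"
      by (auto intro!: derivative_eq_intros)
    moreover have "sin t \<ge> 0" using t y pi_gt_zero by (intro sin_ge_zero) linarith+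
    ultimately show "\<exists>z. ((\<lambda>t. t * cos t - sin t) has_real_derivative z) (at t) \<and> z \<le> 0"
      using t by (intro exI[of _ "- t * sin t"]) auto
  qed
  then have 1: "y * cos y \<le> sin y" by simp
  have "cos (pi / 4) \<le> cos y" using y pi_gt_zero by (intro cos_monotone_0_pi_le) linarith+
  then have 2: "sqrt 2 / 2 \<le> cos y" by (simp add: cos_45)
  then have "(sqrt 2 / 2)\<^sup>2 \<le> (cos y)\<^sup>2" by (intro power_mono) auto
  then have "1 / 2 \<le> (cos y)\<^sup>2" by (simp add: power_divide)
  then have "x / 2 \<le> x * (cos y)\<^sup>2"
    using mult_left_mono[of "1/2" "(cos y)\<^sup>2" x] assms(1) by simp
  also have "\<dots> = 2 * (y * cos y) * cos y" by (simp add: y_def power2_eq_square)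
  also have "\<dots> \<le> 2 * sin y * cos y"
    using 1 2 order_trans[OF _ 2, of 0] by (intro mult_right_mono mult_left_mono) auto
  also have "\<dots> = sin x" by (simp add: y_def flip: sin_double)
  finally show ?thesis .
qed

lemma norm_1_minus_e_unit: "cmod (1 - e_unit t) = 2 * \<bar>sin (pi * t)\<bar>"
proof -
  have "1 - e_unit t = e_unit (t / 2) * (e_unit (- (t / 2)) - e_unit (t / 2))"
    by (simp add: algebra_simps flip: e_unit_add)
  also have "e_unit (- (t / 2)) - e_unit (t / 2) = - 2 * \<i> * of_real (sin (pi * t))"
    by (simp add: e_unit_cis complex_eq_iff)
  finally show ?thesis by (simp add: norm_mult)
qed

lemma norm_1_minus_e_unit_ge:
  assumes "\<bar>t\<bar> \<le> 1 / 2"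
  shows "2 * \<bar>t\<bar> \<le> cmod (1 - e_unit t)"
proof -
  have "pi * \<bar>t\<bar> / 2 \<le> sin (pi * \<bar>t\<bar>)" using assms by (intro sin_ge_half) auto
  moreover have "sin (pi * \<bar>t\<bar>) \<le> \<bar>sin (pi * t)\<bar>" by (auto simp: abs_if)
  moreover have "2 * \<bar>t\<bar> \<le> pi * \<bar>t\<bar>" using pi_ge_two by (intro mult_right_mono) auto
  ultimately show ?thesis unfolding norm_1_minus_e_unit by linarith
qed

lemma norm_e_unit_geometric_sum_le:
  assumes "\<bar>t\<bar> \<le> 1 / 2" "t \<noteq> 0"
  shows "(cmod (\<Sum>h<H. e_unit (real h * t)))\<^sup>2 \<le> 1 / t\<^sup>2"
proof -
  have ge: "2 * \<bar>t\<bar> \<le> cmod (1 - e_unit t)" by (rule norm_1_minus_e_unit_ge) fact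
  then have ne: "e_unit t \<noteq> 1" using assms(2) by auto
  have "(\<Sum>h<H. e_unit (real h * t)) = (1 - e_unit (real H * t)) / (1 - e_unit t)"
    using ne by (simp add: sum_gp_strict flip: e_unit_power)
  then have "cmod (\<Sum>h<H. e_unit (real h * t)) = cmod (1 - e_unit (real H * t)) / cmod (1 - e_unit t)"
    by (simp add: norm_divide)
  also have "\<dots> \<le> 2 / (2 * \<bar>t\<bar>)"
    using ge assms(2) norm_triangle_ineq4[of 1 "e_unit (real H * t)"] by (intro frac_le) auto
  finally have "(cmod (\<Sum>h<H. e_unit (real h * t)))\<^sup>2 \<le> (1 / \<bar>t\<bar>)\<^sup>2"
    by (intro power_mono) auto
  then show ?thesis by (simp add: power_divide)
qed

section \<open>The Fejer kernel and duality\<close>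

lemma fejer_row_sum_le:
  fixes \<alpha> :: "'a \<Rightarrow> real"
  assumes R: "finite R" "r \<in> R" and \<delta>: "\<delta> > 0"
    and spaced: "\<And>r s k. r \<in> R \<Longrightarrow> s \<in> R \<Longrightarrow> r \<noteq> s \<Longrightarrow> \<delta> \<le> \<bar>\<alpha> r - \<alpha> s - of_int k\<bar>"
  shows "(\<Sum>s\<in>R. (cmod (\<Sum>h<H. e_unit (real h * (\<alpha> r - \<alpha> s))))\<^sup>2) \<le> (real H)\<^sup>2 + 16 / \<delta>\<^sup>2"
proof -
  \<comment> \<open>The sums only depend on the differences modulo 1, and the representatives in
    \<open>[-1/2, 1/2]\<close> inherit the spacing.\<close>
  define \<theta> where "\<theta> s = \<alpha> r - \<alpha> s - of_int (round (\<alpha> r - \<alpha> s))" for s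
  have half: "\<bar>\<theta> s\<bar> \<le> 1 / 2" for s
    using of_int_round_abs_le[of "\<alpha> r - \<alpha> s"] unfolding \<theta>_def by linarith
  have shift: "e_unit (real h * (\<alpha> r - \<alpha> s)) = e_unit (real h * \<theta> s)" for h s
  proof -
    have "real h * (\<alpha> r - \<alpha> s) = real h * \<theta> s + real h * of_int (round (\<alpha> r - \<alpha> s))"
      by (simp add: \<theta>_def algebra_simps)
    then show ?thesis by (simp add: e_unit_diff_int)
  qed
  have away: "\<delta> \<le> \<bar>\<theta> s\<bar>" if "s \<in> R - {r}" for s
    using that spaced R unfolding \<theta>_def by auto
  have "(\<Sum>s\<in>R - {r}. (cmod (\<Sum>h<H. e_unit (real h * (\<alpha> r - \<alpha> s))))\<^sup>2) \<le> (\<Sum>s\<in>R - {r}. 1 / (\<theta> s)\<^sup>2)"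
    unfolding shift using half away \<delta>
    by (intro sum_mono norm_e_unit_geometric_sum_le) fastforce+
  also have "\<dots> \<le> 16 / \<delta>\<^sup>2"
  proof (rule spaced_sum_inverse_square)
    fix s t assume st: "s \<in> R - {r}" "t \<in> R - {r}" "s \<noteq> t"
    show "\<delta> \<le> \<bar>\<theta> s - \<theta> t\<bar>"
      using spaced[of t s "round (\<alpha> r - \<alpha> s) - round (\<alpha> r - \<alpha> t)"] st
      by (simp add: \<theta>_def algebra_simps)
  qed (use R \<delta> away in auto)
  finally show ?thesis
    using R by (simp add: sum.remove[of R r])
qed

text \<open>Every \<open>n <= N\<close> is a difference \<open>g - h\<close> of numbers below
  \<open>H\<close> in at least \<open>H - N\<close> ways, so the left side is at most the sum over
  all pairs \<open>g, h < H\<close>. Expanded, that sum is a Hermitian form in \<open>b\<close>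
  whose kernel has the absolute values \<open>F r s\<close>, squares of geometric sums. They are
  symmetric with bounded row sums, and Schur's test (AM-GM on \<open>b r\<close>,
  \<open>b s\<close>) finishes.\<close>

lemma large_sieve_dual:
  fixes \<alpha> :: "'a \<Rightarrow> real" and b :: "'a \<Rightarrow> complex"
  assumes R: "finite R" and \<delta>: "\<delta> > 0" and H: "N < H"
    and spaced: "\<And>r s k. r \<in> R \<Longrightarrow> s \<in> R \<Longrightarrow> r \<noteq> s \<Longrightarrow> \<delta> \<le> \<bar>\<alpha> r - \<alpha> s - of_int k\<bar>"
  shows "real (H - N) * (\<Sum>n\<le>N. (cmod (\<Sum>r\<in>R. b r * e_unit (real n * \<alpha> r)))\<^sup>2)
    \<le> ((real H)\<^sup>2 + 16 / \<delta>\<^sup>2) * (\<Sum>r\<in>R. (cmod (b r))\<^sup>2)"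
proof -
  define B where "B t = (\<Sum>r\<in>R. b r * e_unit (t * \<alpha> r))" for t
  define F where "F r s = (cmod (\<Sum>h<H. e_unit (real h * (\<alpha> r - \<alpha> s))))\<^sup>2" for r s
  define C where "C = (real H)\<^sup>2 + 16 / \<delta>\<^sup>2"
  have F_nonneg: "0 \<le> F r s" for r s by (simp add: F_def)
  have F_sym: "F r s = F s r" for r s
  proof -
    have "(\<Sum>h<H. e_unit (real h * (\<alpha> s - \<alpha> r))) = cnj (\<Sum>h<H. e_unit (real h * (\<alpha> r - \<alpha> s)))"
      unfolding cnj_sum by (simp flip: e_unit_minus add: algebra_simps)
    then show ?thesis unfolding F_def by (simp only: complex_mod_cnj)
  qed
  have row: "(\<Sum>s\<in>R. F r s) \<le> C" if "r \<in> R" for r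
    unfolding F_def C_def by (intro fejer_row_sum_le R that \<delta> spaced)
  have "real (H - N) * (\<Sum>n\<le>N. (cmod (B n))\<^sup>2) = (\<Sum>n\<le>N. \<Sum>h<H - N. (cmod (B (real (h + n) - real h)))\<^sup>2)"
    by (simp add: sum_distrib_left)
  also have "\<dots> = (\<Sum>(n, h)\<in>{..N} \<times> {..<H - N}. (cmod (B (real (h + n) - real h)))\<^sup>2)"
    by (rule sum.cartesian_product)
  also have "\<dots> = (\<Sum>(g, h)\<in>(\<lambda>(n, h). (h + n, h)) ` ({..N} \<times> {..<H - N}). (cmod (B (real g - real h)))\<^sup>2)"
    by (subst sum.reindex) (auto simp: inj_on_def intro!: sum.cong)
  also have "\<dots> \<le> (\<Sum>(g, h)\<in>{..<H} \<times> {..<H}. (cmod (B (real g - real h)))\<^sup>2)"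
    by (intro sum_mono2) auto
  also have "\<dots> = (\<Sum>g<H. \<Sum>h<H. (cmod (B (real g - real h)))\<^sup>2)"
    by (simp add: sum.cartesian_product)
  also have "\<dots> = cmod (complex_of_real (\<Sum>g<H. \<Sum>h<H. (cmod (B (real g - real h)))\<^sup>2))"
    by (simp only: norm_of_real) (simp add: sum_nonneg)
  also have "complex_of_real (\<Sum>g<H. \<Sum>h<H. (cmod (B (real g - real h)))\<^sup>2)
     = (\<Sum>g<H. \<Sum>h<H. \<Sum>r\<in>R. \<Sum>s\<in>R. b r * cnj (b s) *
          (e_unit (real g * (\<alpha> r - \<alpha> s)) * cnj (e_unit (real h * (\<alpha> r - \<alpha> s)))))"
    unfolding of_real_sum B_def cmod_sum_square
    by (intro sum.cong refl) (simp flip: e_unit_minus e_unit_add add: algebra_simps)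
  also have "\<dots> = (\<Sum>g<H. \<Sum>r\<in>R. \<Sum>s\<in>R. \<Sum>h<H. b r * cnj (b s) *
          (e_unit (real g * (\<alpha> r - \<alpha> s)) * cnj (e_unit (real h * (\<alpha> r - \<alpha> s)))))"
    by (intro sum.cong refl, subst sum.swap, intro sum.cong refl, rule sum.swap)
  also have "\<dots> = (\<Sum>r\<in>R. \<Sum>s\<in>R. \<Sum>g<H. \<Sum>h<H. b r * cnj (b s) *
          (e_unit (real g * (\<alpha> r - \<alpha> s)) * cnj (e_unit (real h * (\<alpha> r - \<alpha> s)))))"
    by (subst sum.swap, intro sum.cong refl, rule sum.swap)
  also have "\<dots> = (\<Sum>r\<in>R. \<Sum>s\<in>R. b r * cnj (b s) * of_real (F r s))"
    unfolding F_def cmod_sum_square by (simp add: sum_distrib_left)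
  also have "cmod \<dots> \<le> (\<Sum>r\<in>R. \<Sum>s\<in>R. cmod (b r) * cmod (b s) * F r s)"
    by (intro order.trans[OF norm_sum] sum_mono)
       (simp add: norm_mult F_nonneg)
  also have "\<dots> \<le> (\<Sum>r\<in>R. \<Sum>s\<in>R. ((cmod (b r))\<^sup>2 * F r s + (cmod (b s))\<^sup>2 * F s r) / 2)"
  proof (intro sum_mono)
    fix r s
    have "2 * (cmod (b r) * cmod (b s)) \<le> (cmod (b r))\<^sup>2 + (cmod (b s))\<^sup>2"
      using sum_squares_bound[of "cmod (b r)" "cmod (b s)"] by (simp add: mult_ac)
    then have "2 * (cmod (b r) * cmod (b s)) * F r s \<le> ((cmod (b r))\<^sup>2 + (cmod (b s))\<^sup>2) * F r s"
      by (intro mult_right_mono F_nonneg)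
    then show "cmod (b r) * cmod (b s) * F r s \<le> ((cmod (b r))\<^sup>2 * F r s + (cmod (b s))\<^sup>2 * F s r) / 2"
      unfolding F_sym[of s r] by (simp add: algebra_simps)
  qed
  also have "\<dots> = ((\<Sum>r\<in>R. \<Sum>s\<in>R. (cmod (b r))\<^sup>2 * F r s) + (\<Sum>r\<in>R. \<Sum>s\<in>R. (cmod (b s))\<^sup>2 * F s r)) / 2"
    by (simp add: sum.distrib flip: sum_divide_distrib)
  also have "(\<Sum>r\<in>R. \<Sum>s\<in>R. (cmod (b s))\<^sup>2 * F s r) = (\<Sum>r\<in>R. \<Sum>s\<in>R. (cmod (b r))\<^sup>2 * F r s)"
    by (rule sum.swap)
  also have "((\<Sum>r\<in>R. \<Sum>s\<in>R. (cmod (b r))\<^sup>2 * F r s) + (\<Sum>r\<in>R. \<Sum>s\<in>R. (cmod (b r))\<^sup>2 * F r s)) / 2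
      = (\<Sum>r\<in>R. (cmod (b r))\<^sup>2 * (\<Sum>s\<in>R. F r s))"
    unfolding sum_distrib_left by simp
  also have "\<dots> \<le> (\<Sum>r\<in>R. (cmod (b r))\<^sup>2 * C)"
    by (intro sum_mono mult_left_mono row) auto
  also have "\<dots> = C * (\<Sum>r\<in>R. (cmod (b r))\<^sup>2)"
    by (simp add: sum_distrib_left mult_ac)
  finally show ?thesis by (simp add: B_def C_def)
qed

lemma sum_cauchy_schwarz_real:
  fixes f g :: "'a \<Rightarrow> real"
  shows "(\<Sum>i\<in>S. f i * g i)\<^sup>2 \<le> (\<Sum>i\<in>S. (f i)\<^sup>2) * (\<Sum>i\<in>S. (g i)\<^sup>2)"
proof -
  let ?X = "(\<Sum>i\<in>S. (f i)\<^sup>2) * (\<Sum>i\<in>S. (g i)\<^sup>2)" and ?Y = "(\<Sum>i\<in>S. f i * g i)\<^sup>2"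
  have "0 \<le> (\<Sum>i\<in>S. \<Sum>j\<in>S. (f i * g j - f j * g i)\<^sup>2)" by (intro sum_nonneg) auto
  also have "\<dots> = (\<Sum>i\<in>S. \<Sum>j\<in>S. (f i)\<^sup>2 * (g j)\<^sup>2) + (\<Sum>i\<in>S. \<Sum>j\<in>S. (f j)\<^sup>2 * (g i)\<^sup>2)
      - 2 * (\<Sum>i\<in>S. \<Sum>j\<in>S. (f i * g i) * (f j * g j))"
    unfolding sum_distrib_left sum.distrib[symmetric] sum_subtractf[symmetric]
    by (intro sum.cong refl) (simp add: power2_eq_square algebra_simps)
  also have "(\<Sum>i\<in>S. \<Sum>j\<in>S. (f i)\<^sup>2 * (g j)\<^sup>2) = ?X" by (rule sum_product[symmetric])
  also have "(\<Sum>i\<in>S. \<Sum>j\<in>S. (f j)\<^sup>2 * (g i)\<^sup>2) = ?X" by (subst sum.swap) (rule sum_product[symmetric])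
  also have "(\<Sum>i\<in>S. \<Sum>j\<in>S. (f i * g i) * (f j * g j)) = ?Y"
    unfolding power2_eq_square by (rule sum_product[symmetric])
  finally show ?thesis by simp
qed

lemma sum_cauchy_schwarz_complex:
  "(cmod (\<Sum>i\<in>S. f i * g i))\<^sup>2 \<le> (\<Sum>i\<in>S. (cmod (f i))\<^sup>2) * (\<Sum>i\<in>S. (cmod (g i))\<^sup>2)"
proof -
  have "cmod (\<Sum>i\<in>S. f i * g i) \<le> (\<Sum>i\<in>S. cmod (f i) * cmod (g i))"
    by (rule order.trans[OF norm_sum]) (simp add: norm_mult)
  then have "(cmod (\<Sum>i\<in>S. f i * g i))\<^sup>2 \<le> (\<Sum>i\<in>S. cmod (f i) * cmod (g i))\<^sup>2"
    by (intro power_mono) auto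
  also have "\<dots> \<le> (\<Sum>i\<in>S. (cmod (f i))\<^sup>2) * (\<Sum>i\<in>S. (cmod (g i))\<^sup>2)"
    by (rule sum_cauchy_schwarz_real)
  finally show ?thesis .
qed

text \<open>Duality: the left side \<open>X\<close> is the pairing of \<open>a\<close> with the dual
  sums for the coefficients \<open>cnj (S r)\<close>. Cauchy-Schwarz and the dual inequality give
  \<open>X^2 <= C X\<close> times the square norm of \<open>a\<close>, and one factor
  \<open>X\<close> cancels.\<close>

theorem large_sieve:
  fixes \<alpha> :: "'a \<Rightarrow> real" and a :: "nat \<Rightarrow> complex"
  assumes R: "finite R" and \<delta>: "\<delta> > 0"
    and spaced: "\<And>r s k. r \<in> R \<Longrightarrow> s \<in> R \<Longrightarrow> r \<noteq> s \<Longrightarrow> \<delta> \<le> \<bar>\<alpha> r - \<alpha> s - of_int k\<bar>"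
  shows "(\<Sum>r\<in>R. (cmod (\<Sum>n\<le>N. a n * e_unit (real n * \<alpha> r)))\<^sup>2)
    \<le> (4 * real N + 34 / \<delta> + 2) * (\<Sum>n\<le>N. (cmod (a n))\<^sup>2)"
proof -
  define M where "M = nat \<lceil>1 / \<delta>\<rceil>"
  have M: "1 / \<delta> \<le> real M" "real M \<le> 1 / \<delta> + 1" "M > 0"
    using \<delta> by (simp_all add: M_def real_nat_ceiling_ge) 
  \<comment> \<open>This choice gives \<open>H - N >= H / 2\<close> and
    \<open>H >= 1 / \<delta>\<close>, so that \<open>16 / \<delta>^2 <= H * 16 / \<delta>\<close>
    and a factor \<open>H\<close> cancels. Then
    \<open>C = 2 (2 N + 1/\<delta> + 1 + 16/\<delta>)\<close>.\<close>
  define H where "H = 2 * N + M"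
  define C where "C = 4 * real N + 34 / \<delta> + 2"
  have dual: "(\<Sum>n\<le>N. (cmod (\<Sum>r\<in>R. b r * e_unit (real n * \<alpha> r)))\<^sup>2) \<le> C * (\<Sum>r\<in>R. (cmod (b r))\<^sup>2)"
    (is "?L \<le> C * ?b") for b :: "'a \<Rightarrow> complex"
  proof -
    have "real H / 2 * ?L \<le> real (H - N) * ?L"
      by (intro mult_right_mono sum_nonneg) (auto simp: H_def)
    also have "\<dots> \<le> ((real H)\<^sup>2 + 16 / \<delta>\<^sup>2) * ?b"
      using M(3) by (intro large_sieve_dual R \<delta> spaced) (auto simp: H_def)
    also have "\<dots> \<le> (real H / 2 * C) * ?b"
    proof (intro mult_right_mono sum_nonneg)
      have "1 / \<delta> \<le> real H" using M unfolding H_def by simp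
      then have "(1 / \<delta>) * (1 / \<delta>) \<le> real H * (1 / \<delta>)" using \<delta> by (intro mult_right_mono) auto
      then have "16 * (1 / \<delta> * (1 / \<delta>)) \<le> 16 * (real H * (1 / \<delta>))" by simp
      then have "16 / \<delta>\<^sup>2 \<le> real H * (16 / \<delta>)" by (simp add: power2_eq_square mult_ac)
      moreover have "real H \<le> 2 * real N + 1 / \<delta> + 1" using M unfolding H_def by simp
      then have "real H * real H \<le> real H * (2 * real N + 1 / \<delta> + 1)" by (intro mult_left_mono) auto
      moreover have "real H * (2 * real N + 1 / \<delta> + 1) + real H * (16 / \<delta>) = real H / 2 * C"
        using \<delta> by (simp add: C_def field_simps)
      ultimately show "(real H)\<^sup>2 + 16 / \<delta>\<^sup>2 \<le> real H / 2 * C"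
        by (simp add: power2_eq_square)
    qed auto
    finally have "real H / 2 * ?L \<le> real H / 2 * (C * ?b)" by (simp only: mult.assoc)
    then show ?thesis using M(3) by (simp add: H_def)
  qed
  define S where "S r = (\<Sum>n\<le>N. a n * e_unit (real n * \<alpha> r))" for r
  define X where "X = (\<Sum>r\<in>R. (cmod (S r))\<^sup>2)"
  have "X \<ge> 0" unfolding X_def by (intro sum_nonneg) auto
  have "complex_of_real X = (\<Sum>r\<in>R. cnj (S r) * S r)"
    unfolding X_def of_real_sum complex_norm_square by (simp add: mult.commute)
  also have "\<dots> = (\<Sum>r\<in>R. \<Sum>n\<le>N. a n * (cnj (S r) * e_unit (real n * \<alpha> r)))"
  proof (rule sum.cong[OF refl])
    fix r
    have "c * S r = (\<Sum>n\<le>N. a n * (c * e_unit (real n * \<alpha> r)))" for c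
      by (simp add: S_def sum_distrib_left mult_ac)
    then show "cnj (S r) * S r = (\<Sum>n\<le>N. a n * (cnj (S r) * e_unit (real n * \<alpha> r)))" .
  qed
  also have "\<dots> = (\<Sum>n\<le>N. a n * (\<Sum>r\<in>R. cnj (S r) * e_unit (real n * \<alpha> r)))"
    by (subst sum.swap) (simp add: sum_distrib_left)
  finally have "X\<^sup>2 = (cmod (\<Sum>n\<le>N. a n * (\<Sum>r\<in>R. cnj (S r) * e_unit (real n * \<alpha> r))))\<^sup>2"
    using \<open>X \<ge> 0\<close> by (metis norm_of_real power2_abs)
  also have "\<dots> \<le> (\<Sum>n\<le>N. (cmod (a n))\<^sup>2) * (\<Sum>n\<le>N. (cmod (\<Sum>r\<in>R. cnj (S r) * e_unit (real n * \<alpha> r)))\<^sup>2)"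
    by (rule sum_cauchy_schwarz_complex)
  also have "\<dots> \<le> (\<Sum>n\<le>N. (cmod (a n))\<^sup>2) * (C * X)"
    using dual[of "\<lambda>r. cnj (S r)"] by (intro mult_left_mono sum_nonneg) (auto simp: X_def)
  finally have *: "X * X \<le> (C * (\<Sum>n\<le>N. (cmod (a n))\<^sup>2)) * X" by (simp add: power2_eq_square mult_ac)
  have "C \<ge> 0" using \<delta> by (simp add: C_def)
  then have "X \<le> C * (\<Sum>n\<le>N. (cmod (a n))\<^sup>2)"
    using * \<open>X \<ge> 0\<close> by (cases "X = 0") (auto intro!: sum_nonneg mult_nonneg_nonneg)
  then show ?thesis by (simp add: X_def S_def C_def)
qed

section \<open>Irreducible characters of subgroups of the affine group\<close>

text \<open>The element \<open>g\<close> acts on \<open>\<int>/q\<close> as \<open>x \<mapsto> a g \<cdot> x + b g\<close>.\<close>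

locale affine_subgroup = group G for G (structure) +
  fixes q :: nat and a b :: "'a \<Rightarrow> int"
  assumes prime_q: "Factorial_Ring.prime q"
    and a_mult: "\<And>g h. g \<in> carrier G \<Longrightarrow> h \<in> carrier G \<Longrightarrow> [a (g \<otimes> h) = a g * a h] (mod int q)"
    and b_mult: "\<And>g h. g \<in> carrier G \<Longrightarrow> h \<in> carrier G \<Longrightarrow> [b (g \<otimes> h) = b g + a g * b h] (mod int q)"
    and ab_inj: "\<And>g h. g \<in> carrier G \<Longrightarrow> h \<in> carrier G \<Longrightarrow>
       [a g = a h] (mod int q) \<Longrightarrow> [b g = b h] (mod int q) \<Longrightarrow> g = h"
    and a_surj: "\<And>u. \<not> int q dvd u \<Longrightarrow> \<exists>g\<in>carrier G. [a g = u] (mod int q)"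
begin

lemma prime_int_q: "Factorial_Ring.prime (int q)" and q_gt_1: "q > 1"
  using prime_q prime_gt_1_nat by auto

lemma exists_nat_cong: "\<exists>k. [int k = u] (mod int q)"
  using q_gt_1 by (intro exI[of _ "nat (u mod int q)"]) (simp add: Cong.cong_def)

lemma exists_nat_inverse:
  assumes "\<not> int q dvd u"
  shows "\<exists>k. [u * int k = 1] (mod int q)"
proof -
  have "coprime u (int q)"
    using assms prime_imp_coprime[OF prime_int_q] by (simp add: coprime_commute)
  then obtain x where "[u * x = 1] (mod int q)" using cong_solve_coprime_int by blast
  moreover obtain k where "[int k = x] (mod int q)" using exists_nat_cong by blast
  ultimately show ?thesis by (metis cong_scalar_left cong_trans)
qed

text \<open>Multiplicativity alone would allow the value 0; an element with \<open>a g = 1\<close>,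
  provided by surjectivity, excludes it.\<close>

lemma a_one: "[a \<one> = 1] (mod int q)"
proof -
  have "\<not> int q dvd 1" using q_gt_1 by simp
  then obtain g where g: "g \<in> carrier G" "[a g = 1] (mod int q)" using a_surj by blast
  have "[a g = a g * a \<one>] (mod int q)" using a_mult[of g \<one>] g by simp
  moreover have "[a g * a \<one> = 1 * a \<one>] (mod int q)" using g by (intro cong_mult) auto
  ultimately show ?thesis using g(2) by (metis cong_sym cong_trans mult_1)
qed

lemma b_one: "[b \<one> = 0] (mod int q)"
proof -
  have "[b \<one> = b \<one> + a \<one> * b \<one>] (mod int q)" using b_mult[of \<one> \<one>] by simp
  then have "int q dvd a \<one> * b \<one>" by (simp add: cong_iff_dvd_diff)
  moreover have "\<not> int q dvd a \<one>"
  proof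
    assume "int q dvd a \<one>"
    then have "[1 = 0] (mod int q)" using a_one by (meson cong_0_iff cong_sym cong_trans)
    then show False using q_gt_1 by (simp add: cong_0_iff)
  qed
  ultimately show ?thesis using prime_int_q by (simp add: prime_dvd_mult_iff cong_0_iff)
qed

lemma a_nz: "g \<in> carrier G \<Longrightarrow> \<not> int q dvd a g"
proof
  assume g: "g \<in> carrier G" and "int q dvd a g"
  then have "[a g * a (inv g) = 0] (mod int q)" by (simp add: cong_0_iff)
  moreover have "[1 = a g * a (inv g)] (mod int q)"
    using a_mult[of g "inv g"] g a_one by (metis cong_sym cong_trans inv_closed r_inv)
  ultimately have "int q dvd 1" using cong_0_iff cong_trans by blast
  then show False using q_gt_1 by simp
qed

lemma a_pow: "g \<in> carrier G \<Longrightarrow> [a (g [^] (k::nat)) = a g ^ k] (mod int q)"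
proof (induction k)
  case (Suc k)
  have "[a (g [^] k \<otimes> g) = a (g [^] k) * a g] (mod int q)" using Suc.prems by (intro a_mult) auto
  moreover have "[a (g [^] k) * a g = a g ^ k * a g] (mod int q)" using Suc by (intro cong_mult) auto
  ultimately show ?case by (simp add: mult.commute) (meson cong_trans)
qed (simp add: a_one)

lemma ab_pow_translation:
  assumes "g \<in> carrier G" "[a g = 1] (mod int q)"
  shows "[a (g [^] (k::nat)) = 1] (mod int q)" "[b (g [^] k) = int k * b g] (mod int q)"
proof -
  have A: "[a (g [^] k) = 1] (mod int q)" for k :: nat
    using a_pow[OF assms(1), of k] cong_pow[OF assms(2), of k] by (metis cong_trans power_one)
  show "[a (g [^] k) = 1] (mod int q)" by (rule A)
  show "[b (g [^] k) = int k * b g] (mod int q)"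
  proof (induction k)
    case (Suc k)
    have "[b (g [^] k \<otimes> g) = b (g [^] k) + a (g [^] k) * b g] (mod int q)"
      using assms by (intro b_mult) auto
    moreover have "[b (g [^] k) + a (g [^] k) * b g = int k * b g + 1 * b g] (mod int q)"
      using Suc A by (intro cong_add cong_mult) auto
    ultimately have "[b (g [^] k \<otimes> g) = int k * b g + 1 * b g] (mod int q)" by (rule cong_trans)
    then show ?case by (simp add: algebra_simps)
  qed (simp add: b_one)
qed

end

section \<open>Traces and matrix actions\<close>

lemma trace_mult_commute:
  fixes A B :: "'a :: comm_semiring_0 mat"
  assumes "A \<in> carrier_mat n n" "B \<in> carrier_mat n n"
  shows "(\<Sum>i<n. (A * B) $$ (i, i)) = (\<Sum>i<n. (B * A) $$ (i, i))"
proof -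
  have "(\<Sum>i<n. (A * B) $$ (i, i)) = (\<Sum>i<n. \<Sum>j<n. A $$ (i, j) * B $$ (j, i))"
    using assms by (simp add: scalar_prod_def atLeast0LessThan)
  also have "\<dots> = (\<Sum>j<n. \<Sum>i<n. B $$ (j, i) * A $$ (i, j))"
    by (subst sum.swap) (simp add: mult.commute)
  also have "\<dots> = (\<Sum>i<n. (B * A) $$ (i, i))"
    using assms by (simp add: scalar_prod_def atLeast0LessThan)
  finally show ?thesis .
qed

lemma mult_mat_vec_sum:
  fixes A :: "'a :: comm_semiring_0 mat"
  assumes "A \<in> carrier_mat n n" "\<And>k. k \<in> K \<Longrightarrow> f k \<in> carrier_vec n"
  shows "A *\<^sub>v vec n (\<lambda>i. \<Sum>k\<in>K. c k * f k $ i) = vec n (\<lambda>i. \<Sum>k\<in>K. c k * (A *\<^sub>v f k) $ i)"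
proof (rule eq_vecI)
  fix i assume "i < dim_vec (vec n (\<lambda>i. \<Sum>k\<in>K. c k * (A *\<^sub>v f k) $ i))"
  then have i: "i < n" by simp
  have "(A *\<^sub>v vec n (\<lambda>i. \<Sum>k\<in>K. c k * f k $ i)) $ i = (\<Sum>j<n. \<Sum>k\<in>K. c k * (A $$ (i, j) * f k $ j))"
    using assms(1) i by (simp add: scalar_prod_def atLeast0LessThan sum_distrib_left mult.left_commute)
  also have "\<dots> = (\<Sum>k\<in>K. c k * (\<Sum>j<n. A $$ (i, j) * f k $ j))"
    by (subst sum.swap) (simp add: sum_distrib_left)
  also have "\<dots> = (\<Sum>k\<in>K. c k * (A *\<^sub>v f k) $ i)"
  proof (intro sum.cong refl arg_cong2[where f = "(*)"])
    fix k assume "k \<in> K"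
    then have "dim_vec (f k) = n" by (rule carrier_vecD[OF assms(2)])
    then show "(\<Sum>j<n. A $$ (i, j) * f k $ j) = (A *\<^sub>v f k) $ i"
      using assms(1) i by (simp add: scalar_prod_def atLeast0LessThan)
  qed
  finally show "(A *\<^sub>v vec n (\<lambda>i. \<Sum>k\<in>K. c k * f k $ i)) $ i = vec n (\<lambda>i. \<Sum>k\<in>K. c k * (A *\<^sub>v f k) $ i) $ i"
    using i by simp
qed (use assms in auto)

lemma mult_mat_unit_vec_index:
  fixes A :: "'a :: semiring_1 mat"
  assumes "A \<in> carrier_mat n n" "i < n" "j < n"
  shows "(A *\<^sub>v unit_vec n j) $ i = A $$ (i, j)"
  using assms by simp

section \<open>Irreducible matrix representations of an arbitrary group\<close>

locale irrep = group G for G (structure) +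
  fixes n :: nat and \<rho> :: "'a \<Rightarrow> complex mat"
  assumes irr: "irreducible_rep G n \<rho>"
begin

lemma n_pos: "n > 0" using irr by (simp add: irreducible_rep_def)

lemma rho_carrier [simp]: "g \<in> carrier G \<Longrightarrow> \<rho> g \<in> carrier_mat n n"
  using irr by (auto simp: irreducible_rep_def representation_def hom_def units_of_def Units_def ring_mat_simps)

lemma rho_dim [simp]: "g \<in> carrier G \<Longrightarrow> dim_row (\<rho> g) = n" "g \<in> carrier G \<Longrightarrow> dim_col (\<rho> g) = n"
  using rho_carrier by (metis carrier_matD)+

lemma rho_mult: "g \<in> carrier G \<Longrightarrow> h \<in> carrier G \<Longrightarrow> \<rho> (g \<otimes> h) = \<rho> g * \<rho> h"
  using irr by (auto simp: irreducible_rep_def representation_def hom_def units_of_def ring_mat_simps)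

lemma rho_one: "\<rho> \<one> = 1\<^sub>m n"
proof -
  interpret R: ring "ring_mat TYPE(complex) n ()" by (rule ring_mat)
  have "\<rho> \<in> hom G (units_of (ring_mat TYPE(complex) n ()))"
    using irr by (simp add: irreducible_rep_def representation_def)
  from hom_one[OF this is_group R.units_group] show ?thesis
    by (simp add: units_of_one ring_mat_simps)
qed

lemma act_mult:
  "g \<in> carrier G \<Longrightarrow> h \<in> carrier G \<Longrightarrow> v \<in> carrier_vec n \<Longrightarrow> \<rho> (g \<otimes> h) *\<^sub>v v = \<rho> g *\<^sub>v (\<rho> h *\<^sub>v v)"
  by (simp add: rho_mult) (meson assoc_mult_mat_vec rho_carrier)

lemma act_carrier [simp]: "g \<in> carrier G \<Longrightarrow> \<rho> g *\<^sub>v v \<in> carrier_vec n"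
  by (rule carrier_vecI) simp

lemma act_one: "v \<in> carrier_vec n \<Longrightarrow> \<rho> \<one> *\<^sub>v v = v"
  by (simp add: rho_one)

lemma act_pow_eigenvector:
  assumes g: "g \<in> carrier G" and v: "v \<in> carrier_vec n" and ev: "\<rho> g *\<^sub>v v = \<omega> \<cdot>\<^sub>v v"
  shows "\<rho> (g [^] (k::nat)) *\<^sub>v v = \<omega> ^ k \<cdot>\<^sub>v v"
proof (induction k)
  case (Suc k)
  have "\<rho> (g [^] k \<otimes> g) *\<^sub>v v = \<rho> (g [^] k) *\<^sub>v (\<omega> \<cdot>\<^sub>v v)"
    using g v by (simp add: act_mult ev)
  also have "\<dots> = \<omega> \<cdot>\<^sub>v (\<rho> (g [^] k) *\<^sub>v v)"
    using g v by (intro mult_mat_vec[of _ n n]) auto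
  finally show ?case by (simp add: Suc smult_smult_assoc)
qed (use v in \<open>simp add: act_one\<close>)

text \<open>The minimality clause of \<open>irreducible_rep\<close> enters only through this rule,
  with a line, a fixed space, or a space of vectors with prescribed projections as
  \<open>W\<close>.\<close>

lemma invariant_subspace_trivial:
  assumes "W \<subseteq> carrier_vec n" "0\<^sub>v n \<in> W"
    and "\<And>u v. u \<in> W \<Longrightarrow> v \<in> W \<Longrightarrow> u + v \<in> W"
    and "\<And>c v. v \<in> W \<Longrightarrow> c \<cdot>\<^sub>v v \<in> W"
    and "\<And>g v. g \<in> carrier G \<Longrightarrow> v \<in> W \<Longrightarrow> \<rho> g *\<^sub>v v \<in> W"
    and "v \<in> W" "v \<noteq> 0\<^sub>v n"
  shows "W = carrier_vec n"
proof -
  have "VectorSpace.subspace class_ring W (module_vec TYPE(complex) n)"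
    unfolding VectorSpace.subspace_def LinearCombinations.submodule_def
    using assms(1-4) vec_vs vec_module by (auto simp: module_vec_simps)
  then have "W = {0\<^sub>v n} \<or> W = carrier_vec n"
    using irr assms(5) unfolding irreducible_rep_def by blast
  then show ?thesis using assms(6,7) by auto
qed

lemma exists_eigenvector:
  assumes "g \<in> carrier G"
  obtains v \<omega> where "v \<in> carrier_vec n" "v \<noteq> 0\<^sub>v n" "\<rho> g *\<^sub>v v = \<omega> \<cdot>\<^sub>v v"
proof -
  have "spectrum (\<rho> g) \<noteq> {}" using assms n_pos by (intro spectrum_non_empty) auto
  then obtain \<omega> v where "eigenvector (\<rho> g) v \<omega>" by (auto simp: spectrum_def eigenvalue_def)
  then show ?thesis using that assms by (auto simp: eigenvector_def)
qed

definition tr :: "'a \<Rightarrow> complex" where "tr g = (\<Sum>i<n. \<rho> g $$ (i, i))"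

lemma tr_one: "tr \<one> = of_nat n"
  by (simp add: tr_def rho_one)

text \<open>Conjugacy is phrased as \<open>x h = h g\<close> so that it can be verified by comparing
  the coordinates of two products, without computing those of an inverse.\<close>

lemma tr_conj:
  assumes "x \<in> carrier G" "g \<in> carrier G" "h \<in> carrier G" "x \<otimes> h = h \<otimes> g"
  shows "tr x = tr g"
proof -
  have "x = (x \<otimes> h) \<otimes> inv h" using assms(1-3) by (simp add: m_assoc)
  then have x: "x = h \<otimes> (g \<otimes> inv h)" using assms by (simp add: m_assoc)
  have g: "g = (g \<otimes> inv h) \<otimes> h" using assms(1-3) by (simp add: m_assoc)
  have "tr x = (\<Sum>i<n. (\<rho> h * \<rho> (g \<otimes> inv h)) $$ (i, i))"
    unfolding tr_def using assms by (subst x) (simp add: rho_mult)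
  also have "\<dots> = (\<Sum>i<n. (\<rho> (g \<otimes> inv h) * \<rho> h) $$ (i, i))"
    using assms by (intro trace_mult_commute) auto
  also have "\<dots> = tr g"
    unfolding tr_def using assms rho_mult[of "g \<otimes> inv h" h] g by simp
  finally show ?thesis .
qed

text \<open>The line of \<open>v\<close> is invariant, hence the whole space; two unit vectors
  cannot both lie on one line.\<close>

lemma one_dim_of_common_eigenvector:
  assumes v: "v \<in> carrier_vec n" "v \<noteq> 0\<^sub>v n"
    and ev: "\<And>g. g \<in> carrier G \<Longrightarrow> \<rho> g *\<^sub>v v = \<omega> g \<cdot>\<^sub>v v"
  shows "n = 1" "g \<in> carrier G \<Longrightarrow> tr g = \<omega> g"
proof -
  have W: "{c \<cdot>\<^sub>v v | c. True} = carrier_vec n"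
  proof (rule invariant_subspace_trivial)
    fix u w assume "u \<in> {c \<cdot>\<^sub>v v | c. True}" "w \<in> {c \<cdot>\<^sub>v v | c. True}"
    then obtain c d where "u = c \<cdot>\<^sub>v v" "w = d \<cdot>\<^sub>v v" by auto
    then have "u + w = (c + d) \<cdot>\<^sub>v v" using v by (simp add: add_smult_distrib_vec)
    then show "u + w \<in> {c \<cdot>\<^sub>v v | c. True}" by auto
  next
    fix g w assume g: "g \<in> carrier G" "w \<in> {c \<cdot>\<^sub>v v | c. True}"
    then obtain c where "w = c \<cdot>\<^sub>v v" by auto
    then have "\<rho> g *\<^sub>v w = (c * \<omega> g) \<cdot>\<^sub>v v"
      using g(1) v ev mult_mat_vec[of "\<rho> g" n n v c] by (simp add: smult_smult_assoc)
    then show "\<rho> g *\<^sub>v w \<in> {c \<cdot>\<^sub>v v | c. True}" by auto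
  next
    show "0\<^sub>v n \<in> {c \<cdot>\<^sub>v v | c. True}" using v by (auto intro!: exI[of _ 0])
    show "v \<in> {c \<cdot>\<^sub>v v | c. True}" using v by (auto intro!: exI[of _ 1])
  qed (use v in \<open>auto simp: smult_smult_assoc\<close>)
  show n: "n = 1"
  proof (rule ccontr)
    assume "n \<noteq> 1"
    then have n2: "0 < n" "1 < n" using n_pos by auto
    have "unit_vec n 0 \<in> carrier_vec n" "unit_vec n 1 \<in> carrier_vec n" by auto
    then obtain c d where c: "unit_vec n 0 = c \<cdot>\<^sub>v v" and d: "unit_vec n 1 = d \<cdot>\<^sub>v v"
      using W by blast
    have "c * v $ 0 = 1" "c * v $ 1 = 0" "d * v $ 1 = 1"
      using n2 v arg_cong[OF c, of "\<lambda>x. x $ 0"] arg_cong[OF c, of "\<lambda>x. x $ 1"]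
        arg_cong[OF d, of "\<lambda>x. x $ 1"] by auto
    then show False by auto
  qed
  show "tr g = \<omega> g" if g: "g \<in> carrier G"
  proof -
    have v0: "v $ 0 \<noteq> 0" using v n by (metis carrier_vecD dim_vec eq_vecI index_zero_vec less_one)
    have "(\<rho> g *\<^sub>v v) $ 0 = (\<omega> g \<cdot>\<^sub>v v) $ 0" using ev[OF g] by simp
    then have "\<rho> g $$ (0, 0) * v $ 0 = \<omega> g * v $ 0"
      using v n g by (simp add: scalar_prod_def)
    then show ?thesis unfolding tr_def using v0 by (simp add: n)
  qed
qed

end


section \<open>Irreducible representations of affine subgroups\<close>

locale affine_irrep = affine_subgroup G q a b + irrep G n \<rho>
  for G (structure) and q a b n \<rho>
begin

text \<open>The representation factors through the cyclic quotient generated by the class of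
  \<open>g0\<close>. An eigenvector of a lift \<open>\<gamma>\<close> of that generator is then a
  common eigenvector, since each \<open>g\<close> is a power of \<open>\<gamma>\<close> times a
  translation.\<close>

lemma translation_trivial_imp_linear:
  assumes trivial: "\<And>g. g \<in> carrier G \<Longrightarrow> [a g = 1] (mod int q) \<Longrightarrow> \<rho> g = 1\<^sub>m n"
    and prim: "\<And>u. \<not> int q dvd u \<Longrightarrow> \<exists>i::nat. [u = g0 ^ i] (mod int q)"
    and g0: "[g0 ^ (q - 1) = 1] (mod int q)"
  obtains \<omega> where "\<omega> ^ (q - 1) = 1"
    "\<And>g i. g \<in> carrier G \<Longrightarrow> [a g = g0 ^ i] (mod int q) \<Longrightarrow> tr g = \<omega> ^ i"
proof -
  have "\<not> int q dvd g0"
  proof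
    assume "int q dvd g0"
    then have "int q dvd g0 ^ (q - 1)" using q_gt_1 by (intro dvd_power_le[where n = 1, simplified]) auto
    then have "int q dvd 1" using g0 cong_dvd_iff cong_0_iff cong_trans cong_sym by metis
    then show False using q_gt_1 by simp
  qed
  then obtain \<gamma> where \<gamma>: "\<gamma> \<in> carrier G" "[a \<gamma> = g0] (mod int q)" using a_surj by blast
  obtain v \<omega> where v: "v \<in> carrier_vec n" "v \<noteq> 0\<^sub>v n" and ev: "\<rho> \<gamma> *\<^sub>v v = \<omega> \<cdot>\<^sub>v v"
    using exists_eigenvector[OF \<gamma>(1)] by blast
  have act: "\<rho> g *\<^sub>v v = \<omega> ^ i \<cdot>\<^sub>v v" if g: "g \<in> carrier G" "[a g = g0 ^ i] (mod int q)" for g i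
  proof -
    let ?h = "\<gamma> [^] i" and ?s = "inv (\<gamma> [^] i) \<otimes> g"
    have hs: "?h \<otimes> ?s = g" using g \<gamma> by (simp flip: m_assoc)
    have ah: "[a ?h = g0 ^ i] (mod int q)"
      using a_pow[OF \<gamma>(1), of i] cong_pow[OF \<gamma>(2), of i] by (rule cong_trans)
    have "[a ?h * a ?s = a g] (mod int q)"
      using a_mult[of ?h ?s] hs g(1) \<gamma>(1) by (simp add: cong_sym)
    also have "[a g = a ?h * 1] (mod int q)" using g(2) ah by (metis cong_sym cong_trans mult.right_neutral)
    finally have "[a ?s = 1] (mod int q)"
      using a_nz[of ?h] \<gamma>(1) prime_imp_coprime[OF prime_int_q, of "a ?h"]
      by (subst (asm) cong_mult_lcancel) (auto simp: coprime_commute)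
    then have "\<rho> ?s = 1\<^sub>m n" using g(1) \<gamma>(1) by (intro trivial) auto
    then have "\<rho> g *\<^sub>v v = \<rho> ?h *\<^sub>v v"
      using act_mult[of ?h ?s v] hs g(1) \<gamma>(1) v by simp
    then show ?thesis using act_pow_eigenvector[OF \<gamma>(1) v(1) ev] by simp
  qed
  have ex: "\<exists>i. [a g = g0 ^ i] (mod int q)" if "g \<in> carrier G" for g
    using prim a_nz that by blast
  define ind where "ind g = (SOME i. [a g = g0 ^ i] (mod int q))" for g
  have ind: "[a g = g0 ^ ind g] (mod int q)" if "g \<in> carrier G" for g
    unfolding ind_def by (rule someI_ex) (rule ex[OF that])
  \<comment> \<open>\<open>act\<close> holds for every exponent that represents the same unit, so a
    nonzero coordinate of \<open>v\<close> shows that \<open>\<omega> ^ i\<close> depends only on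
    the class of \<open>g0 ^ i\<close>. The exponents \<open>q - 1\<close> and 0 yield
    \<open>\<omega> ^ (q - 1) = 1\<close>.\<close>
  have pow_eq: "\<omega> ^ i = \<omega> ^ j" if "g \<in> carrier G" "[a g = g0 ^ i] (mod int q)" "[a g = g0 ^ j] (mod int q)" for g i j
  proof -
    obtain k where k: "k < n" "v $ k \<noteq> 0" using v by (metis carrier_vecD dim_vec eq_vecI index_zero_vec)
    have "(\<omega> ^ i \<cdot>\<^sub>v v) $ k = (\<omega> ^ j \<cdot>\<^sub>v v) $ k" using act[OF that(1,2)] act[OF that(1,3)] by simp
    then show ?thesis using k v by simp
  qed
  show thesis
  proof (rule that)
    show "\<omega> ^ (q - 1) = 1"
      using pow_eq[of \<one> "q - 1" 0] a_one g0 by (auto intro: cong_trans cong_sym)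
    fix g i assume g: "g \<in> carrier G" "[a g = g0 ^ i] (mod int q)"
    then have "tr g = \<omega> ^ ind g"
      using one_dim_of_common_eigenvector(2)[of v "\<lambda>g. \<omega> ^ ind g" g] v act ind by blast
    then show "tr g = \<omega> ^ i" using pow_eq[OF g(1) ind g(2)] g(1) by simp
  qed
qed

section \<open>The action of the translations\<close>

context
  fixes \<tau> assumes \<tau>: "\<tau> \<in> carrier G" "[a \<tau> = 1] (mod int q)" "[b \<tau> = 1] (mod int q)"
begin

lemma tau_pow: "[a (\<tau> [^] (k::nat)) = 1] (mod int q)" "[b (\<tau> [^] k) = int k] (mod int q)"
  using ab_pow_translation[OF \<tau>(1,2), of k] cong_scalar_left[OF \<tau>(3), of "int k"]
  by (auto intro: cong_trans)

lemma tau_mult_cong: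
  assumes g: "g \<in> carrier G"
  shows "[a (\<tau> [^] (k::nat) \<otimes> g) = a g] (mod int q)" "[b (\<tau> [^] k \<otimes> g) = int k + b g] (mod int q)"
    "[a (g \<otimes> \<tau> [^] k) = a g] (mod int q)" "[b (g \<otimes> \<tau> [^] k) = b g + a g * int k] (mod int q)"
proof -
  have t: "\<tau> [^] k \<in> carrier G" using \<tau> by simp
  show "[a (\<tau> [^] k \<otimes> g) = a g] (mod int q)"
    using cong_trans[OF a_mult[OF t g] cong_mult[OF tau_pow(1) cong_refl]] by simp
  show "[b (\<tau> [^] k \<otimes> g) = int k + b g] (mod int q)"
    using cong_trans[OF b_mult[OF t g] cong_add[OF tau_pow(2) cong_mult[OF tau_pow(1) cong_refl]]] by simp
  show "[a (g \<otimes> \<tau> [^] k) = a g] (mod int q)"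
    using cong_trans[OF a_mult[OF g t] cong_mult[OF cong_refl tau_pow(1)]] by simp
  show "[b (g \<otimes> \<tau> [^] k) = b g + a g * int k] (mod int q)"
    using cong_trans[OF b_mult[OF g t] cong_add[OF cong_refl cong_mult[OF cong_refl tau_pow(2)]]] by simp
qed

lemma translation_eq_tau_pow:
  assumes "g \<in> carrier G" "[a g = 1] (mod int q)" "[b g = int k] (mod int q)"
  shows "g = \<tau> [^] k"
  using assms \<tau> tau_pow[of k] by (intro ab_inj) (auto intro: cong_trans cong_sym)

lemma tau_pow_q: "\<tau> [^] q = \<one>"
  using a_one b_one by (intro translation_eq_tau_pow[symmetric]) (auto simp: Cong.cong_def)

text \<open>In coordinates, \<open>\<tau>\<close> is the translation by 1 and
  \<open>g \<tau>\<^sup>k g\<^sup>-\<^sup>1\<close> is the translation by \<open>a g \<cdot> k\<close>.\<close>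

lemma tau_commute:
  assumes "g \<in> carrier G" "[a g * int k = int j] (mod int q)"
  shows "\<tau> [^] j \<otimes> g = g \<otimes> \<tau> [^] k"
proof (rule ab_inj)
  show "[a (\<tau> [^] j \<otimes> g) = a (g \<otimes> \<tau> [^] k)] (mod int q)"
    using tau_mult_cong(1,3)[OF assms(1)] by (meson cong_sym cong_trans)
  have "[b (\<tau> [^] j \<otimes> g) = int j + b g] (mod int q)" by (rule tau_mult_cong) fact
  also have "[int j + b g = b g + a g * int k] (mod int q)"
    using cong_add[OF cong_sym[OF assms(2)] cong_refl[of "b g"]] by (simp add: add.commute)
  also have "[b g + a g * int k = b (g \<otimes> \<tau> [^] k)] (mod int q)"
    by (rule cong_sym) (rule tau_mult_cong, fact)
  finally show "[b (\<tau> [^] j \<otimes> g) = b (g \<otimes> \<tau> [^] k)] (mod int q)" .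
qed (use assms \<tau> in auto)

text \<open>Translations are normal: \<open>\<tau> g = g \<tau> ^ k\<close> for a suitable
  \<open>k\<close>, so the fixed space of \<open>\<tau>\<close> is invariant. If it were everything,
  \<open>\<tau>\<close> would act as the identity.\<close>

lemma fixed_space_trivial:
  assumes "\<rho> \<tau> \<noteq> 1\<^sub>m n" "v \<in> carrier_vec n" "\<rho> \<tau> *\<^sub>v v = v"
  shows "v = 0\<^sub>v n"
proof (rule ccontr)
  assume "v \<noteq> 0\<^sub>v n"
  have "{v \<in> carrier_vec n. \<rho> \<tau> *\<^sub>v v = v} = carrier_vec n"
  proof (rule invariant_subspace_trivial)
    show "v \<in> {v \<in> carrier_vec n. \<rho> \<tau> *\<^sub>v v = v}" using assms by simp
    show "v \<noteq> 0\<^sub>v n" by fact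
  next
    fix g w assume g: "g \<in> carrier G" and w: "w \<in> {v \<in> carrier_vec n. \<rho> \<tau> *\<^sub>v v = v}"
    obtain k where "[a g * int k = int 1] (mod int q)" using exists_nat_inverse[OF a_nz[OF g]] by auto
    from tau_commute[OF g this] have c: "\<tau> \<otimes> g = g \<otimes> \<tau> [^] k" using \<tau> by simp
    have "\<rho> (\<tau> [^] k) *\<^sub>v w = w" using act_pow_eigenvector[OF \<tau>(1), of w 1 k] w by simp
    then have "\<rho> \<tau> *\<^sub>v (\<rho> g *\<^sub>v w) = \<rho> g *\<^sub>v w"
      using act_mult[of \<tau> g w] act_mult[of g "\<tau> [^] k" w] c g w \<tau> by simp
    then show "\<rho> g *\<^sub>v w \<in> {v \<in> carrier_vec n. \<rho> \<tau> *\<^sub>v v = v}" using g by simp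
  next
    show "0\<^sub>v n \<in> {v \<in> carrier_vec n. \<rho> \<tau> *\<^sub>v v = v}"
      using \<tau> by (auto simp: scalar_prod_def)
  next
    fix u w assume "u \<in> {v \<in> carrier_vec n. \<rho> \<tau> *\<^sub>v v = v}" "w \<in> {v \<in> carrier_vec n. \<rho> \<tau> *\<^sub>v v = v}"
    then show "u + w \<in> {v \<in> carrier_vec n. \<rho> \<tau> *\<^sub>v v = v}"
      using mult_add_distrib_mat_vec[of "\<rho> \<tau>" n n u w] \<tau> by simp
  next
    fix c w assume "w \<in> {v \<in> carrier_vec n. \<rho> \<tau> *\<^sub>v v = v}"
    then show "c \<cdot>\<^sub>v w \<in> {v \<in> carrier_vec n. \<rho> \<tau> *\<^sub>v v = v}"
      using mult_mat_vec[of "\<rho> \<tau>" n n w c] \<tau> by simp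
  qed auto
  then have all: "\<rho> \<tau> *\<^sub>v w = w" if "w \<in> carrier_vec n" for w using that by blast
  have "\<rho> \<tau> = 1\<^sub>m n"
  proof (rule eq_matI)
    fix i j assume "i < dim_row (1\<^sub>m n)" "j < dim_col (1\<^sub>m n)"
    then have ij: "i < n" "j < n" by auto
    have "(\<rho> \<tau> *\<^sub>v unit_vec n j) $ i = \<rho> \<tau> $$ (i, j)"
      using ij \<tau> by (intro mult_mat_unit_vec_index) auto
    then show "\<rho> \<tau> $$ (i, j) = 1\<^sub>m n $$ (i, j)" using all[of "unit_vec n j"] ij by auto
  qed (use \<tau> in auto)
  with assms(1) show False by simp
qed

text \<open>For \<open>\<nu> ^ q = 1\<close> this is \<open>q\<close> times the projection onto the
  eigenspace of \<open>\<rho> \<tau>\<close> with eigenvalue \<open>1 / \<nu>\<close>.\<close>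

definition proj :: "complex \<Rightarrow> complex vec \<Rightarrow> complex vec" where
  "proj \<nu> v = vec n (\<lambda>i. \<Sum>k<q. \<nu> ^ k * (\<rho> (\<tau> [^] k) *\<^sub>v v) $ i)"

lemma proj_carrier [simp]: "proj \<nu> v \<in> carrier_vec n"
  by (simp add: proj_def)

lemma act_proj:
  assumes \<nu>: "\<nu> ^ q = 1" "\<nu> * \<omega> = 1" and v: "v \<in> carrier_vec n"
  shows "\<rho> \<tau> *\<^sub>v proj \<nu> v = \<omega> \<cdot>\<^sub>v proj \<nu> v"
proof -
  have eq: "\<rho> \<tau> *\<^sub>v (\<rho> (\<tau> [^] k) *\<^sub>v v) = \<rho> (\<tau> [^] Suc k) *\<^sub>v v" for k :: nat
    using act_mult[of \<tau> "\<tau> [^] k" v] \<tau> v nat_pow_Suc2[of \<tau> k] by simp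
  \<comment> \<open>Cyclic shift of the summation index; the two end terms agree because both
    \<open>\<tau> ^ q\<close> and \<open>\<nu> ^ q\<close> are 1.\<close>
  have shift: "(\<Sum>k<q. f (Suc k)) = (\<Sum>k<q. f k)" if "f q = f 0" for f :: "nat \<Rightarrow> complex"
    using that sum.lessThan_Suc_shift[of f q] sum.lessThan_Suc[of f q] by simp
  have "\<rho> \<tau> *\<^sub>v proj \<nu> v = vec n (\<lambda>i. \<Sum>k<q. \<nu> ^ k * (\<rho> \<tau> *\<^sub>v (\<rho> (\<tau> [^] k) *\<^sub>v v)) $ i)"
    unfolding proj_def using \<tau> by (intro mult_mat_vec_sum) auto
  also have "\<dots> = vec n (\<lambda>i. \<Sum>k<q. \<omega> * (\<nu> ^ Suc k * (\<rho> (\<tau> [^] Suc k) *\<^sub>v v) $ i))"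
    unfolding eq using \<nu>(2) by (simp add: mult.assoc[symmetric] mult.commute)
  also have "\<dots> = vec n (\<lambda>i. \<omega> * (\<Sum>k<q. \<nu> ^ Suc k * (\<rho> (\<tau> [^] Suc k) *\<^sub>v v) $ i))"
    unfolding sum_distrib_left ..
  also have "\<dots> = vec n (\<lambda>i. \<omega> * (\<Sum>k<q. \<nu> ^ k * (\<rho> (\<tau> [^] k) *\<^sub>v v) $ i))"
    by (subst shift) (use tau_pow_q \<nu>(1) in auto)
  also have "\<dots> = \<omega> \<cdot>\<^sub>v proj \<nu> v" by (auto simp: proj_def)
  finally show ?thesis .
qed

lemma proj_eigenvector:
  assumes "v \<in> carrier_vec n" "\<rho> \<tau> *\<^sub>v v = \<omega> \<cdot>\<^sub>v v"
  shows "proj \<nu> v = (\<Sum>k<q. (\<nu> * \<omega>) ^ k) \<cdot>\<^sub>v v"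
  using assms act_pow_eigenvector[OF \<tau>(1) assms]
  by (auto simp: proj_def sum_distrib_right power_mult_distrib mult.assoc)

lemma trace_proj:
  assumes "g \<in> carrier G"
  shows "(\<Sum>i<n. proj \<nu> (\<rho> g *\<^sub>v unit_vec n i) $ i) = (\<Sum>k<q. \<nu> ^ k * tr (\<tau> [^] k \<otimes> g))"
proof -
  have "(\<rho> (\<tau> [^] k) *\<^sub>v (\<rho> g *\<^sub>v unit_vec n i)) $ i = \<rho> (\<tau> [^] k \<otimes> g) $$ (i, i)"
    if "i < n" for i and k :: nat
    using act_mult[of "\<tau> [^] k" g "unit_vec n i"] that assms \<tau>
      mult_mat_unit_vec_index[of "\<rho> (\<tau> [^] k \<otimes> g)" n i i] by simp
  then have "(\<Sum>i<n. proj \<nu> (\<rho> g *\<^sub>v unit_vec n i) $ i)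
      = (\<Sum>i<n. \<Sum>k<q. \<nu> ^ k * \<rho> (\<tau> [^] k \<otimes> g) $$ (i, i))"
    by (simp add: proj_def)
  also have "\<dots> = (\<Sum>k<q. \<nu> ^ k * tr (\<tau> [^] k \<otimes> g))"
    by (subst sum.swap) (simp add: tr_def sum_distrib_left)
  finally show ?thesis .
qed

lemma proj_1_eq_0:
  assumes "\<rho> \<tau> \<noteq> 1\<^sub>m n" "v \<in> carrier_vec n"
  shows "proj 1 v = 0\<^sub>v n"
  using act_proj[of 1 1 v] assms by (intro fixed_space_trivial) auto

text \<open>The sum is the trace of \<open>proj 1\<close> after \<open>\<rho> g\<close>, and the
  image of \<open>proj 1\<close> consists of vectors fixed by \<open>\<tau>\<close>, hence is
  zero.\<close>

lemma sum_tr_tau_coset: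
  assumes "\<rho> \<tau> \<noteq> 1\<^sub>m n" "g \<in> carrier G"
  shows "(\<Sum>k<q. tr (\<tau> [^] k \<otimes> g)) = 0"
  using trace_proj[OF assms(2), of 1] proj_1_eq_0[OF assms(1)] assms(2) by simp

text \<open>An affine map with linear part different from 1 has a fixed point, so all elements of
  the coset \<open>\<tau> ^ k g\<close> are conjugate to \<open>g\<close> by translations. Their
  equal traces add up to 0. The conjugating translation by \<open>v\<close> solves
  \<open>(1 - a g) v = k\<close>.\<close>

lemma tr_nontranslation:
  assumes "\<rho> \<tau> \<noteq> 1\<^sub>m n" "g \<in> carrier G" "\<not> [a g = 1] (mod int q)"
  shows "tr g = 0"
proof -
  have "tr (\<tau> [^] k \<otimes> g) = tr g" for k :: nat
  proof -
    have "\<not> int q dvd 1 - a g" using assms(3) by (metis cong_iff_dvd_diff cong_sym)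
    then obtain m where m: "[(1 - a g) * int m = 1] (mod int q)" using exists_nat_inverse by blast
    let ?v = "m * k"
    have mk: "[(1 - a g) * int ?v = int k] (mod int q)"
      using cong_scalar_right[OF m, of "int k"] by (simp add: mult.assoc)
    have "\<tau> [^] k \<otimes> g \<otimes> \<tau> [^] ?v = \<tau> [^] ?v \<otimes> g"
    proof (rule ab_inj)
      have tg: "\<tau> [^] k \<otimes> g \<in> carrier G" using \<tau> assms by simp
      show "[a (\<tau> [^] k \<otimes> g \<otimes> \<tau> [^] ?v) = a (\<tau> [^] ?v \<otimes> g)] (mod int q)"
        using tau_mult_cong(3)[OF tg] tau_mult_cong(1)[OF assms(2)] by (meson cong_sym cong_trans)
      have "[b (\<tau> [^] k \<otimes> g \<otimes> \<tau> [^] ?v) = b (\<tau> [^] k \<otimes> g) + a (\<tau> [^] k \<otimes> g) * int ?v] (mod int q)"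
        by (rule tau_mult_cong(4)[OF tg])
      also have "[b (\<tau> [^] k \<otimes> g) + a (\<tau> [^] k \<otimes> g) * int ?v = (int k + b g) + a g * int ?v] (mod int q)"
        by (intro cong_add cong_mult tau_mult_cong assms cong_refl)
      also have "[(int k + b g) + a g * int ?v = ((1 - a g) * int ?v + b g) + a g * int ?v] (mod int q)"
        by (intro cong_add cong_refl cong_sym[OF mk])
      also have "((1 - a g) * int ?v + b g) + a g * int ?v = int ?v + b g" by (simp add: algebra_simps)
      also have "[int ?v + b g = b (\<tau> [^] ?v \<otimes> g)] (mod int q)"
        by (rule cong_sym) (rule tau_mult_cong, fact)
      finally show "[b (\<tau> [^] k \<otimes> g \<otimes> \<tau> [^] ?v) = b (\<tau> [^] ?v \<otimes> g)] (mod int q)" .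
    qed (use \<tau> assms in auto)
    then show ?thesis using \<tau> assms by (intro tr_conj[where h = "\<tau> [^] ?v"]) auto
  qed
  then show ?thesis using sum_tr_tau_coset[OF assms(1,2)] q_gt_1 by simp
qed

text \<open>Conjugation by \<open>g\<close> multiplies a translation by \<open>a g\<close>, and
  \<open>a\<close> takes every unit as a value, so the nontrivial translations form one conjugacy
  class.\<close>

lemma tr_tau_pow:
  assumes "\<not> q dvd k"
  shows "tr (\<tau> [^] k) = tr \<tau>"
proof -
  have "\<not> int q dvd int k" using assms by simp
  then obtain g where g: "g \<in> carrier G" "[a g = int k] (mod int q)" using a_surj by blast
  then have "\<tau> [^] k \<otimes> g = g \<otimes> \<tau> [^] (1::nat)" by (intro tau_commute) auto
  then show ?thesis using g \<tau> by (intro tr_conj[where h = g]) auto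
qed

lemma sum_tr_tau:
  "(\<Sum>k<q. \<nu> ^ k * tr (\<tau> [^] k)) = of_nat n + (\<Sum>k=1..<q. \<nu> ^ k) * tr \<tau>"
proof -
  have "(\<Sum>k<q. \<nu> ^ k * tr (\<tau> [^] k)) = tr \<one> + (\<Sum>k=1..<q. \<nu> ^ k * tr (\<tau> [^] k))"
    using q_gt_1 sum.atLeast_Suc_lessThan[of 0 q "\<lambda>k. \<nu> ^ k * tr (\<tau> [^] k)"]
    by (simp add: atLeast0LessThan)
  also have "(\<Sum>k=1..<q. \<nu> ^ k * tr (\<tau> [^] k)) = (\<Sum>k=1..<q. \<nu> ^ k) * tr \<tau>"
    unfolding sum_distrib_right by (intro sum.cong refl) (auto simp: tr_tau_pow nat_dvd_not_less)
  finally show ?thesis by (simp add: tr_one)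
qed

lemma tr_tau:
  assumes "\<rho> \<tau> \<noteq> 1\<^sub>m n"
  shows "of_nat n + of_nat (q - 1) * tr \<tau> = 0"
  using sum_tr_tau_coset[OF assms one_closed] sum_tr_tau[of 1] \<tau> by simp

lemma sum_nontrivial_root:
  fixes \<nu> :: complex
  assumes "\<nu> ^ q = 1" "\<nu> \<noteq> 1"
  shows "(\<Sum>k<q. \<nu> ^ k) = 0"
  using assms by (simp add: geometric_sum)

text \<open>For an eigenvector \<open>w\<close> of \<open>\<rho> \<tau>\<close> with eigenvalue \<open>\<omega>\<close>, every \<open>\<rho> g w\<close> is again an
  eigenvector. So the vectors all of whose translates are projected into the line of \<open>w\<close> form
  an invariant subspace, the projection onto the eigenspace of \<open>\<omega>\<close> has rank 1, and comparing its
  trace \<open>n / (q - 1)\<close> with 1 gives the dimension.\<close>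

lemma proj_into_line:
  assumes nontriv: "\<rho> \<tau> \<noteq> 1\<^sub>m n"
    and w: "w \<in> carrier_vec n" "w \<noteq> 0\<^sub>v n" "\<rho> \<tau> *\<^sub>v w = \<omega> \<cdot>\<^sub>v w"
    and \<nu>: "\<nu> ^ q = 1" "\<nu> * \<omega> = 1" "\<omega> \<noteq> 1"
    and v: "v \<in> carrier_vec n"
  shows "\<exists>c. proj \<nu> v = c \<cdot>\<^sub>v w"
proof -
  have \<omega>q: "\<omega> ^ q = 1" using \<nu> by (metis mult_1 power_mult_distrib power_one)
  have lin: "proj \<nu> (x + y) = proj \<nu> x + proj \<nu> y" "proj \<nu> (c \<cdot>\<^sub>v x) = c \<cdot>\<^sub>v proj \<nu> x"
    if "x \<in> carrier_vec n" "y \<in> carrier_vec n" for x y c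
  proof -
    have "\<rho> (\<tau> [^] k) *\<^sub>v (x + y) = \<rho> (\<tau> [^] k) *\<^sub>v x + \<rho> (\<tau> [^] k) *\<^sub>v y" for k :: nat
      using \<tau> that by (intro mult_add_distrib_mat_vec[of _ n n]) auto
    then show "proj \<nu> (x + y) = proj \<nu> x + proj \<nu> y"
      using \<tau> by (auto simp: proj_def distrib_left sum.distrib)
    have "\<rho> (\<tau> [^] k) *\<^sub>v (c \<cdot>\<^sub>v x) = c \<cdot>\<^sub>v (\<rho> (\<tau> [^] k) *\<^sub>v x)" for k :: nat
      using \<tau> that by (intro mult_mat_vec[of _ n n]) auto
    then show "proj \<nu> (c \<cdot>\<^sub>v x) = c \<cdot>\<^sub>v proj \<nu> x"
      using \<tau> by (auto simp: proj_def sum_distrib_left mult.left_commute)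
  qed
  let ?W = "{v \<in> carrier_vec n. \<forall>g\<in>carrier G. \<exists>c. proj \<nu> (\<rho> g *\<^sub>v v) = c \<cdot>\<^sub>v w}"
  have "?W = carrier_vec n"
  proof (rule invariant_subspace_trivial)
    have "\<exists>c. proj \<nu> (\<rho> g *\<^sub>v w) = c \<cdot>\<^sub>v w" if g: "g \<in> carrier G" for g
    proof -
      obtain k where k: "[a g * int k = int 1] (mod int q)" using exists_nat_inverse[OF a_nz[OF g]] by auto
      from tau_commute[OF g k] have c: "\<tau> \<otimes> g = g \<otimes> \<tau> [^] k" using \<tau> by simp
      have "\<rho> \<tau> *\<^sub>v (\<rho> g *\<^sub>v w) = \<rho> g *\<^sub>v (\<rho> (\<tau> [^] k) *\<^sub>v w)"
        using act_mult[of \<tau> g w] act_mult[of g "\<tau> [^] k" w] c g w \<tau> by simp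
      also have "\<dots> = \<omega> ^ k \<cdot>\<^sub>v (\<rho> g *\<^sub>v w)"
        using act_pow_eigenvector[OF \<tau>(1) w(1,3), of k] mult_mat_vec[of "\<rho> g" n n w "\<omega> ^ k"] g w by simp
      finally have ev: "proj \<nu> (\<rho> g *\<^sub>v w) = (\<Sum>j<q. (\<nu> * \<omega> ^ k) ^ j) \<cdot>\<^sub>v (\<rho> g *\<^sub>v w)"
        using g by (intro proj_eigenvector) auto
      show ?thesis
      proof (cases "\<nu> * \<omega> ^ k = 1")
        case False
        have "(\<nu> * \<omega> ^ k) ^ q = 1"
          using \<nu>(1) \<omega>q by (simp add: power_mult_distrib power_mult[symmetric] mult.commute[of k] power_mult)
        then have "(\<Sum>j<q. (\<nu> * \<omega> ^ k) ^ j) = 0" using False by (rule sum_nontrivial_root)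
        then have "proj \<nu> (\<rho> g *\<^sub>v w) = 0 \<cdot>\<^sub>v w" unfolding ev using g w by auto
        then show ?thesis by blast
      next
        case True
        then have \<omega>k: "\<omega> ^ k = \<omega>" using \<nu>(2) by (metis mult.assoc mult.commute mult_1)
        \<comment> \<open>\<open>\<omega>\<close> is a nontrivial \<open>q\<close>-th root of unity
          and \<open>\<omega> ^ k = \<omega>\<close>. If \<open>k - 1\<close> had an inverse
          \<open>m\<close> modulo \<open>q\<close>, then \<open>k m = m + 1\<close> modulo
          \<open>q\<close> would turn this into \<open>\<omega> ^ m = \<omega> ^ (m + 1)\<close>,
          that is \<open>\<omega> = 1\<close>.\<close>
        have "[int k = 1] (mod int q)"
        proof (rule ccontr)
          assume ne: "\<not> [int k = 1] (mod int q)"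
          then have "\<not> int q dvd int k - 1" by (simp add: cong_iff_dvd_diff)
          then obtain m where m: "[(int k - 1) * int m = 1] (mod int q)" using exists_nat_inverse by blast
          have "\<omega> ^ (k * m) = \<omega> ^ m" using \<omega>k by (simp add: power_mult)
          moreover have "[k * m = m + 1] (mod q)"
          proof -
            have "[(int k - 1) * int m + int m = 1 + int m] (mod int q)" using m by (intro cong_add) auto
            then have "[int (k * m) = int (m + 1)] (mod int q)" by (simp add: algebra_simps)
            then show ?thesis by (simp only: cong_int_iff)
          qed
          then have "\<omega> ^ (k * m) = \<omega> ^ (m + 1)"
            by (metis \<omega>q Cong.cong_def div_mult_mod_eq mult_1 power_add power_mult power_one mult.commute)
          moreover have "\<omega> \<noteq> 0" using \<nu>(2) by auto
          ultimately show False using \<nu>(3) by simp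
        qed
        then have "[a g * int k = a g * 1] (mod int q)" by (rule cong_scalar_left)
        then have ag: "[a g = 1] (mod int q)" using k by (metis cong_sym cong_trans mult.right_neutral of_nat_1)
        obtain m where "[int m = b g] (mod int q)" using exists_nat_cong by blast
        then have "g = \<tau> [^] m" using g ag by (intro translation_eq_tau_pow) (auto intro: cong_sym)
        then have "\<rho> g *\<^sub>v w = \<omega> ^ m \<cdot>\<^sub>v w" using act_pow_eigenvector[OF \<tau>(1) w(1,3)] by simp
        then show ?thesis unfolding ev by (auto simp: smult_smult_assoc)
      qed
    qed
    then show "w \<in> ?W" using w by simp
    show "w \<noteq> 0\<^sub>v n" by fact
  next
    have "\<rho> g *\<^sub>v 0\<^sub>v n = 0\<^sub>v n" if "g \<in> carrier G" for g
      using that by (auto simp: scalar_prod_def)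
    moreover have "proj \<nu> (0\<^sub>v n) = 0 \<cdot>\<^sub>v w" using \<tau> w by (auto simp: proj_def scalar_prod_def)
    ultimately show "0\<^sub>v n \<in> ?W" by auto
  next
    fix x y assume x: "x \<in> ?W" and y: "y \<in> ?W"
    have "\<exists>c. proj \<nu> (\<rho> g *\<^sub>v (x + y)) = c \<cdot>\<^sub>v w" if g: "g \<in> carrier G" for g
    proof -
      obtain c d where "proj \<nu> (\<rho> g *\<^sub>v x) = c \<cdot>\<^sub>v w" "proj \<nu> (\<rho> g *\<^sub>v y) = d \<cdot>\<^sub>v w"
        using x y g by blast
      moreover have "\<rho> g *\<^sub>v (x + y) = \<rho> g *\<^sub>v x + \<rho> g *\<^sub>v y"
        using g x y by (intro mult_add_distrib_mat_vec[of _ n n]) auto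
      ultimately have "proj \<nu> (\<rho> g *\<^sub>v (x + y)) = (c + d) \<cdot>\<^sub>v w"
        using g lin(1)[of "\<rho> g *\<^sub>v x" "\<rho> g *\<^sub>v y"] by (simp add: add_smult_distrib_vec)
      then show ?thesis by blast
    qed
    then show "x + y \<in> ?W" using x y by simp
  next
    fix d x assume x: "x \<in> ?W"
    have "\<exists>c. proj \<nu> (\<rho> g *\<^sub>v (d \<cdot>\<^sub>v x)) = c \<cdot>\<^sub>v w" if g: "g \<in> carrier G" for g
    proof -
      obtain c where "proj \<nu> (\<rho> g *\<^sub>v x) = c \<cdot>\<^sub>v w" using x g by blast
      moreover have "\<rho> g *\<^sub>v (d \<cdot>\<^sub>v x) = d \<cdot>\<^sub>v (\<rho> g *\<^sub>v x)"
        using g x by (intro mult_mat_vec[of _ n n]) auto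
      ultimately have "proj \<nu> (\<rho> g *\<^sub>v (d \<cdot>\<^sub>v x)) = (d * c) \<cdot>\<^sub>v w"
        using g lin(2)[of "\<rho> g *\<^sub>v x" "\<rho> g *\<^sub>v x" d] by (simp add: smult_smult_assoc)
      then show ?thesis by blast
    qed
    then show "d \<cdot>\<^sub>v x \<in> ?W" using x by simp
  next
    fix h x assume h: "h \<in> carrier G" and x: "x \<in> ?W"
    have "\<exists>c. proj \<nu> (\<rho> g *\<^sub>v (\<rho> h *\<^sub>v x)) = c \<cdot>\<^sub>v w" if "g \<in> carrier G" for g
    proof -
      have "g \<otimes> h \<in> carrier G" using h that by simp
      then obtain c where "proj \<nu> (\<rho> (g \<otimes> h) *\<^sub>v x) = c \<cdot>\<^sub>v w" using x by blast
      then show ?thesis using act_mult[of g h x] x h that by auto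
    qed
    then show "\<rho> h *\<^sub>v x \<in> ?W" using h by simp
  qed auto
  then show ?thesis using v act_one[OF v] by force
qed

lemma dim_eq:
  assumes "\<rho> \<tau> \<noteq> 1\<^sub>m n"
  shows "n = q - 1"
proof -
  obtain w \<omega> where w: "w \<in> carrier_vec n" "w \<noteq> 0\<^sub>v n" "\<rho> \<tau> *\<^sub>v w = \<omega> \<cdot>\<^sub>v w"
    using exists_eigenvector[OF \<tau>(1)] by blast
  obtain k where k: "k < n" "w $ k \<noteq> 0" using w by (metis carrier_vecD dim_vec eq_vecI index_zero_vec)
  have "\<omega> ^ q \<cdot>\<^sub>v w = w"
    using act_pow_eigenvector[OF \<tau>(1) w(1,3), of q] tau_pow_q w act_one by simp
  then have "(\<omega> ^ q \<cdot>\<^sub>v w) $ k = w $ k" by simp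
  then have \<omega>q: "\<omega> ^ q = 1" using k w by simp
  have \<omega>1: "\<omega> \<noteq> 1" using fixed_space_trivial[OF assms w(1)] w by auto
  have "\<omega> \<noteq> 0" using \<omega>q q_gt_1 by (auto simp: power_0_left)
  define \<nu> where "\<nu> = inverse \<omega>"
  have \<nu>: "\<nu> ^ q = 1" "\<nu> * \<omega> = 1" "\<nu> \<noteq> 1"
    using \<omega>q \<omega>1 \<open>\<omega> \<noteq> 0\<close> by (simp_all add: \<nu>_def power_inverse)
  have "\<forall>i. \<exists>c. proj \<nu> (unit_vec n i) = c \<cdot>\<^sub>v w"
    using proj_into_line[OF assms w \<nu>(1,2) \<omega>1] by simp
  then obtain l where l: "\<And>i. proj \<nu> (unit_vec n i) = l i \<cdot>\<^sub>v w" by metis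
  define M where "M = mat n n (\<lambda>(i, j). \<Sum>k<q. \<nu> ^ k * \<rho> (\<tau> [^] k) $$ (i, j))"
  have Mv: "M *\<^sub>v v = proj \<nu> v" if "v \<in> carrier_vec n" for v
  proof (rule eq_vecI)
    fix i assume "i < dim_vec (proj \<nu> v)"
    then have i: "i < n" by (simp add: proj_def)
    have "(M *\<^sub>v v) $ i = (\<Sum>j<n. \<Sum>k<q. \<nu> ^ k * (\<rho> (\<tau> [^] k) $$ (i, j) * v $ j))"
      using that i by (simp add: M_def scalar_prod_def atLeast0LessThan sum_distrib_right mult.assoc)
    also have "\<dots> = proj \<nu> v $ i"
      by (subst sum.swap)
         (use that i \<tau> in \<open>simp add: proj_def scalar_prod_def atLeast0LessThan sum_distrib_left\<close>)
    finally show "(M *\<^sub>v v) $ i = proj \<nu> v $ i" .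
  qed (simp add: M_def proj_def)
  have M: "M \<in> carrier_mat n n" by (simp add: M_def)
  have Mij: "M $$ (i, j) = l j * w $ i" if "i < n" "j < n" for i j
    using mult_mat_unit_vec_index[OF M that] Mv[of "unit_vec n j"] l[of j] that w by simp
  \<comment> \<open>\<open>M\<close> has entries \<open>l j * w $ i\<close>, so its trace is the
    factor by which it multiplies \<open>w\<close>, and that factor is \<open>q\<close>. The second
    evaluation of the trace, through \<open>trace_proj\<close> at the identity, brings in
    \<open>n\<close> and \<open>tr \<tau>\<close>.\<close>
  have "proj \<nu> w = of_nat q \<cdot>\<^sub>v w"
    using proj_eigenvector[OF w(1,3), of \<nu>] \<nu> by simp
  then have "(M *\<^sub>v w) $ k = of_nat q * w $ k" using Mv w k by simp
  moreover have "(M *\<^sub>v w) $ k = (\<Sum>j<n. l j * w $ j) * w $ k"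
    unfolding sum_distrib_right using M w k by (simp add: scalar_prod_def atLeast0LessThan Mij mult_ac)
  ultimately have "(\<Sum>j<n. l j * w $ j) = of_nat q" using k by simp
  also have "(\<Sum>j<n. l j * w $ j) = (\<Sum>i<n. proj \<nu> (\<rho> \<one> *\<^sub>v unit_vec n i) $ i)"
    using w by (intro sum.cong refl) (simp add: act_one l)
  also have "\<dots> = of_nat n + (\<Sum>k=1..<q. \<nu> ^ k) * tr \<tau>"
    using trace_proj[OF one_closed, of \<nu>] sum_tr_tau[of \<nu>] \<tau> by simp
  also have "(\<Sum>k=1..<q. \<nu> ^ k) = - 1"
    using sum_nontrivial_root[OF \<nu>(1,3)] q_gt_1 sum.atLeast_Suc_lessThan[of 0 q "\<lambda>k. \<nu> ^ k"]
    by (simp add: atLeast0LessThan add_eq_0_iff)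
  finally have t: "tr \<tau> = of_nat n - of_nat q" by (simp add: algebra_simps)
  \<comment> \<open>Eliminating \<open>tr \<tau>\<close> between this evaluation and
    \<open>tr_tau\<close> leaves \<open>q (n - (q - 1)) = 0\<close>.\<close>
  have "of_nat n + of_nat (q - 1) * (of_nat n - of_nat q) = (0::complex)"
    using tr_tau[OF assms] by (simp only: t)
  also have "of_nat n + of_nat (q - 1) * (of_nat n - of_nat q) = (of_nat q * (of_nat n - of_nat (q - 1)) :: complex)"
    using q_gt_1 by (simp add: of_nat_diff algebra_simps)
  finally have "of_nat n = (of_nat (q - 1) :: complex)" using q_gt_1 by simp
  then show ?thesis by (simp only: of_nat_eq_iff)
qed

lemma tr_nonlinear:
  assumes "\<rho> \<tau> \<noteq> 1\<^sub>m n" "g \<in> carrier G"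
  shows "tr g = (if \<not> [a g = 1] (mod int q) then 0 else if [b g = 0] (mod int q) then of_nat (q - 1) else - 1)"
proof -
  have "tr g = of_nat (q - 1)" if "[a g = 1] (mod int q)" "[b g = 0] (mod int q)"
  proof -
    have "g = \<tau> [^] (0::nat)" using that assms by (intro translation_eq_tau_pow) auto
    then show ?thesis using tr_one dim_eq[OF assms(1)] by simp
  qed
  moreover have "tr g = - 1" if "[a g = 1] (mod int q)" "\<not> [b g = 0] (mod int q)"
  proof -
    obtain m where m: "[int m = b g] (mod int q)" using exists_nat_cong by blast
    then have "g = \<tau> [^] m" using that assms by (intro translation_eq_tau_pow) (auto intro: cong_sym)
    moreover have "\<not> q dvd m"
      using m that(2) by (metis cong_0_iff cong_sym cong_trans of_nat_dvd_iff)
    ultimately have "tr g = tr \<tau>" by (simp add: tr_tau_pow)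
    moreover have "of_nat (q - 1) * (1 + tr \<tau>) = 0"
      using tr_tau[OF assms(1)] dim_eq[OF assms(1)] by (simp add: algebra_simps)
    ultimately show ?thesis using q_gt_1 by (auto simp: add_eq_0_iff)
  qed
  ultimately show ?thesis using tr_nontranslation[OF assms] by auto
qed

end

theorem character_cases:
  assumes prim: "\<And>u. \<not> int q dvd u \<Longrightarrow> \<exists>i::nat. [u = g0 ^ i] (mod int q)"
    and g0: "[g0 ^ (q - 1) = 1] (mod int q)"
  obtains (linear) \<omega> where "\<omega> ^ (q - 1) = 1"
      "\<And>g i. g \<in> carrier G \<Longrightarrow> [a g = g0 ^ i] (mod int q) \<Longrightarrow> tr g = \<omega> ^ i"
  | (nonlinear) "\<And>g. g \<in> carrier G \<Longrightarrow> tr g =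
      (if \<not> [a g = 1] (mod int q) then 0 else if [b g = 0] (mod int q) then of_nat (q - 1) else - 1)"
proof (cases "\<forall>g\<in>carrier G. [a g = 1] (mod int q) \<longrightarrow> \<rho> g = 1\<^sub>m n")
  case True
  then show ?thesis using translation_trivial_imp_linear[OF _ prim g0] linear by metis
next
  case False
  then obtain t where t: "t \<in> carrier G" "[a t = 1] (mod int q)" "\<rho> t \<noteq> 1\<^sub>m n" by blast
  have "\<not> int q dvd b t"
  proof
    assume "int q dvd b t"
    then have "t = \<one>"
      using t a_one b_one by (intro ab_inj) (auto simp flip: cong_0_iff intro: cong_trans cong_sym)
    then show False using t rho_one by simp
  qed
  \<comment> \<open>A power of \<open>t\<close> is the translation by 1. It still acts nontrivially,
    because \<open>t\<close> is in turn a power of it.\<close>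
  then obtain m where "[b t * int m = 1] (mod int q)" using exists_nat_inverse by blast
  then have \<tau>: "t [^] m \<in> carrier G" "[a (t [^] m) = 1] (mod int q)" "[b (t [^] m) = 1] (mod int q)"
    using ab_pow_translation[OF t(1,2), of m] t by (auto simp: mult.commute intro: cong_trans)
  have "\<rho> (t [^] m) \<noteq> 1\<^sub>m n"
  proof
    assume triv: "\<rho> (t [^] m) = 1\<^sub>m n"
    obtain k where "[int k = b t] (mod int q)" using exists_nat_cong by blast
    then have tk: "t = (t [^] m) [^] k" using t by (intro translation_eq_tau_pow[OF \<tau>]) (auto intro: cong_sym)
    have "\<rho> ((t [^] m) [^] j) = 1\<^sub>m n" for j :: nat
      by (induction j) (use \<tau>(1) in \<open>simp_all add: rho_one rho_mult triv\<close>)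
    then show False using t(3) tk by metis
  qed
  then show ?thesis using tr_nonlinear[OF \<tau>] nonlinear by blast
qed

end

section \<open>The index of 2\<close>

text \<open>Lagrange in the unit group: \<open>l\<close> is the order of 2, recorded only through
  the exponents that it divides.\<close>

lemma index_of_two_mult_order:
  assumes p: "Factorial_Ring.prime p" "odd p"
  obtains l where "index_of_two p * l = p - 1" "\<And>k::nat. [2 ^ k = 1] (mod int p) \<longleftrightarrow> l dvd k"
proof -
  have p2: "p > 2" using p prime_gt_1_nat[OF p(1)] by (cases "p = 2") auto
  interpret R: residues_prime "p" "residue_ring (int p)"
    using p by unfold_locales auto
  let ?U = "units_of (residue_ring (int p))"
  interpret U: group ?U by (rule R.units_group)
  have two: "2 \<in> carrier ?U"
    using p2 by (auto simp: units_of_carrier R.res_prime_units_eq)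
  have card: "Coset.order ?U = p - 1"
    using p2 by (simp add: Coset.order_def units_of_carrier R.res_prime_units_eq)
  have "U.ord 2 = card (generate ?U {2})" using two by (rule U.generate_pow_card)
  moreover have "card (rcosets\<^bsub>?U\<^esub> (generate ?U {2})) * card (generate ?U {2}) = Coset.order ?U"
    using two by (intro U.lagrange U.generate_is_subgroup) auto
  ultimately have "index_of_two p * U.ord 2 = p - 1"
    by (simp add: index_of_two_def card Let_def)
  moreover have "[2 ^ k = 1] (mod int p) \<longleftrightarrow> U.ord 2 dvd k" for k :: nat
  proof -
    have "2 [^]\<^bsub>?U\<^esub> k = 2 [^]\<^bsub>residue_ring (int p)\<^esub> k"
      by (induction k) (simp_all add: units_of_one units_of_mult)
    also have "\<dots> = 2 ^ k mod int p"
      using R.pow_cong[of 2 k] p2 by simp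
    finally have "2 [^]\<^bsub>?U\<^esub> k = \<one>\<^bsub>?U\<^esub> \<longleftrightarrow> 2 ^ k mod int p = 1"
      by (simp add: units_of_one R.res_one_eq)
    moreover have "[2 ^ k = 1] (mod int p) \<longleftrightarrow> 2 ^ k mod int p = 1"
    proof -
      have "1 mod int p = 1" using p2 by simp
      then show ?thesis unfolding Cong.cong_def by metis
    qed
    ultimately show ?thesis using U.pow_eq_id[OF two, of k] by metis
  qed
  ultimately show ?thesis using that by blast
qed

text \<open>Since index times order is \<open>p - 1\<close>, \<open>q\<close> divides the index
  exactly when the order of 2 divides \<open>(p - 1) / q\<close>. The right side is Euler's
  criterion for 2 to be a \<open>q\<close>-th power modulo \<open>p\<close>, the form in which the
  Frobenius element sees it.\<close>

lemma dvd_index_of_two_iff: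
  assumes p: "Factorial_Ring.prime p" "odd p" and q: "q > 0"
  shows "q dvd index_of_two p \<longleftrightarrow> q dvd p - 1 \<and> [2 ^ ((p - 1) div q) = 1] (mod int p)"
proof -
  obtain l where l: "index_of_two p * l = p - 1" "\<And>k::nat. [2 ^ k = 1] (mod int p) \<longleftrightarrow> l dvd k"
    using index_of_two_mult_order[OF p] by blast
  have "p - 1 > 0" using prime_gt_1_nat[OF p(1)] by simp
  then have pos: "index_of_two p > 0" "l > 0" using l(1) by (metis mult_is_0 neq0_conv)+
  show ?thesis
  proof
    assume "q dvd index_of_two p"
    then obtain k where k: "index_of_two p = q * k" by blast
    then have "p - 1 = q * (k * l)" using l(1) by (simp add: mult_ac)
    then show "q dvd p - 1 \<and> [2 ^ ((p - 1) div q) = 1] (mod int p)"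
      using q by (simp add: l(2))
  next
    assume "q dvd p - 1 \<and> [2 ^ ((p - 1) div q) = 1] (mod int p)"
    then obtain k where k: "p - 1 = q * k" "l dvd k" using q l(2) by auto
    then obtain j where "k = l * j" by blast
    then have "index_of_two p * l = (q * j) * l" using k l(1) by (simp add: mult_ac)
    then show "q dvd index_of_two p" using pos by simp
  qed
qed

section \<open>Automorphisms of subfields of the complex numbers\<close>

lemma gal_Q_hom:
  assumes "\<sigma> \<in> carrier (gal_Q L)"
  shows "x \<in> L \<Longrightarrow> \<sigma> x \<in> L"
    "x \<in> L \<Longrightarrow> y \<in> L \<Longrightarrow> \<sigma> (x + y) = \<sigma> x + \<sigma> y"
    "x \<in> L \<Longrightarrow> y \<in> L \<Longrightarrow> \<sigma> (x * y) = \<sigma> x * \<sigma> y"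
    "\<sigma> 1 = 1" "r \<in> \<rat> \<Longrightarrow> \<sigma> r = r"
    "\<sigma> \<in> Bij L" "inj_on \<sigma> L"
  using assms by (auto simp: gal_Q_def Ring.ring_hom_def Bij_def bij_betw_def)

lemma gal_Q_mult: "\<sigma> \<in> carrier (gal_Q L) \<Longrightarrow> \<tau> \<in> carrier (gal_Q L) \<Longrightarrow> \<sigma> \<otimes>\<^bsub>gal_Q L\<^esub> \<tau> = compose L \<sigma> \<tau>"
  by (simp add: gal_Q_def BijGroup_def)

lemma group_gal_Q:
  assumes one: "1 \<in> L" and add: "\<And>x y. x \<in> L \<Longrightarrow> y \<in> L \<Longrightarrow> x + y \<in> L"
    and mult: "\<And>x y. x \<in> L \<Longrightarrow> y \<in> L \<Longrightarrow> x * y \<in> L" and rat: "\<rat> \<subseteq> L"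
  shows "group (gal_Q L)"
proof -
  interpret B: group "BijGroup L" by (rule group_BijGroup)
  let ?H = "{\<sigma> \<in> Bij L. \<sigma> \<in> Ring.ring_hom (class_ring\<lparr>carrier := L\<rparr>) (class_ring\<lparr>carrier := L\<rparr>)
                             \<and> (\<forall>r \<in> \<rat>. \<sigma> r = r)}"
  have "subgroup ?H (BijGroup L)"
  proof (rule B.subgroupI)
    show "?H \<subseteq> carrier (BijGroup L)" by (auto simp: BijGroup_def)
    have "(\<lambda>x\<in>L. x) \<in> ?H"
      using assms by (auto simp: id_Bij Ring.ring_hom_def)
    then show "?H \<noteq> {}" by blast
  next
    fix \<sigma> \<tau> assume st: "\<sigma> \<in> ?H" "\<tau> \<in> ?H"
    have "compose L \<sigma> \<tau> \<in> ?H"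
      using st assms compose_Bij[of \<sigma> L \<tau>]
      by (auto simp: Ring.ring_hom_def compose_def Pi_iff)
    then show "\<sigma> \<otimes>\<^bsub>BijGroup L\<^esub> \<tau> \<in> ?H" using st by (simp add: BijGroup_def)
  next
    fix \<sigma> assume s: "\<sigma> \<in> ?H"
    have bij: "bij_betw \<sigma> L L" using s by (simp add: Bij_def)
    have inv: "inv_into L \<sigma> (\<sigma> x) = x" "inv_into L \<sigma> x \<in> L" "\<sigma> (inv_into L \<sigma> x) = x" if "x \<in> L" for x
      using that bij by (auto simp: bij_betw_def f_inv_into_f inv_into_into)
    have hom: "\<sigma> (x + y) = \<sigma> x + \<sigma> y" "\<sigma> (x * y) = \<sigma> x * \<sigma> y" if "x \<in> L" "y \<in> L" for x y
      using s that by (auto simp: Ring.ring_hom_def)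
    have "inv_into L \<sigma> (x + y) = inv_into L \<sigma> x + inv_into L \<sigma> y"
      "inv_into L \<sigma> (x * y) = inv_into L \<sigma> x * inv_into L \<sigma> y" if "x \<in> L" "y \<in> L" for x y
      using inv(1)[of "inv_into L \<sigma> x + inv_into L \<sigma> y"] inv(1)[of "inv_into L \<sigma> x * inv_into L \<sigma> y"]
        inv(2,3)[OF that(1)] inv(2,3)[OF that(2)] hom add mult by simp_all
    moreover have "inv_into L \<sigma> r = r" if "r \<in> \<rat>" for r
      using inv(1)[of r] s that rat by auto
    ultimately have "(\<lambda>x\<in>L. inv_into L \<sigma> x) \<in> ?H"
      using s assms restrict_inv_into_Bij[of \<sigma> L] inv(2)
      by (auto simp: Ring.ring_hom_def)
    then show "inv\<^bsub>BijGroup L\<^esub> \<sigma> \<in> ?H" using s by (simp add: inv_BijGroup)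
  qed
  then show ?thesis unfolding gal_Q_def by (rule B.subgroup_imp_group)
qed

lemma gal_Q_power:
  assumes "\<sigma> \<in> carrier (gal_Q L)" "x \<in> L" "1 \<in> L" "\<And>x y. x \<in> L \<Longrightarrow> y \<in> L \<Longrightarrow> x * y \<in> L"
  shows "x ^ n \<in> L \<and> \<sigma> (x ^ n) = \<sigma> x ^ n"
  by (induction n) (use assms gal_Q_hom[OF assms(1)] in auto)

lemma rat_adjoin_closed:
  shows "1 \<in> rat_adjoin S" "\<rat> \<subseteq> rat_adjoin S" "S \<subseteq> rat_adjoin S"
    "x \<in> rat_adjoin S \<Longrightarrow> y \<in> rat_adjoin S \<Longrightarrow> x + y \<in> rat_adjoin S"
    "x \<in> rat_adjoin S \<Longrightarrow> y \<in> rat_adjoin S \<Longrightarrow> x * y \<in> rat_adjoin S"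
  using generate_field.one[of class_ring "\<rat> \<union> S"] generate_field.incl[of _ "\<rat> \<union> S" class_ring]
    generate_field.eng_add[of x class_ring "\<rat> \<union> S" y] generate_field.eng_mult[of x class_ring "\<rat> \<union> S" y]
  by (auto simp: rat_adjoin_def)

lemma class_ring_inverse: "h \<noteq> 0 \<Longrightarrow> inv\<^bsub>class_ring\<^esub> (h :: complex) = inverse h"
  by (simp add: class_ring_simps)

lemma rat_adjoin_inverse: "x \<in> rat_adjoin S \<Longrightarrow> inverse x \<in> rat_adjoin S"
  using generate_field.m_inv[of x class_ring "\<rat> \<union> S"] rat_adjoin_closed(2)[of S]
  by (cases "x = 0") (auto simp: rat_adjoin_def class_ring_inverse)

lemma minus_one_in_rat_adjoin: "- 1 \<in> rat_adjoin S"
proof -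
  have "(- 1 :: complex) \<in> \<rat>" by (subst Rats_minus_iff) simp
  then show ?thesis using rat_adjoin_closed(2) by blast
qed

lemma rat_adjoin_uminus: "x \<in> rat_adjoin S \<Longrightarrow> - x \<in> rat_adjoin S"
  using rat_adjoin_closed(5)[OF minus_one_in_rat_adjoin, of x S] by simp

lemma gal_Q_rat_adjoin_eqI:
  assumes \<sigma>: "\<sigma> \<in> carrier (gal_Q (rat_adjoin S))" and \<tau>: "\<tau> \<in> carrier (gal_Q (rat_adjoin S))"
    and eq: "\<And>x. x \<in> S \<Longrightarrow> \<sigma> x = \<tau> x"
  shows "\<sigma> = \<tau>"
proof
  fix x
  let ?L = "rat_adjoin S"
  note hs = gal_Q_hom[OF \<sigma>] and ht = gal_Q_hom[OF \<tau>]
  have "x \<in> ?L \<and> \<sigma> x = \<tau> x" if "x \<in> generate_field class_ring (\<rat> \<union> S)" for x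
    using that
  proof (induction rule: generate_field.induct)
    case (incl h)
    then show ?case using rat_adjoin_closed(2,3)[of S] eq hs(5) ht(5) by auto
  next
    case (a_inv h)
    have neg: "\<phi> (- h) = - \<phi> h" if "\<phi> \<in> carrier (gal_Q ?L)" for \<phi>
      using gal_Q_hom(3)[OF that, of "-1" h] gal_Q_hom(5)[OF that, of "-1"] a_inv minus_one_in_rat_adjoin[of S]
      by auto
    show ?case using a_inv neg[OF \<sigma>] neg[OF \<tau>] by (auto simp: class_ring_simps rat_adjoin_uminus)
  next
    case (m_inv h)
    have inv: "\<phi> (inverse h) = inverse (\<phi> h)" if "\<phi> \<in> carrier (gal_Q ?L)" for \<phi>
    proof -
      have "\<phi> h * \<phi> (inverse h) = 1"
        using gal_Q_hom(3)[OF that, of h "inverse h"] gal_Q_hom(4)[OF that] m_inv rat_adjoin_inverse by auto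
      then show ?thesis by (metis inverse_unique)
    qed
    show ?case using m_inv inv[OF \<sigma>] inv[OF \<tau>] by (auto simp: class_ring_inverse rat_adjoin_inverse)
  qed (use hs ht rat_adjoin_closed[where S = S] in auto)
  then have "x \<in> ?L \<Longrightarrow> \<sigma> x = \<tau> x" by (auto simp: rat_adjoin_def)
  \<comment> \<open>Off the field both maps take the default value, as members of \<open>Bij\<close>
    are extensional.\<close>
  moreover have "x \<notin> ?L \<Longrightarrow> \<sigma> x = \<tau> x"
    using hs(6) ht(6) by (auto simp: Bij_def extensional_def)
  ultimately show "\<sigma> x = \<tau> x" by blast
qed

section \<open>Prime ideals of rings of integers\<close>

text \<open>That the algebraic integers of \<open>L\<close> are closed under addition and multiplication is
  part of the assumption that \<open>P\<close> is a prime ideal.\<close>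

locale integers_prime =
  fixes L P assumes ideal: "primeideal P (integers_of L)" and rat: "\<rat> \<subseteq> L"
begin

sublocale I: primeideal P "integers_of L" by (rule ideal)

abbreviation "OL \<equiv> carrier (integers_of L)"

lemma OL_closed: "x \<in> OL \<Longrightarrow> y \<in> OL \<Longrightarrow> x + y \<in> OL" "x \<in> OL \<Longrightarrow> y \<in> OL \<Longrightarrow> x * y \<in> OL" "of_int k \<in> OL"
proof -
  show "x \<in> OL \<Longrightarrow> y \<in> OL \<Longrightarrow> x + y \<in> OL" using I.a_closed[of x y] by (simp add: integers_of_def)
  show "x \<in> OL \<Longrightarrow> y \<in> OL \<Longrightarrow> x * y \<in> OL" using I.m_closed[of x y] by (simp add: integers_of_def)
  show "of_int k \<in> OL" using rat by (auto simp: integers_of_def intro: int_imp_algebraic_int)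
qed

lemma OL_power: "x \<in> OL \<Longrightarrow> x ^ n \<in> OL"
  using OL_closed(3)[of 1] by (induction n) (auto intro: OL_closed)

lemma P_closed: "x \<in> P \<Longrightarrow> y \<in> P \<Longrightarrow> x + y \<in> P" "x \<in> OL \<Longrightarrow> y \<in> P \<Longrightarrow> x * y \<in> P" "0 \<in> P"
  using I.a_closed[of x y] I.I_l_closed[of y x] additive_subgroup.zero_closed[OF I.is_additive_subgroup]
    additive_subgroup.a_closed[OF I.is_additive_subgroup, of x y]
  by (auto simp: integers_of_def)

lemma P_uminus: "x \<in> P \<Longrightarrow> - x \<in> P"
  using P_closed(2)[of "-1" x] OL_closed(3)[of "-1"] by simp

lemma P_prime: "x \<in> OL \<Longrightarrow> y \<in> OL \<Longrightarrow> x * y \<in> P \<Longrightarrow> x \<in> P \<or> y \<in> P"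
  using I.I_prime[of x y] by (simp add: integers_of_def)

lemma P_subset: "P \<subseteq> OL"
  using additive_subgroup.a_subset[OF I.is_additive_subgroup] .

lemma one_notin_P: "1 \<notin> P"
  using P_closed(2)[of _ 1] P_subset I.I_notcarr by fastforce

text \<open>\<open>P\<close> meets the integers in a proper ideal containing \<open>p\<close>: by
  Bezout an integer prime to \<open>p\<close> would put 1 into \<open>P\<close>.\<close>

lemma of_int_in_P_iff:
  assumes "Factorial_Ring.prime p" "of_nat p \<in> P"
  shows "of_int k \<in> P \<longleftrightarrow> int p dvd k"
proof
  assume k: "of_int k \<in> P"
  show "int p dvd k"
  proof (rule ccontr)
    assume "\<not> int p dvd k"
    then have "coprime (int p) k" using assms(1) by (intro prime_imp_coprime) auto
    then obtain u v where "u * int p + v * k = 1" using bezout_int[of "int p" k] by (auto simp: coprime_iff_gcd_eq_1)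
    then have "of_int u * of_nat p + of_int v * of_int k = (1 :: complex)"
      by (metis of_int_1 of_int_add of_int_mult of_int_of_nat_eq)
    then show False using one_notin_P P_closed(1)[OF P_closed(2)[OF OL_closed(3) assms(2)] P_closed(2)[OF OL_closed(3) k]]
      by metis
  qed
next
  assume "int p dvd k"
  then obtain j where "k = int p * j" by blast
  then show "of_int k \<in> P" using P_closed(2)[OF OL_closed(3)[of j] assms(2)] by (simp add: mult.commute)
qed

lemma power_cong_1: "x \<in> OL \<Longrightarrow> x - 1 \<in> P \<Longrightarrow> x ^ n - 1 \<in> P"
proof (induction n)
  case (Suc n)
  have "x ^ Suc n - 1 = x * (x ^ n - 1) + (x - 1)" by (simp add: algebra_simps)
  then show ?case using Suc P_closed by metis
qed (simp add: P_closed)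

text \<open>Distinct roots of unity of order prime to \<open>P\<close> stay distinct modulo \<open>P\<close>, since
  \<open>1 + x + \<dots> + x\<^bsup>q - 1\<^esup>\<close> is 0 for a root of unity \<open>x \<noteq> 1\<close>, but \<open>q\<close> for \<open>x\<close> congruent to 1.\<close>

lemma root_of_unity_cong_1:
  assumes x: "x \<in> OL" "x ^ q = 1" "x - 1 \<in> P"
    and p: "Factorial_Ring.prime p" "of_nat p \<in> P" "\<not> p dvd q"
  shows "x = 1"
proof (rule ccontr)
  assume "x \<noteq> 1"
  then have "(\<Sum>i<q. x ^ i) = 0" using x(2) by (simp add: geometric_sum)
  moreover have "(\<Sum>i<m. x ^ i) - of_nat m \<in> P" for m :: nat
  proof (induction m)
    case (Suc m)
    have "(\<Sum>i<Suc m. x ^ i) - of_nat (Suc m) = ((\<Sum>i<m. x ^ i) - of_nat m) + (x ^ m - 1)" by simp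
    then show ?case using Suc power_cong_1[OF x(1,3)] P_closed(1) by metis
  qed (simp add: P_closed)
  ultimately have "- of_nat q \<in> P" by (metis diff_0)
  then have "of_int (int q) \<in> P" using P_uminus by fastforce
  then show False unfolding of_int_in_P_iff[OF p(1,2)] using p(3) by simp
qed

end


section \<open>The Galois group of the Kummer field\<close>

locale kummer =
  fixes q :: nat
  assumes prime_q: "Factorial_Ring.prime q" and odd_q: "odd q"
begin

definition \<zeta> :: complex where "\<zeta> = e_unit (1 / real q)"
definition r2 :: complex where "r2 = of_real (root q 2)"

abbreviation "L \<equiv> L_field q"
abbreviation "Gal \<equiv> G_group q"

lemma q_gt_1: "q > 1" using prime_q prime_gt_1_nat by blast

lemma zeta_power: "\<zeta> ^ k = e_unit (real k / real q)"
  by (simp add: \<zeta>_def e_unit_power)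

lemma zeta_power_eq_iff: "\<zeta> ^ i = \<zeta> ^ j \<longleftrightarrow> [int i = int j] (mod int q)"
proof -
  have "real i / real q = real j / real q + of_int (int i - int j) / real q"
    by (simp add: diff_divide_distrib)
  then have "\<zeta> ^ i = \<zeta> ^ j * e_unit (of_int (int i - int j) / real q)"
    unfolding zeta_power by (metis e_unit_add)
  then have "\<zeta> ^ i = \<zeta> ^ j \<longleftrightarrow> e_unit (of_int (int i - int j) / real q) = 1"
    by (simp add: zeta_power)
  also have "\<dots> \<longleftrightarrow> [int i = int j] (mod int q)"
    unfolding e_unit_eq_1_iff using q_gt_1 by (subst of_int_divide_in_Ints_iff) (auto simp: cong_iff_dvd_diff)
  finally show ?thesis .
qed

lemma zeta_power_q: "\<zeta> ^ q = 1"
  using zeta_power_eq_iff[of q 0] by (simp add: cong_0_iff)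

lemma root_of_unity_eq_zeta_power: "z ^ q = 1 \<Longrightarrow> \<exists>k. z = \<zeta> ^ k"
proof -
  assume "z ^ q = 1"
  then have "z \<in> (\<lambda>k. cis (2 * pi * real k / real q)) ` {..<q}"
    using bij_betw_imp_surj_on[OF Complex.bij_betw_roots_unity[of q]] q_gt_1 by simp
  then show ?thesis by (auto simp only: zeta_power e_unit_cis times_divide_eq_right)
qed

lemma r2_power_q: "r2 ^ q = 2"
  using q_gt_1 by (simp add: r2_def flip: of_real_power)

lemma r2_nonzero: "r2 \<noteq> 0"
  using r2_power_q q_gt_1 by (auto simp: power_0_left)

lemma L_eq: "L = rat_adjoin {\<zeta>, r2}"
  by (simp add: L_field_def \<zeta>_def r2_def)

lemma L_closed:
  "1 \<in> L" "\<rat> \<subseteq> L" "\<zeta> \<in> L" "r2 \<in> L"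
  "x \<in> L \<Longrightarrow> y \<in> L \<Longrightarrow> x + y \<in> L" "x \<in> L \<Longrightarrow> y \<in> L \<Longrightarrow> x * y \<in> L"
  using rat_adjoin_closed[where S = "{\<zeta>, r2}"] unfolding L_eq by blast+

lemma group_Gal: "group Gal"
  unfolding G_group_def by (rule group_gal_Q) (use L_closed in auto)

lemma power_Gal:
  "\<sigma> \<in> carrier Gal \<Longrightarrow> x \<in> L \<Longrightarrow> \<sigma> (x ^ n) = \<sigma> x ^ n" "x \<in> L \<Longrightarrow> x ^ n \<in> L"
proof -
  show "x ^ n \<in> L" if "x \<in> L" using that by (induction n) (auto intro: L_closed)
  show "\<sigma> (x ^ n) = \<sigma> x ^ n" if "\<sigma> \<in> carrier Gal" "x \<in> L"
    using gal_Q_power[of \<sigma> L x n] that L_closed by (simp add: G_group_def)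
qed

text \<open>Together with \<open>bN\<close> these are the matrix coordinates of an automorphism.
  Only their classes modulo \<open>q\<close> are determined, which is why
  \<open>affine_subgroup\<close> is stated with congruences.\<close>

definition aN :: "(complex \<Rightarrow> complex) \<Rightarrow> nat" where "aN \<sigma> = (SOME k. \<sigma> \<zeta> = \<zeta> ^ k)"
definition bN :: "(complex \<Rightarrow> complex) \<Rightarrow> nat" where "bN \<sigma> = (SOME k. \<sigma> r2 = \<zeta> ^ k * r2)"

lemma Gal_zeta:
  assumes "\<sigma> \<in> carrier Gal"
  shows "\<sigma> \<zeta> = \<zeta> ^ aN \<sigma>"
proof -
  have "\<sigma> \<zeta> ^ q = \<sigma> (\<zeta> ^ q)" using assms by (simp add: power_Gal L_closed)
  also have "\<dots> = 1" using gal_Q_hom(4) assms by (simp add: zeta_power_q G_group_def)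
  finally have "\<exists>k. \<sigma> \<zeta> = \<zeta> ^ k" by (rule root_of_unity_eq_zeta_power)
  then show ?thesis unfolding aN_def by (rule someI_ex)
qed

lemma Gal_r2:
  assumes "\<sigma> \<in> carrier Gal"
  shows "\<sigma> r2 = \<zeta> ^ bN \<sigma> * r2"
proof -
  have "\<sigma> r2 ^ q = \<sigma> (r2 ^ q)" using assms by (simp add: power_Gal L_closed)
  also have "\<dots> = 2" using gal_Q_hom(5)[of \<sigma> L 2] assms by (simp add: r2_power_q G_group_def)
  finally have "(\<sigma> r2 / r2) ^ q = 1" by (simp add: power_divide r2_power_q)
  then obtain k where "\<sigma> r2 / r2 = \<zeta> ^ k" using root_of_unity_eq_zeta_power by blast
  then have "\<exists>k. \<sigma> r2 = \<zeta> ^ k * r2" using r2_nonzero by (intro exI[of _ k]) (simp add: field_simps)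
  then show ?thesis unfolding bN_def by (rule someI_ex)
qed

lemma Gal_compose:
  assumes "\<sigma> \<in> carrier Gal" "\<tau> \<in> carrier Gal" "x \<in> L"
  shows "(\<sigma> \<otimes>\<^bsub>Gal\<^esub> \<tau>) x = \<sigma> (\<tau> x)"
  using assms by (simp add: G_group_def gal_Q_mult compose_def)

lemma aN_mult:
  assumes "\<sigma> \<in> carrier Gal" "\<tau> \<in> carrier Gal"
  shows "[int (aN (\<sigma> \<otimes>\<^bsub>Gal\<^esub> \<tau>)) = int (aN \<sigma>) * int (aN \<tau>)] (mod int q)"
proof -
  interpret group Gal by (rule group_Gal)
  have "\<zeta> ^ aN (\<sigma> \<otimes>\<^bsub>Gal\<^esub> \<tau>) = \<sigma> (\<zeta> ^ aN \<tau>)"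
    using assms by (simp flip: Gal_zeta add: Gal_compose L_closed)
  also have "\<dots> = \<zeta> ^ (aN \<sigma> * aN \<tau>)"
    using assms by (simp add: power_Gal L_closed Gal_zeta power_mult)
  finally show ?thesis by (simp add: zeta_power_eq_iff)
qed

lemma bN_mult:
  assumes "\<sigma> \<in> carrier Gal" "\<tau> \<in> carrier Gal"
  shows "[int (bN (\<sigma> \<otimes>\<^bsub>Gal\<^esub> \<tau>)) = int (bN \<sigma>) + int (aN \<sigma>) * int (bN \<tau>)] (mod int q)"
proof -
  interpret group Gal by (rule group_Gal)
  have "\<zeta> ^ bN (\<sigma> \<otimes>\<^bsub>Gal\<^esub> \<tau>) * r2 = (\<sigma> \<otimes>\<^bsub>Gal\<^esub> \<tau>) r2"
    by (rule Gal_r2[symmetric]) (use assms in simp)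
  also have "\<dots> = \<sigma> (\<zeta> ^ bN \<tau> * r2)" by (simp only: Gal_compose[OF assms L_closed(4)] Gal_r2[OF assms(2)])
  also have "\<dots> = \<sigma> (\<zeta> ^ bN \<tau>) * \<sigma> r2"
    using assms gal_Q_hom(3)[of \<sigma> L] by (simp add: G_group_def power_Gal L_closed)
  also have "\<dots> = \<zeta> ^ (aN \<sigma> * bN \<tau>) * (\<zeta> ^ bN \<sigma> * r2)"
    using assms by (simp add: power_Gal L_closed Gal_zeta Gal_r2 power_mult)
  also have "\<dots> = \<zeta> ^ (bN \<sigma> + aN \<sigma> * bN \<tau>) * r2" by (simp add: power_add)
  finally show ?thesis using r2_nonzero by (simp add: zeta_power_eq_iff)
qed

lemma Gal_eqI:
  assumes "\<sigma> \<in> carrier Gal" "\<tau> \<in> carrier Gal"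
    and "[int (aN \<sigma>) = int (aN \<tau>)] (mod int q)" "[int (bN \<sigma>) = int (bN \<tau>)] (mod int q)"
  shows "\<sigma> = \<tau>"
proof (rule gal_Q_rat_adjoin_eqI[where S = "{\<zeta>, r2}"])
  show "\<sigma> \<in> carrier (gal_Q (rat_adjoin {\<zeta>, r2}))" "\<tau> \<in> carrier (gal_Q (rat_adjoin {\<zeta>, r2}))"
    using assms(1,2) by (simp_all add: G_group_def L_eq)
  show "\<sigma> x = \<tau> x" if "x \<in> {\<zeta>, r2}" for x
    using that assms(1,2) assms(3,4)[folded zeta_power_eq_iff] by (auto simp: Gal_zeta Gal_r2)
qed

lemma algebraic_int_zeta_r2: "algebraic_int \<zeta>" "algebraic_int r2"
proof -
  show "algebraic_int r2" unfolding r2_def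
    by (intro algebraic_int_of_real algebraic_int_nth_root_real int_imp_algebraic_int) auto
  show "algebraic_int \<zeta>"
  proof (rule algebraic_int_root[where p = "monom 1 q" and y = 1])
    show "poly (monom 1 q) \<zeta> = 1" by (simp add: poly_monom zeta_power_q)
  qed (use q_gt_1 in \<open>auto simp: degree_monom_eq int_imp_algebraic_int\<close>)
qed

section \<open>Coordinates of Frobenius elements\<close>

context
  fixes p \<sigma> assumes p: "Factorial_Ring.prime p" "odd p" "p \<noteq> q" and frob: "is_frobenius L p \<sigma>"
begin

lemma frobenius_in_Gal: "\<sigma> \<in> carrier Gal"
  using frob by (simp add: is_frobenius_def G_group_def)

text \<open>The Frobenius congruence is applied to \<open>\<zeta>\<close> and to \<open>r2\<close>.
  When \<open>p = q m + 1\<close>, \<open>r2 ^ p = r2 * 2 ^ m\<close>, so after cancelling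
  \<open>r2\<close> the root of unity \<open>\<zeta> ^ bN \<sigma>\<close> is congruent to the
  integer \<open>2 ^ m\<close> modulo \<open>P\<close>. As \<open>q\<close>-th roots of unity stay
  distinct modulo \<open>P\<close>, and \<open>P\<close> meets the integers in the multiples of
  \<open>p\<close>, the first is 1 exactly when the second is 1 modulo \<open>p\<close>.\<close>

lemma frobenius_coordinates:
  shows aN_frobenius: "[int (aN \<sigma>) = int p] (mod int q)"
    and bN_frobenius: "q dvd p - 1 \<Longrightarrow>
      [int (bN \<sigma>) = 0] (mod int q) \<longleftrightarrow> [2 ^ ((p - 1) div q) = 1] (mod int p)"
proof -
  obtain P where P: "primeideal P (integers_of L)" "of_nat p \<in> P"
    and cong: "\<And>\<alpha>. \<alpha> \<in> carrier (integers_of L) \<Longrightarrow> \<sigma> \<alpha> - \<alpha> ^ p \<in> P"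
    using frob by (auto simp: is_frobenius_def)
  interpret I: integers_prime L P
    using P(1) L_closed(2) by (rule integers_prime.intro)
  have OL: "\<zeta> \<in> I.OL" "r2 \<in> I.OL"
    using algebraic_int_zeta_r2 L_closed by (auto simp: integers_of_def)
  have npq: "\<not> p dvd q" using p prime_q primes_dvd_imp_eq by blast
  have zeta1: "[int k = 0] (mod int q)" if "\<zeta> ^ k - 1 \<in> P" for k
  proof -
    have "\<zeta> ^ k = 1"
    proof (rule I.root_of_unity_cong_1[OF _ _ that p(1) P(2) npq])
      show "\<zeta> ^ k \<in> I.OL" using OL by (intro I.OL_power)
      show "(\<zeta> ^ k) ^ q = 1" by (metis mult.commute power_mult power_one zeta_power_q)
    qed
    then show ?thesis using zeta_power_eq_iff[of k 0] by simp
  qed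
  have zeta_cong: "[int i = int j] (mod int q)" if "\<zeta> ^ i - \<zeta> ^ j \<in> P" for i j
  proof -
    \<comment> \<open>\<open>\<zeta> ^ ?m\<close> is the inverse of \<open>\<zeta> ^ j\<close>,
      written with a nonnegative exponent so that it visibly is an algebraic integer of the
      field.\<close>
    let ?m = "(q - 1) * j"
    have jm: "j + ?m = q * j" using q_gt_1 by (cases q) auto
    have "\<zeta> ^ ?m * (\<zeta> ^ i - \<zeta> ^ j) \<in> P" using OL that by (intro I.P_closed I.OL_power)
    moreover have "\<zeta> ^ ?m * (\<zeta> ^ i - \<zeta> ^ j) = \<zeta> ^ (i + ?m) - \<zeta> ^ (j + ?m)"
      by (simp add: algebra_simps power_add)
    moreover have "\<zeta> ^ (j + ?m) = 1" unfolding jm by (simp add: power_mult zeta_power_q)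
    ultimately have "[int (i + ?m) = 0] (mod int q)" using zeta1 by metis
    moreover have "[int (j + ?m) = 0] (mod int q)" unfolding jm by (simp add: cong_0_iff)
    ultimately have "[int i + int ?m = int j + int ?m] (mod int q)"
      by (metis cong_sym cong_trans of_nat_add)
    then show ?thesis by (simp only: cong_add_rcancel)
  qed
  show "[int (aN \<sigma>) = int p] (mod int q)"
    using cong[OF OL(1)] Gal_zeta[OF frobenius_in_Gal] by (intro zeta_cong) simp
  assume "q dvd p - 1"
  then obtain m where m: "p - 1 = q * m" by blast
  then have pm: "p = Suc (q * m)" using prime_gt_1_nat[OF p(1)] by linarith
  have m': "(p - 1) div q = m" using m q_gt_1 by simp
  \<comment> \<open>The \<open>q\<close>-th power of \<open>r2\<close> is 2, which the odd
    \<open>p\<close> does not divide. Outside \<open>P\<close>, \<open>r2\<close> can be cancelled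
    by primality.\<close>
  have "r2 \<notin> P"
  proof
    assume "r2 \<in> P"
    then have "r2 ^ (q - 1) * r2 \<in> P" using OL by (intro I.P_closed I.OL_power)
    then have "of_int 2 \<in> P" using r2_power_q q_gt_1 by (simp flip: power_Suc2)
    then have "int p dvd 2" using I.of_int_in_P_iff[OF p(1) P(2)] by blast
    then have "p dvd 2" by (metis int_dvd_int_iff of_nat_numeral)
    then have "p \<le> 2" by (rule dvd_imp_le) simp
    then have "p = 2" using prime_gt_1_nat[OF p(1)] by linarith
    then show False using p(2) by simp
  qed
  have "r2 * (\<zeta> ^ bN \<sigma> - 2 ^ m) = \<sigma> r2 - r2 ^ p"
  proof -
    have "r2 ^ p = r2 * 2 ^ m" unfolding pm by (simp only: power_Suc power_mult r2_power_q)
    then show ?thesis using Gal_r2[OF frobenius_in_Gal] by (simp add: algebra_simps)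
  qed
  then have "r2 * (\<zeta> ^ bN \<sigma> - 2 ^ m) \<in> P" using cong[OF OL(2)] by simp
  moreover have "\<zeta> ^ bN \<sigma> - 2 ^ m \<in> I.OL"
    using I.OL_closed(1)[OF I.OL_power[OF OL(1)] I.OL_closed(3)[of "- (2 ^ m)"]] by simp
  ultimately have key: "\<zeta> ^ bN \<sigma> - 2 ^ m \<in> P" using I.P_prime[OF OL(2)] \<open>r2 \<notin> P\<close> by blast
  have two: "2 ^ m - 1 \<in> P \<longleftrightarrow> [2 ^ m = 1] (mod int p)"
    using I.of_int_in_P_iff[OF p(1) P(2), of "2 ^ m - 1"] by (simp add: cong_iff_dvd_diff)
  show "[int (bN \<sigma>) = 0] (mod int q) \<longleftrightarrow> [2 ^ ((p - 1) div q) = 1] (mod int p)"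
    unfolding m' two[symmetric]
  proof
    assume "[int (bN \<sigma>) = 0] (mod int q)"
    then have "\<zeta> ^ bN \<sigma> = 1" using zeta_power_eq_iff[of "bN \<sigma>" 0] by simp
    then show "2 ^ m - 1 \<in> P" using I.P_uminus[OF key] by simp
  next
    assume "2 ^ m - 1 \<in> P"
    then show "[int (bN \<sigma>) = 0] (mod int q)" using I.P_closed(1)[OF key] by (intro zeta1) fastforce
  qed
qed

end

text \<open>An odd number prime to \<open>q\<close> is a product of odd primes different from
  \<open>q\<close>, and the product of their Frobenius elements has that number as its linear
  part.\<close>

lemma aN_surj:
  assumes frob: "\<And>p. Factorial_Ring.prime p \<Longrightarrow> odd p \<Longrightarrow> p \<noteq> q \<Longrightarrow> is_frobenius L p (s p)"
    and u: "\<not> int q dvd u"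
  shows "\<exists>\<sigma>\<in>carrier Gal. [int (aN \<sigma>) = u] (mod int q)"
proof -
  interpret group Gal by (rule group_Gal)
  have odd_case: "\<exists>\<sigma>\<in>carrier Gal. [int (aN \<sigma>) = int n] (mod int q)" if "odd n" "\<not> q dvd n" for n
    using that
  proof (induction n rule: less_induct)
    case (less n)
    show ?case
    proof (cases "n = 1")
      case True
      have "\<zeta> ^ aN \<one>\<^bsub>Gal\<^esub> = \<one>\<^bsub>Gal\<^esub> \<zeta>" by (simp add: Gal_zeta)
      also have "\<dots> = \<zeta> ^ 1" by (simp add: G_group_def gal_Q_def BijGroup_def L_closed)
      finally show ?thesis using True zeta_power_eq_iff[of "aN \<one>\<^bsub>Gal\<^esub>" 1] by (intro bexI[of _ "\<one>\<^bsub>Gal\<^esub>"]) auto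
    next
      case False
      then obtain p where p: "Factorial_Ring.prime p" "p dvd n" using prime_factor_nat by blast
      then obtain m where m: "n = p * m" by blast
      have pq: "odd p" "p \<noteq> q" using less.prems m p by auto
      have "n > 0" using less.prems by (auto intro: gr0I)
      then have "m < n" using m prime_gt_1_nat[OF p(1)] by simp
      then obtain \<tau> where \<tau>: "\<tau> \<in> carrier Gal" "[int (aN \<tau>) = int m] (mod int q)"
        using less.IH[of m] less.prems m dvd_mult[of q m p] by auto
      note sp = frobenius_in_Gal[OF p(1) pq frob[OF p(1) pq]] aN_frobenius[OF p(1) pq frob[OF p(1) pq]]
      have "[int (aN (s p \<otimes>\<^bsub>Gal\<^esub> \<tau>)) = int p * int m] (mod int q)"
        using cong_trans[OF aN_mult[OF sp(1) \<tau>(1)] cong_mult[OF sp(2) \<tau>(2)]] .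
      then show ?thesis using m sp(1) \<tau>(1) by (intro bexI[of _ "s p \<otimes>\<^bsub>Gal\<^esub> \<tau>"]) auto
    qed
  qed
  define n where "n = nat (u mod int q)"
  have n: "[int n = u] (mod int q)" using q_gt_1 by (simp add: n_def Cong.cong_def)
  have "\<not> int q dvd int n" using n u by (metis cong_dvd_iff cong_0_iff cong_sym cong_trans)
  then have nq: "\<not> q dvd n" by simp
  show ?thesis
  proof (cases "odd n")
    case True
    then show ?thesis using odd_case[OF True nq] n by (meson cong_trans)
  next
    case False
    \<comment> \<open>An even representative becomes odd on adding the odd number
      \<open>q\<close>.\<close>
    have "[int (n + q) = int n] (mod int q)" by (simp add: Cong.cong_def)
    then show ?thesis using odd_case[of "n + q"] False odd_q nq n by (auto intro: cong_trans)
  qed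
qed

end

section \<open>Character sums over Frobenius elements\<close>

text \<open>The last clause converts congruence modulo \<open>q\<close> into congruence of
  logarithms modulo \<open>q - 1\<close>, so that Parseval on Z/(q - 1) counts pairs of primes
  congruent modulo \<open>q\<close>.\<close>

lemma primitive_root_index:
  assumes "Factorial_Ring.prime (q::nat)"
  obtains g0 :: int and ind :: "int \<Rightarrow> nat" where
    "\<And>u. \<not> int q dvd u \<Longrightarrow> [u = g0 ^ ind u] (mod int q)"
    "[g0 ^ (q - 1) = 1] (mod int q)"
    "\<And>i j. [g0 ^ i = g0 ^ j] (mod int q) \<longleftrightarrow> int (q - 1) dvd int i - int j"
proof -
  have q1: "q > 1" using assms prime_gt_1_nat by blast
  obtain g where g: "residue_primroot q g" using prime_primitive_root_exists[OF q1 assms] by blast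
  have cop: "coprime q g" and ord: "Pocklington.ord q g = q - 1"
    using g assms by (auto simp: residue_primroot_def totient_prime)
  have pow_iff: "[int g ^ i = int g ^ j] (mod int q) \<longleftrightarrow> int (q - 1) dvd int i - int j" for i j
  proof -
    have "[int g ^ i = int g ^ j] (mod int q) \<longleftrightarrow> [g ^ i = g ^ j] (mod q)"
      by (simp flip: cong_int_iff)
    also have "\<dots> \<longleftrightarrow> [i = j] (mod (q - 1))"
      using order_divides_expdiff[OF cop, of i j] by (simp add: ord)
    also have "\<dots> \<longleftrightarrow> int (q - 1) dvd int i - int j"
      by (simp only: cong_iff_dvd_diff flip: cong_int_iff)
    finally show ?thesis .
  qed
  have ex: "\<exists>i. [u = int g ^ i] (mod int q)" if "\<not> int q dvd u" for u
  proof -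
    let ?n = "nat (u mod int q)"
    have n: "int ?n = u mod int q" using q1 by simp
    have "coprime ?n q"
    proof -
      have "\<not> int q dvd int ?n" unfolding n using that by (simp add: dvd_mod_iff)
      then have "\<not> q dvd ?n" by (metis int_dvd_int_iff)
      then have "coprime q ?n" by (rule prime_imp_coprime[OF assms])
      then show ?thesis by (metis coprime_commute)
    qed
    moreover have "?n > 0"
    proof -
      have "u mod int q \<ge> 0" "u mod int q \<noteq> 0" using that q1 by (auto simp: dvd_eq_mod_eq_0)
      then show ?thesis by linarith
    qed
    moreover have "?n < q" using q1 by (simp add: nat_less_iff)
    ultimately have "?n \<in> totatives q" by (simp add: totatives_def)
    then obtain i where "?n = g ^ i mod q"
      using residue_primroot_is_generator[OF q1 g] by (auto simp: bij_betw_def)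
    then have "u mod int q = int g ^ i mod int q" using n by (metis of_nat_mod of_nat_power)
    then show ?thesis by (auto simp: Cong.cong_def)
  qed
  show thesis
  proof (rule that)
    show "[u = int g ^ (SOME i. [u = int g ^ i] (mod int q))] (mod int q)" if "\<not> int q dvd u" for u
      by (rule someI_ex) (rule ex[OF that])
    show "[int g ^ (q - 1) = 1] (mod int q)" using pow_iff[of "q - 1" 0] by simp
  qed (rule pow_iff)
qed

lemma character_of_eq_tr:
  assumes "irreducible_rep G n \<rho>" "group G"
  shows "character_of G n \<rho> = restrict (irrep.tr n \<rho>) (carrier G)"
proof -
  interpret irrep G n \<rho> using assms by (simp add: irrep_def irrep_axioms_def)
  show ?thesis by (simp add: character_of_def tr_def[abs_def])
qed

context kummer
begin

abbreviation (input) additive_sums :: "nat set \<Rightarrow> real" where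
  "additive_sums P \<equiv> (\<Sum>d=1..q - 1. (cmod (\<Sum>p\<in>P. e_unit (real p * real d / real q)))\<^sup>2)"

lemma q_ge_3: "q \<ge> 3"
  using q_gt_1 odd_q by (cases "q = 2") auto

lemma additive_sums_eq:
  assumes "finite P"
  shows "additive_sums P = real q * (\<Sum>p\<in>P. \<Sum>r\<in>P. of_bool (int q dvd int p - int r)) - (real (card P))\<^sup>2"
proof -
  have "(\<Sum>d<q. (cmod (\<Sum>p\<in>P. e_unit (real d * of_int (int p) / real q)))\<^sup>2)
    = real q * (\<Sum>p\<in>P. \<Sum>r\<in>P. of_bool (int q dvd int p - int r))"
    using q_gt_1 by (intro sum_exponential_parseval) simp
  moreover have "{..<q} = insert 0 {1..q - 1}" using q_gt_1 by auto
  ultimately show ?thesis by (simp add: mult.commute)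
qed

text \<open>Let \<open>C\<close> count the pairs congruent modulo \<open>q\<close>, and let
  \<open>P' = P - {q}\<close>. By Parseval the sides are \<open>(q - 1) C(P') - |P'|^2\<close> and
  \<open>q C(P) - |P|^2\<close>. If \<open>q\<close> lies in \<open>P\<close>, it contributes only
  the pair \<open>(q, q)\<close> to \<open>C(P)\<close>, and the difference of the sides is
  \<open>C(P') + (q - 1) - 2 |P'|\<close>.\<close>

lemma character_sums_le_additive_sums:
  fixes ind :: "nat \<Rightarrow> int"
  assumes P: "finite P" "\<And>p. p \<in> P \<Longrightarrow> Factorial_Ring.prime p"
    and ind: "\<And>p r. p \<in> P - {q} \<Longrightarrow> r \<in> P - {q} \<Longrightarrow> int (q - 1) dvd ind p - ind r \<longleftrightarrow> int q dvd int p - int r"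
  shows "(\<Sum>j=1..<q - 1. (cmod (\<Sum>p\<in>P - {q}. e_unit (real j * of_int (ind p) / real (q - 1))))\<^sup>2)
    \<le> additive_sums P"
proof -
  let ?P = "P - {q}"
  define m where "m = q - 1"
  have m: "m > 0" "q = m + 1" using q_gt_1 by (simp_all add: m_def)
  define C where "C S = (\<Sum>p\<in>S. \<Sum>r\<in>S. of_bool (int q dvd int p - int r) :: real)" for S
  define X where "X = (\<Sum>j=1..<m. (cmod (\<Sum>p\<in>?P. e_unit (real j * of_int (ind p) / real m)))\<^sup>2)"
  have "(\<Sum>j<m. (cmod (\<Sum>p\<in>?P. e_unit (real j * of_int (ind p) / real m)))\<^sup>2)
    = real m * (\<Sum>p\<in>?P. \<Sum>r\<in>?P. of_bool (int m dvd ind p - ind r))"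
    using m by (intro sum_exponential_parseval)
  also have "(\<Sum>p\<in>?P. \<Sum>r\<in>?P. of_bool (int m dvd ind p - ind r)) = C ?P"
    unfolding C_def m_def by (intro sum.cong refl) (simp only: ind)
  finally have all: "(\<Sum>j<m. (cmod (\<Sum>p\<in>?P. e_unit (real j * of_int (ind p) / real m)))\<^sup>2) = real m * C ?P" .
  have "{..<m} = insert 0 {1..<m}" using m by auto
  then have X: "X = real m * C ?P - (real (card ?P))\<^sup>2" using all by (simp add: X_def)
  have "X \<ge> 0" unfolding X_def by (intro sum_nonneg) auto
  have "C ?P \<ge> 0" unfolding C_def by (intro sum_nonneg) auto
  have LS: "additive_sums P = real q * C P - (real (card P))\<^sup>2"
    unfolding C_def by (rule additive_sums_eq[OF P(1)])
  have "X \<le> real q * C P - (real (card P))\<^sup>2"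
  proof (cases "q \<in> P")
    case False
    then have "?P = P" by auto
    then show ?thesis using X \<open>C ?P \<ge> 0\<close> by (simp add: m(2) algebra_simps)
  next
    case True
    have ne: "\<not> int q dvd int q - int r" "\<not> int q dvd int r - int q" if "r \<in> ?P" for r
    proof -
      have "\<not> q dvd r" using that P(2)[of r] prime_q primes_dvd_imp_eq by auto
      then have "\<not> int q dvd int r" by simp
      then show "\<not> int q dvd int q - int r" "\<not> int q dvd int r - int q"
        using dvd_diff[of "int q" "int q" "int q - int r"] dvd_add[of "int q" "int r - int q" "int q"]
        by auto
    qed
    let ?g = "\<lambda>p r. of_bool (int q dvd int p - int r) :: real"
    have "C P = (\<Sum>r\<in>P. ?g q r) + (\<Sum>p\<in>?P. \<Sum>r\<in>P. ?g p r)"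
      unfolding C_def by (rule sum.remove[OF P(1) True])
    also have "(\<Sum>r\<in>P. ?g q r) = ?g q q + (\<Sum>r\<in>?P. ?g q r)"
      by (rule sum.remove[OF P(1) True])
    also have "(\<Sum>r\<in>?P. ?g q r) = 0" using ne(1) by (intro sum.neutral ballI) simp
    also have "(\<Sum>p\<in>?P. \<Sum>r\<in>P. ?g p r) = C ?P"
      unfolding C_def
    proof (rule sum.cong[OF refl])
      fix p assume p: "p \<in> ?P"
      have "(\<Sum>r\<in>P. ?g p r) = ?g p q + (\<Sum>r\<in>?P. ?g p r)" by (rule sum.remove[OF P(1) True])
      then show "(\<Sum>r\<in>P. ?g p r) = (\<Sum>r\<in>?P. ?g p r)" using ne(2)[OF p] by simp
    qed
    finally have "C P = C ?P + 1" by simp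
    moreover have "card P = card ?P + 1" using card.remove[OF P(1) True] by linarith
    \<comment> \<open>Multiplied by \<open>m\<close>, this quantity is
      \<open>X + (|P'| - m)^2\<close>, and \<open>X\<close> is itself a sum of squares.\<close>
    moreover have "0 \<le> C ?P + real m - 2 * real (card ?P)"
    proof -
      have "0 \<le> (real (card ?P) - real m)\<^sup>2" by simp
      also have "\<dots> \<le> X + (real (card ?P) - real m)\<^sup>2" using \<open>X \<ge> 0\<close> by simp
      also have "\<dots> = real m * (C ?P + real m - 2 * real (card ?P))"
        unfolding X by (simp add: power2_eq_square algebra_simps)
      finally show ?thesis using m(1) by (simp add: zero_le_mult_iff)
    qed
    ultimately show ?thesis using X by (simp add: m(2) power2_eq_square algebra_simps)
  qed
  then show ?thesis unfolding LS[symmetric] by (simp add: X_def m_def)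
qed

section \<open>The sum of the nonlinear character\<close>

lemma sum_e_unit_dvd:
  assumes "finite P"
  shows "(\<Sum>p\<in>P. \<Sum>d<q. e_unit (real d * of_int (k p) / real q)) = of_nat q * of_nat (card {p\<in>P. int q dvd k p})"
proof -
  have "(\<Sum>p\<in>P. \<Sum>d<q. e_unit (real d * of_int (k p) / real q)) = (\<Sum>p\<in>P. if int q dvd k p then of_nat q else 0)"
    using q_gt_1 by (intro sum.cong refl sum_e_unit_orthogonality) auto
  also have "\<dots> = (\<Sum>p\<in>{p\<in>P. int q dvd k p}. of_nat q)"
    by (rule sum.inter_filter[OF assms, symmetric])
  finally show ?thesis by (simp add: mult.commute)
qed

lemma nonlinear_character_sum_le:
  fixes i :: "nat \<Rightarrow> nat"
  assumes P: "finite P" "\<And>p. p \<in> P \<Longrightarrow> p > 0"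
    and i: "\<And>p. p \<in> P \<Longrightarrow> q dvd i p \<Longrightarrow> q dvd p - 1"
  defines "A \<equiv> real (card {p\<in>P. q dvd i p})" and "B \<equiv> real (card {p\<in>P. q dvd p - 1})"
  defines "T \<equiv> (\<Sum>c=1..q - 1. \<Sum>d=1..q - 1.
    (cmod (\<Sum>p\<in>P. e_unit ((real p * real d - real (i p) * real c) / real q)))\<^sup>2)"
  shows "(real q * A - B)\<^sup>2 \<le> 3 * (additive_sums P + 4 * T + (real (card P) / real q)\<^sup>2)"
proof -
  define S where "S c d = (\<Sum>p\<in>P. e_unit ((real p * real d - real (i p) * real c) / real q))" for c d
  \<comment> \<open>The twist replaces \<open>p\<close> by \<open>p - 1\<close>, so that summing
    over \<open>d\<close> detects \<open>p = 1\<close> modulo \<open>q\<close>. It has absolute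
    value 1 and drops out of the square norms.\<close>
  define f where "f c d = e_unit (- real d / real q) * S c d" for c d :: nat
  have f: "f c d = (\<Sum>p\<in>P. e_unit (real d * of_int (int p - 1) / real q) * e_unit (real c * of_int (- int (i p)) / real q))" for c d
    unfolding f_def S_def sum_distrib_left e_unit_add[symmetric]
    by (intro sum.cong refl arg_cong[where f = e_unit]) (simp add: diff_divide_distrib right_diff_distrib mult.commute)
  have dvd_p: "int q dvd int p - 1 \<longleftrightarrow> q dvd p - 1" if "p \<in> P" for p
    using P(2)[OF that] by (metis One_nat_def Suc_leI int_dvd_int_iff int_ops(2) of_nat_diff)
  have A: "A = real (card {p\<in>P. int q dvd - int (i p)})" by (simp add: A_def)
  have B: "B = real (card {p\<in>P. int q dvd int p - 1})"
    unfolding B_def using dvd_p by (intro arg_cong[where f = real] arg_cong[where f = card]) auto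
  have sum0: "(\<Sum>c<q. f c 0) = of_real (real q * A)"
    using sum_e_unit_dvd[OF P(1), of "\<lambda>p. - int (i p)"]
    unfolding f A by (subst sum.swap) simp
  have sum1: "(\<Sum>d<q. f 0 d) = of_real (real q * B)"
    using sum_e_unit_dvd[OF P(1), of "\<lambda>p. int p - 1"]
    unfolding f B by (subst sum.swap) simp
  have sum2: "(\<Sum>c<q. \<Sum>d<q. f c d) = of_real ((real q)\<^sup>2 * A)"
  proof -
    have "(\<Sum>c<q. \<Sum>d<q. f c d) = (\<Sum>p\<in>P. \<Sum>c<q. \<Sum>d<q. e_unit (real d * of_int (int p - 1) / real q) * e_unit (real c * of_int (- int (i p)) / real q))"
      (is "_ = (\<Sum>p\<in>P. \<Sum>c<q. \<Sum>d<q. ?g c d p)")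
    proof -
      have "(\<Sum>c<q. \<Sum>d<q. \<Sum>p\<in>P. ?g c d p) = (\<Sum>c<q. \<Sum>p\<in>P. \<Sum>d<q. ?g c d p)"
        by (intro sum.cong refl sum.swap)
      also have "\<dots> = (\<Sum>p\<in>P. \<Sum>c<q. \<Sum>d<q. ?g c d p)" by (rule sum.swap)
      finally show ?thesis unfolding f .
    qed
    also have "\<dots> = (\<Sum>p\<in>P. (\<Sum>c<q. e_unit (real c * of_int (- int (i p)) / real q)) * (\<Sum>d<q. e_unit (real d * of_int (int p - 1) / real q)))"
      by (simp add: sum_product mult.commute)
    \<comment> \<open>Whenever the sum over \<open>c\<close> does not vanish, \<open>q\<close>
      divides \<open>i p\<close>, hence \<open>p - 1\<close>, and the sum over \<open>d\<close> has
      its full value \<open>q\<close>. This collapses the two conditions into one.\<close>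
    also have "\<dots> = (\<Sum>p\<in>P. of_nat q * (\<Sum>c<q. e_unit (real c * of_int (- int (i p)) / real q)))"
    proof (intro sum.cong refl)
      fix p assume p: "p \<in> P"
      have "int q dvd - int (i p) \<Longrightarrow> int q dvd int p - 1" using i[OF p] dvd_p[OF p] by simp
      then show "(\<Sum>c<q. e_unit (real c * of_int (- int (i p)) / real q)) * (\<Sum>d<q. e_unit (real d * of_int (int p - 1) / real q))
         = of_nat q * (\<Sum>c<q. e_unit (real c * of_int (- int (i p)) / real q))"
        using q_gt_1 by (subst (1 2 3) sum_e_unit_orthogonality) auto
    qed
    also have "\<dots> = of_nat q * (of_nat q * of_nat (card {p\<in>P. int q dvd - int (i p)}))"
      unfolding sum_distrib_left[symmetric] sum_e_unit_dvd[OF P(1)] ..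
    also have "\<dots> = of_real ((real q)\<^sup>2 * A)" unfolding A by (simp add: power2_eq_square)
    finally show ?thesis .
  qed
  have f00: "f 0 0 = of_nat (card P)" by (simp add: f)
  have split: "{..<q} = insert 0 {1..q - 1}" using q_gt_1 by auto
  \<comment> \<open>After division by \<open>q\<close>, \<open>E\<close> is what inclusion-exclusion
    leaves of the total \<open>q^2 A\<close> when the row \<open>c = 0\<close> with sum
    \<open>q B\<close> and the column \<open>d = 0\<close> with sum \<open>q A\<close> are removed;
    the corner \<open>|P|\<close> is put back once. \<open>D\<close> is the row without its
    corner.\<close>
  define E where "E = (real q - 1) * A - B + real (card P) / real q"
  define D where "D = B - real (card P) / real q"
  have qD: "(\<Sum>d=1..q - 1. f 0 d) = of_real (real q * D)"
    using sum1 f00 q_gt_1 unfolding split D_def by (simp add: algebra_simps)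
  have qE: "(\<Sum>c=1..q - 1. \<Sum>d=1..q - 1. f c d) = of_real (real q * E)"
  proof -
    have "(\<Sum>c<q. \<Sum>d<q. f c d) = (\<Sum>d<q. f 0 d) + (\<Sum>c=1..q - 1. \<Sum>d<q. f c d)"
      by (simp add: split)
    also have "(\<Sum>c=1..q - 1. \<Sum>d<q. f c d) = (\<Sum>c=1..q - 1. f c 0) + (\<Sum>c=1..q - 1. \<Sum>d=1..q - 1. f c d)"
      by (simp add: split sum.distrib)
    also have "(\<Sum>c=1..q - 1. f c 0) = (\<Sum>c<q. f c 0) - f 0 0" by (simp add: split)
    finally have "(\<Sum>c=1..q - 1. \<Sum>d=1..q - 1. f c d)
        = of_real ((real q)\<^sup>2 * A) - of_real (real q * B) - (of_real (real q * A) - of_nat (card P))"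
      unfolding sum0 sum1 sum2 f00 by simp
    also have "\<dots> = of_real ((real q)\<^sup>2 * A - real q * B - (real q * A - real (card P)))" by simp
    also have "(real q)\<^sup>2 * A - real q * B - (real q * A - real (card P)) = real q * E"
      using q_gt_1 by (simp add: E_def field_simps power2_eq_square)
    finally show ?thesis .
  qed
  have "(real q * D)\<^sup>2 \<le> real q * additive_sums P"
  proof -
    have "(real q * D)\<^sup>2 = (cmod (\<Sum>d=1..q - 1. e_unit (- real d / real q) * S 0 d))\<^sup>2"
      using qD by (simp only: f_def norm_of_real power2_abs)
    also have "\<dots> \<le> (\<Sum>d=1..q - 1. (cmod (e_unit (- real d / real q)))\<^sup>2) * (\<Sum>d=1..q - 1. (cmod (S 0 d))\<^sup>2)"
      by (rule sum_cauchy_schwarz_complex)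
    also have "\<dots> \<le> real q * (\<Sum>d=1..q - 1. (cmod (S 0 d))\<^sup>2)"
      by (intro mult_right_mono sum_nonneg) auto
    finally show ?thesis by (simp add: S_def)
  qed
  also have "\<dots> \<le> (real q)\<^sup>2 * additive_sums P"
    using q_gt_1 by (intro mult_right_mono sum_nonneg) (auto simp: power2_eq_square)
  finally have D: "D\<^sup>2 \<le> additive_sums P" using q_gt_1 by (simp add: power_mult_distrib)
  \<comment> \<open>There are \<open>(q - 1)^2\<close> pairs of frequencies, so the loss in
    Cauchy-Schwarz is matched by the factor \<open>q^2\<close> on the left.\<close>
  have "(real q * E)\<^sup>2 \<le> (real q)\<^sup>2 * T"
  proof -
    let ?R = "{1..q - 1} \<times> {1..q - 1}"
    have "(real q * E)\<^sup>2 = (cmod (\<Sum>(c, d)\<in>?R. e_unit (- real d / real q) * S c d))\<^sup>2"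
      using qE by (simp only: f_def norm_of_real power2_abs sum.cartesian_product)
    also have "\<dots> \<le> (\<Sum>(c, d)\<in>?R. (cmod (e_unit (- real d / real q)))\<^sup>2) * (\<Sum>(c, d)\<in>?R. (cmod (S c d))\<^sup>2)"
      using sum_cauchy_schwarz_complex[of "\<lambda>(c, d). e_unit (- real d / real q)" "\<lambda>(c, d). S c d" ?R]
      by (simp add: case_prod_unfold)
    also have "\<dots> \<le> (real q)\<^sup>2 * (\<Sum>(c, d)\<in>?R. (cmod (S c d))\<^sup>2)"
    proof (intro mult_right_mono sum_nonneg)
      have "(\<Sum>(c, d)\<in>?R. (cmod (e_unit (- real d / real q)))\<^sup>2) = real (q - 1) * real (q - 1)"
        by (simp add: case_prod_unfold)
      also have "\<dots> \<le> real q * real q" by (intro mult_mono) auto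
      finally show "(\<Sum>(c, d)\<in>?R. (cmod (e_unit (- real d / real q)))\<^sup>2) \<le> (real q)\<^sup>2"
        by (simp add: power2_eq_square)
    qed auto
    finally show ?thesis by (simp add: T_def S_def sum.cartesian_product)
  qed
  then have E: "E\<^sup>2 \<le> T" using q_gt_1 by (simp add: power_mult_distrib)
  have "A \<ge> 0" by (simp add: A_def)
  \<comment> \<open>With \<open>q A - B = A + E - |P|/q\<close>, bounding the single remaining
    \<open>A\<close> by \<open>|D| + |E|\<close> produces the coefficient 2 of \<open>|E|\<close>;
    its square becomes the 4 in front of \<open>T\<close>.\<close>
  have "A \<le> (real q - 1) * A"
    using mult_right_mono[of 1 "real q - 1" A] q_ge_3 \<open>A \<ge> 0\<close> by simp
  also have "\<dots> = D + E" by (simp add: D_def E_def)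
  finally have "A \<le> \<bar>D\<bar> + \<bar>E\<bar>" by linarith
  moreover have "real q * A - B = A + E - real (card P) / real q" by (simp add: E_def algebra_simps)
  ultimately have "\<bar>real q * A - B\<bar> \<le> \<bar>D\<bar> + 2 * \<bar>E\<bar> + real (card P) / real q"
    using \<open>A \<ge> 0\<close> divide_nonneg_nonneg[of "real (card P)" "real q"] by linarith
  then have "(real q * A - B)\<^sup>2 \<le> (\<bar>D\<bar> + 2 * \<bar>E\<bar> + real (card P) / real q)\<^sup>2"
    by (metis abs_ge_zero power2_abs power_mono)
  also have "\<dots> \<le> 3 * (D\<^sup>2 + 4 * E\<^sup>2 + (real (card P) / real q)\<^sup>2)"
  proof -
    have "(x + 2 * y + z)\<^sup>2 \<le> 3 * (x\<^sup>2 + 4 * y\<^sup>2 + z\<^sup>2)" for x y z :: real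
      using zero_le_power2[of "x - 2 * y"] zero_le_power2[of "x - z"] zero_le_power2[of "2 * y - z"]
      by (simp add: power2_eq_square algebra_simps)
    from this[of "\<bar>D\<bar>" "\<bar>E\<bar>" "real (card P) / real q"] show ?thesis by simp
  qed
  also have "\<dots> \<le> 3 * (additive_sums P + 4 * T + (real (card P) / real q)\<^sup>2)"
    using D E by simp
  finally show ?thesis .
qed

text \<open>All terms are nonnegative, so it suffices that each nontrivial irreducible character is
  either \<open>\<phi>q\<close> or one of the \<open>\<psi> j\<close> with
  \<open>1 <= j < q - 1\<close>. The latter are Dirichlet characters written through a discrete
  logarithm.\<close>

lemma frobenius_character_sums_le:
  assumes frob: "\<And>p. Factorial_Ring.prime p \<Longrightarrow> odd p \<Longrightarrow> p \<noteq> q \<Longrightarrow> is_frobenius L p (s p)"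
    and P: "finite P" "\<And>p. p \<in> P \<Longrightarrow> Factorial_Ring.prime p \<and> odd p"
  shows "(\<Sum>\<phi>\<in>irr_chars Gal - {trivial_char Gal}. (cmod (\<Sum>p\<in>P. if p = q then 0 else \<phi> (s p)))\<^sup>2)
    \<le> additive_sums P
      + (real q * real (card {p\<in>P. q dvd index_of_two p}) - real (card {p\<in>P. q dvd p - 1}))\<^sup>2"
proof -
  interpret group Gal by (rule group_Gal)
  interpret affine_subgroup Gal q "\<lambda>\<sigma>. int (aN \<sigma>)" "\<lambda>\<sigma>. int (bN \<sigma>)"
    by unfold_locales (use prime_q aN_mult bN_mult Gal_eqI aN_surj[OF frob] in auto)
  obtain g0 ind where ind: "\<And>u. \<not> int q dvd u \<Longrightarrow> [u = g0 ^ ind u] (mod int q)"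
    and g0: "[g0 ^ (q - 1) = 1] (mod int q)"
    and pow_iff: "\<And>i j. [g0 ^ i = g0 ^ j] (mod int q) \<longleftrightarrow> int (q - 1) dvd int i - int j"
    using primitive_root_index[OF prime_q] by blast
  define k where "k \<sigma> = ind (int (aN \<sigma>))" for \<sigma>
  define \<psi> where "\<psi> j = (\<lambda>\<sigma>\<in>carrier Gal. e_unit (real j * real (k \<sigma>) / real (q - 1)))" for j :: nat
  define \<phi>q where "\<phi>q = (\<lambda>\<sigma>\<in>carrier Gal. if \<not> [int (aN \<sigma>) = 1] (mod int q) then 0
    else if [int (bN \<sigma>) = 0] (mod int q) then of_nat (q - 1) else - 1 :: complex)"
  have k: "[int (aN \<sigma>) = g0 ^ k \<sigma>] (mod int q)" if "\<sigma> \<in> carrier Gal" for \<sigma>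
    unfolding k_def using a_nz[OF that] by (rule ind)
  have "irr_chars Gal - {trivial_char Gal} \<subseteq> insert \<phi>q (\<psi> ` {1..<q - 1})"
  proof
    fix \<phi> assume \<phi>: "\<phi> \<in> irr_chars Gal - {trivial_char Gal}"
    then obtain n \<rho> where irr: "irreducible_rep Gal n \<rho>" and eq: "\<phi> = character_of Gal n \<rho>"
      by (auto simp: irr_chars_def)
    interpret affine_irrep Gal q "\<lambda>\<sigma>. int (aN \<sigma>)" "\<lambda>\<sigma>. int (bN \<sigma>)" n \<rho>
      by unfold_locales (rule irr)
    have \<phi>_eq: "\<phi> = restrict tr (carrier Gal)"
      unfolding eq by (rule character_of_eq_tr[OF irr group_Gal])
    have prim: "\<exists>i. [u = g0 ^ i] (mod int q)" if "\<not> int q dvd u" for u using ind[OF that] by blast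
    show "\<phi> \<in> insert \<phi>q (\<psi> ` {1..<q - 1})"
    proof (rule character_cases[OF _ g0])
      show "\<exists>i. [u = g0 ^ i] (mod int q)" if "\<not> int q dvd u" for u by (rule prim[OF that])
    next
      fix \<omega> assume linear: "\<omega> ^ (q - 1) = 1"
        "\<And>g i. g \<in> carrier Gal \<Longrightarrow> [int (aN g) = g0 ^ i] (mod int q) \<Longrightarrow> tr g = \<omega> ^ i"
      obtain j where j: "j < q - 1" "\<omega> = cis (2 * pi * real j / real (q - 1))"
      proof -
        have "\<omega> \<in> (\<lambda>k. cis (2 * pi * real k / real (q - 1))) ` {..<q - 1}"
          using bij_betw_imp_surj_on[OF Complex.bij_betw_roots_unity[of "q - 1"]] q_ge_3 linear(1) by simp
        then show thesis using that by auto
      qed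
      have "\<omega> ^ i = e_unit (real j * real i / real (q - 1))" for i
        unfolding j(2) using e_unit_power[of "real j / real (q - 1)" i] by (simp add: e_unit_cis mult.commute)
      then have \<phi>j: "\<phi> = \<psi> j"
        unfolding \<phi>_eq \<psi>_def using linear(2)[OF _ k] by (intro restrict_ext) simp
      have "j \<noteq> 0"
      proof
        assume "j = 0"
        then have "\<phi> = trivial_char Gal" unfolding \<phi>j \<psi>_def trivial_char_def by simp
        then show False using \<phi> by simp
      qed
      then show ?thesis using \<phi>j j by auto
    next
      assume "\<And>g. g \<in> carrier Gal \<Longrightarrow> tr g =
        (if \<not> [int (aN g) = 1] (mod int q) then 0
         else if [int (bN g) = 0] (mod int q) then of_nat (q - 1) else - 1)"
      then have "\<phi> = \<phi>q" unfolding \<phi>_eq \<phi>q_def by (intro restrict_ext) simp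
      then show ?thesis by simp
    qed
  qed
  moreover have "finite (insert \<phi>q (\<psi> ` {1..<q - 1}))" by simp
  moreover define F where "F \<phi> = (cmod (\<Sum>p\<in>P. if p = q then 0 else \<phi> (s p)))\<^sup>2" for \<phi>
  ultimately have "(\<Sum>\<phi>\<in>irr_chars Gal - {trivial_char Gal}. F \<phi>) \<le> (\<Sum>\<phi>\<in>insert \<phi>q (\<psi> ` {1..<q - 1}). F \<phi>)"
    by (intro sum_mono2) (auto simp: F_def)
  also have "\<dots> \<le> (\<Sum>\<phi>\<in>\<psi> ` {1..<q - 1}. F \<phi>) + F \<phi>q"
    by (subst sum.insert_if) (auto simp: F_def)
  \<comment> \<open>Passing from the image to the indices can only repeat nonnegative terms, so
    coincidences among the \<open>\<psi> j\<close> do no harm.\<close>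
  also have "(\<Sum>\<phi>\<in>\<psi> ` {1..<q - 1}. F \<phi>) \<le> (\<Sum>j=1..<q - 1. F (\<psi> j))"
    using sum_image_le[of "{1..<q - 1}" F \<psi>] by (simp add: F_def comp_def)
  also have "(\<Sum>j=1..<q - 1. F (\<psi> j)) \<le> additive_sums P"
  proof -
    have s: "s p \<in> carrier Gal" "[g0 ^ k (s p) = int p] (mod int q)" if "p \<in> P - {q}" for p
    proof -
      note fr = frob[of p]
      show "s p \<in> carrier Gal" using frobenius_in_Gal that P(2) fr by blast
      then show "[g0 ^ k (s p) = int p] (mod int q)"
        using k aN_frobenius[of p "s p"] that P(2) fr by (blast intro: cong_trans cong_sym)
    qed
    have "F (\<psi> j) = (cmod (\<Sum>p\<in>P - {q}. e_unit (real j * of_int (int (k (s p))) / real (q - 1))))\<^sup>2" for j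
    proof -
      have "(\<Sum>p\<in>P. if p = q then 0 else \<psi> j (s p)) = (\<Sum>p\<in>P - {q}. \<psi> j (s p))"
        using P(1) by (intro sum.mono_neutral_cong_right) auto
      also have "\<dots> = (\<Sum>p\<in>P - {q}. e_unit (real j * of_int (int (k (s p))) / real (q - 1)))"
        using s(1) by (intro sum.cong refl) (simp add: \<psi>_def)
      finally show ?thesis by (simp only: F_def)
    qed
    moreover have "(\<Sum>j=1..<q - 1. (cmod (\<Sum>p\<in>P - {q}. e_unit (real j * of_int (int (k (s p))) / real (q - 1))))\<^sup>2)
      \<le> additive_sums P"
    proof (rule character_sums_le_additive_sums)
      fix p r assume pr: "p \<in> P - {q}" "r \<in> P - {q}"
      have "int (q - 1) dvd int (k (s p)) - int (k (s r)) \<longleftrightarrow> [g0 ^ k (s p) = g0 ^ k (s r)] (mod int q)"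
        by (rule pow_iff[symmetric])
      also have "\<dots> \<longleftrightarrow> [int p = int r] (mod int q)"
        using s(2)[OF pr(1)] s(2)[OF pr(2)] by (meson cong_sym cong_trans)
      finally show "int (q - 1) dvd int (k (s p)) - int (k (s r)) \<longleftrightarrow> int q dvd int p - int r"
        by (simp add: cong_iff_dvd_diff)
    qed (use P in auto)
    ultimately show ?thesis by simp
  qed
  also have "F \<phi>q = (real q * real (card {p\<in>P. q dvd index_of_two p}) - real (card {p\<in>P. q dvd p - 1}))\<^sup>2"
  proof -
    have "(if p = q then 0 else \<phi>q (s p))
        = of_real (real q * of_bool (q dvd index_of_two p) - of_bool (q dvd p - 1))" if "p \<in> P" for p
    proof (cases "p = q")
      \<comment> \<open>At the ramified prime the character is 0 by convention. The formula agrees: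
        \<open>q\<close> does not divide \<open>q - 1\<close>, hence does not divide the index
        either.\<close>
      case True
      then have "\<not> q dvd p - 1" using q_gt_1 by (simp add: nat_dvd_not_less)
      then show ?thesis using True dvd_index_of_two_iff[of p q] P(2)[OF that] q_gt_1 by simp
    next
      case False
      note pp = P(2)[OF that]
      note fr = frob[OF pp[THEN conjunct1] pp[THEN conjunct2] False]
      note pf = pp[THEN conjunct1] pp[THEN conjunct2] False fr
      have "[int p = 1] (mod int q) \<longleftrightarrow> q dvd p - 1"
      proof -
        have e: "int p - 1 = int (p - 1)" using prime_gt_1_nat[OF pf(1)] by simp
        show ?thesis unfolding cong_iff_dvd_diff e by (rule int_dvd_int_iff)
      qed
      then have "[int (aN (s p)) = 1] (mod int q) \<longleftrightarrow> q dvd p - 1"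
        using aN_frobenius[OF pf] by (meson cong_sym cong_trans)
      then show ?thesis
        using False frobenius_in_Gal[OF pf] bN_frobenius[OF pf] dvd_index_of_two_iff[OF pf(1,2), of q] q_gt_1
        by (auto simp: \<phi>q_def of_nat_diff)
    qed
    then have "(\<Sum>p\<in>P. if p = q then 0 else \<phi>q (s p))
      = of_real (\<Sum>p\<in>P. real q * of_bool (q dvd index_of_two p) - of_bool (q dvd p - 1))"
      unfolding of_real_sum by (intro sum.cong refl)
    also have "(\<Sum>p\<in>P. real q * of_bool (q dvd index_of_two p) - of_bool (q dvd p - 1))
      = real q * real (card {p\<in>P. q dvd index_of_two p}) - real (card {p\<in>P. q dvd p - 1})"
      using P(1) by (simp add: sum_subtractf sum_distrib_left[symmetric] Int_def)
    finally show ?thesis unfolding F_def by (simp only: norm_of_real power2_abs)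
  qed
  finally show ?thesis by (simp add: F_def)
qed

end

section \<open>Summation over \<open>q\<close>\<close>

lemma finite_odd_primes_upto: "finite (odd_primes_upto x)"
  and odd_primes_upto_subset: "odd_primes_upto x \<subseteq> {1..nat \<lfloor>x\<rfloor>}"
proof -
  show "odd_primes_upto x \<subseteq> {1..nat \<lfloor>x\<rfloor>}"
    by (auto simp: odd_primes_upto_def le_nat_floor Suc_le_eq prime_gt_0_nat)
  then show "finite (odd_primes_upto x)" by (rule finite_subset) simp
qed

text \<open>Over the common denominator \<open>q r\<close> the difference has an integer numerator
  \<open>z\<close>, so only \<open>z \<noteq> 0\<close> is at stake: for \<open>q = r\<close>
  because \<open>|d - e| < q\<close>, otherwise because \<open>q\<close> would divide
  \<open>d\<close>.\<close>

lemma prime_fractions_spaced: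
  assumes q: "Factorial_Ring.prime q" "real q \<le> Q" "d \<in> {1..q - 1}"
    and r: "Factorial_Ring.prime r" "real r \<le> Q" "e \<in> {1..r - 1}"
    and ne: "(q, d) \<noteq> (r, e)"
  shows "1 / Q\<^sup>2 \<le> \<bar>real d / real q - real e / real r - of_int k\<bar>"
proof -
  have pos: "q > 0" "r > 0" using q(1) r(1) prime_gt_0_nat by auto
  define z where "z = int d * int r - int e * int q - k * int q * int r"
  have eq: "real d / real q - real e / real r - of_int k = of_int z / (real q * real r)"
    using pos by (simp add: z_def field_simps)
  have "z \<noteq> 0"
  proof
    assume z0: "z = 0"
    show False
    proof (cases "q = r")
      case True
      then have "int q * (int d - int e - k * int q) = 0" using z0 by (simp add: z_def algebra_simps)
      then have de: "int d - int e = k * int q" using pos by simp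
      have "\<bar>int d - int e\<bar> < int q" using q(3) r(3) True by auto
      have "k = 0"
      proof (rule ccontr)
        assume "k \<noteq> 0"
        then have "int q \<le> \<bar>k\<bar> * int q" using mult_right_mono[of 1 "\<bar>k\<bar>" "int q"] by simp
        then show False using \<open>\<bar>int d - int e\<bar> < int q\<close> by (simp add: de abs_mult)
      qed
      then show False using de ne True by simp
    next
      case False
      have "int d * int r = int q * (int e + k * int r)" using z0 by (simp add: z_def algebra_simps)
      then have "int q dvd int (d * r)" by simp
      then have "q dvd d * r" by (simp only: int_dvd_int_iff)
      moreover have "\<not> q dvd r" using False q(1) r(1) primes_dvd_imp_eq by blast
      ultimately have "q dvd d" using q(1) prime_dvd_mult_iff by blast
      then show False using q(3) pos by (auto dest: dvd_imp_le)
    qed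
  qed
  then have "1 \<le> \<bar>z\<bar>" by simp
  then have "1 \<le> \<bar>real_of_int z\<bar>" by linarith
  have "1 / Q\<^sup>2 \<le> 1 / (real q * real r)"
    using q r pos mult_mono[OF q(2) r(2)] by (intro divide_left_mono) (auto simp: power2_eq_square intro!: mult_pos_pos)
  also have "\<dots> \<le> \<bar>of_int z / (real q * real r)\<bar>"
    using \<open>1 \<le> \<bar>real_of_int z\<bar>\<close> pos by (simp add: abs_mult divide_right_mono)
  finally show ?thesis unfolding eq .
qed

text \<open>The coefficients are the indicator of \<open>P\<close>, whose square norm is
  \<open>|P|\<close>, and the spacing \<open>1 / Q^2\<close> turns \<open>34 / \<delta>\<close> into
  \<open>34 Q^2\<close>.\<close>

lemma prime_large_sieve:
  fixes x Q :: real
  assumes x: "x \<ge> 0" and Q: "Q > 0" and P: "P \<subseteq> {1..nat \<lfloor>x\<rfloor>}"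
  shows "(\<Sum>q\<in>odd_primes_upto Q. \<Sum>d=1..q - 1. (cmod (\<Sum>p\<in>P. e_unit (real p * real d / real q)))\<^sup>2)
    \<le> (4 * x + 34 * Q\<^sup>2 + 2) * real (card P)"
proof -
  let ?N = "nat \<lfloor>x\<rfloor>"
  let ?R = "Sigma (odd_primes_upto Q) (\<lambda>q. {1..q - 1})"
  let ?a = "\<lambda>n. of_bool (n \<in> P) :: complex"
  have PN: "P \<subseteq> {..?N}" using P by auto
  then have fin: "finite P" by (rule finite_subset) simp
  have int: "{..?N} \<inter> P = P" using PN by auto
  have sum_P: "(\<Sum>n\<le>?N. ?a n * f n) = (\<Sum>p\<in>P. f p)" for f :: "nat \<Rightarrow> complex"
    using PN by (intro sum.mono_neutral_cong_right) auto
  have "(\<Sum>q\<in>odd_primes_upto Q. \<Sum>d=1..q - 1. (cmod (\<Sum>p\<in>P. e_unit (real p * real d / real q)))\<^sup>2)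
    = (\<Sum>r\<in>?R. (cmod (\<Sum>n\<le>?N. ?a n * e_unit (real n * (real (snd r) / real (fst r)))))\<^sup>2)"
    unfolding sum_P by (subst sum.Sigma) (auto simp: finite_odd_primes_upto case_prod_unfold)
  also have "\<dots> \<le> (4 * real ?N + 34 / (1 / Q\<^sup>2) + 2) * (\<Sum>n\<le>?N. (cmod (?a n))\<^sup>2)"
  proof (rule large_sieve)
    fix r s k assume rs: "r \<in> ?R" "s \<in> ?R" "r \<noteq> s"
    then show "1 / Q\<^sup>2 \<le> \<bar>real (snd r) / real (fst r) - real (snd s) / real (fst s) - of_int k\<bar>"
      by (intro prime_fractions_spaced) (auto simp: odd_primes_upto_def prod_eq_iff)
  qed (use Q finite_odd_primes_upto in auto)
  also have "(\<Sum>n\<le>?N. (cmod (?a n))\<^sup>2) = (\<Sum>n\<le>?N. of_bool (n \<in> P))"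
    by (intro sum.cong) auto
  also have "\<dots> = real (card P)" by (simp add: int)
  also have "(4 * real ?N + 34 / (1 / Q\<^sup>2) + 2) * real (card P) \<le> (4 * x + 34 * Q\<^sup>2 + 2) * real (card P)"
    using x of_nat_floor[OF x] by (intro mult_right_mono) auto
  finally show ?thesis .
qed

theorem lemma11:
  fixes \<epsilon> :: real
  assumes "\<epsilon> > 0"
  shows "\<exists>K :: real. K > 0 \<and>
    (\<forall>(x :: real) (Q :: real) \<sigma>.
      x \<ge> 2 \<and> 1 \<le> Q \<and> Q \<le> x powr (1 - \<epsilon>) \<and> frobenius_choice \<sigma> \<longrightarrow>
      (\<Sum>q \<in> odd_primes_upto Q. \<Sum>\<phi> \<in> irr_chars (G_group q) - {trivial_char (G_group q)}.
          (cmod (\<Sum>p \<in> primed_primes x. char_at_frobenius \<sigma> q \<phi> p))\<^sup>2)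
      \<le> K * ((Q\<^sup>2 + x) * real (prime_pi x) +
             (\<Sum>q \<in> odd_primes_upto Q. \<Sum>c \<in> {1..q - 1}. \<Sum>d \<in> {1..q - 1}.
                (cmod (\<Sum>p \<in> primed_primes x.
                   e_unit ((real p * real d - real (index_of_two p) * real c) / real q)))\<^sup>2)))"
proof (intro exI[of _ 136] conjI allI impI)
  fix x Q :: real and \<sigma>
  assume asm: "x \<ge> 2 \<and> 1 \<le> Q \<and> Q \<le> x powr (1 - \<epsilon>) \<and> frobenius_choice \<sigma>"
  define P where "P = primed_primes x"
  define LS where "LS q = (\<Sum>d=1..q - 1. (cmod (\<Sum>p\<in>P. e_unit (real p * real d / real q)))\<^sup>2)" for q :: nat
  define T where "T q = (\<Sum>c \<in> {1..q - 1}. \<Sum>d \<in> {1..q - 1}.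
    (cmod (\<Sum>p \<in> P. e_unit ((real p * real d - real (index_of_two p) * real c) / real q)))\<^sup>2)" for q :: nat
  have Podd: "P \<subseteq> odd_primes_upto x" by (auto simp: P_def primed_primes_def)
  then have PN: "P \<subseteq> {1..nat \<lfloor>x\<rfloor>}" using odd_primes_upto_subset by blast
  have finP: "finite P" using Podd finite_odd_primes_upto finite_subset by blast
  have Pprime: "Factorial_Ring.prime p \<and> odd p" if "p \<in> P" for p
    using that Podd by (auto simp: odd_primes_upto_def)
  have local: "(\<Sum>\<phi> \<in> irr_chars (G_group q) - {trivial_char (G_group q)}.
      (cmod (\<Sum>p \<in> P. char_at_frobenius \<sigma> q \<phi> p))\<^sup>2)
    \<le> 4 * LS q + 12 * T q + 3 * (real (card P))\<^sup>2 * (1 / (real q)\<^sup>2)" if q: "q \<in> odd_primes_upto Q" for q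
  proof -
    interpret kummer q by unfold_locales (use q in \<open>auto simp: odd_primes_upto_def\<close>)
    have frob: "is_frobenius L p (\<sigma> q p)" if "Factorial_Ring.prime p" "odd p" "p \<noteq> q" for p
      using asm that prime_q odd_q by (auto simp: frobenius_choice_def)
    have "(\<Sum>\<phi> \<in> irr_chars (G_group q) - {trivial_char (G_group q)}.
        (cmod (\<Sum>p \<in> P. char_at_frobenius \<sigma> q \<phi> p))\<^sup>2)
      \<le> LS q + (real q * real (card {p\<in>P. q dvd index_of_two p}) - real (card {p\<in>P. q dvd p - 1}))\<^sup>2"
      unfolding char_at_frobenius_def LS_def by (rule frobenius_character_sums_le[OF frob finP Pprime])
    \<comment> \<open>One \<open>LS q\<close> comes from the linear characters and three from the
      nonlinear one, which together give the 4.\<close>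
    also have "\<dots> \<le> LS q + 3 * (LS q + 4 * T q + (real (card P) / real q)\<^sup>2)"
      unfolding LS_def T_def
    proof (intro add_left_mono nonlinear_character_sum_le finP)
      fix p assume p: "p \<in> P"
      then show "p > 0" using Pprime prime_gt_0_nat by blast
      show "q dvd index_of_two p \<Longrightarrow> q dvd p - 1"
        using dvd_index_of_two_iff[of p q] Pprime[OF p] q_gt_1 by simp
    qed
    finally show ?thesis by (simp add: power_divide)
  qed
  have card_pi: "real (card P) \<le> real (prime_pi x)"
    unfolding prime_pi_def of_nat_le_iff
  proof (rule card_mono)
    have "{p. Factorial_Ring.prime p \<and> real p \<le> x} \<subseteq> {..nat \<lfloor>x\<rfloor>}" by (auto simp: le_nat_floor)
    then show "finite {p. Factorial_Ring.prime p \<and> real p \<le> x}" by (rule finite_subset) simp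
    show "P \<subseteq> {p. Factorial_Ring.prime p \<and> real p \<le> x}" using Podd by (auto simp: odd_primes_upto_def)
  qed
  have card_x: "real (card P) \<le> x"
  proof -
    have "card P \<le> nat \<lfloor>x\<rfloor>" using card_mono[OF _ PN] by simp
    then show ?thesis using asm of_nat_floor[of x] by linarith
  qed
  have "(\<Sum>q \<in> odd_primes_upto Q. \<Sum>\<phi> \<in> irr_chars (G_group q) - {trivial_char (G_group q)}.
      (cmod (\<Sum>p \<in> P. char_at_frobenius \<sigma> q \<phi> p))\<^sup>2)
    \<le> (\<Sum>q \<in> odd_primes_upto Q. 4 * LS q + 12 * T q + 3 * (real (card P))\<^sup>2 * (1 / (real q)\<^sup>2))"
    by (intro sum_mono local)
  also have "\<dots> = 4 * (\<Sum>q \<in> odd_primes_upto Q. LS q) + 12 * (\<Sum>q \<in> odd_primes_upto Q. T q)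
      + 3 * (real (card P))\<^sup>2 * (\<Sum>q \<in> odd_primes_upto Q. 1 / (real q)\<^sup>2)"
    by (simp add: sum.distrib sum_distrib_left)
  \<comment> \<open>Of the two factors \<open>|P|\<close> one is bounded by \<open>x\<close> and the
    other by \<open>pi(x)\<close>; \<open>5 x\<close> absorbs \<open>4 x + 2\<close> since
    \<open>x >= 2\<close>.\<close>
  also have "\<dots> \<le> 4 * ((5 * x + 34 * Q\<^sup>2) * real (prime_pi x)) + 12 * (\<Sum>q \<in> odd_primes_upto Q. T q)
      + 3 * (x * real (prime_pi x)) * 2"
  proof (intro add_mono mult_mono mult_left_mono)
    have "(\<Sum>q \<in> odd_primes_upto Q. LS q) \<le> (4 * x + 34 * Q\<^sup>2 + 2) * real (card P)"
      unfolding LS_def using asm by (intro prime_large_sieve PN) auto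
    also have "\<dots> \<le> (5 * x + 34 * Q\<^sup>2) * real (prime_pi x)"
      using asm card_pi by (intro mult_mono) auto
    finally show "(\<Sum>q \<in> odd_primes_upto Q. LS q) \<le> (5 * x + 34 * Q\<^sup>2) * real (prime_pi x)" .
    show "(real (card P))\<^sup>2 \<le> x * real (prime_pi x)"
      unfolding power2_eq_square using card_pi card_x asm by (intro mult_mono) auto
    show "(\<Sum>q \<in> odd_primes_upto Q. 1 / (real q)\<^sup>2) \<le> 2"
      by (intro sum_inverse_square_le_2 finite_odd_primes_upto) (auto simp: odd_primes_upto_def)
  qed (use asm in \<open>auto simp: LS_def T_def intro!: sum_nonneg\<close>)
  \<comment> \<open>The coefficients are \<open>4 * 34 = 136\<close> at \<open>Q^2 pi(x)\<close>,
    \<open>4 * 5 + 3 * 2 = 26\<close> at \<open>x pi(x)\<close> and 12 at the double sums; the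
    largest serves for all three.\<close>
  also have "\<dots> \<le> 136 * ((Q\<^sup>2 + x) * real (prime_pi x) + (\<Sum>q \<in> odd_primes_upto Q. T q))"
  proof -
    have "0 \<le> (\<Sum>q \<in> odd_primes_upto Q. T q)" unfolding T_def by (intro sum_nonneg) auto
    moreover have "0 \<le> x * real (prime_pi x)" using asm by simp
    ultimately show ?thesis by (simp add: algebra_simps)
  qed
  finally show "(\<Sum>q \<in> odd_primes_upto Q. \<Sum>\<phi> \<in> irr_chars (G_group q) - {trivial_char (G_group q)}.
          (cmod (\<Sum>p \<in> primed_primes x. char_at_frobenius \<sigma> q \<phi> p))\<^sup>2)
      \<le> 136 * ((Q\<^sup>2 + x) * real (prime_pi x) +
             (\<Sum>q \<in> odd_primes_upto Q. \<Sum>c \<in> {1..q - 1}. \<Sum>d \<in> {1..q - 1}.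
                (cmod (\<Sum>p \<in> primed_primes x.
                   e_unit ((real p * real d - real (index_of_two p) * real c) / real q)))\<^sup>2))"
    by (simp only: P_def T_def)
qed simp

end
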